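(* Let $\nu$ be a measure on $(0,\infty)$, let $n\in\mathbb N$ and $\sigma_1,\dots,\sigma_n\in(0,\infty)$. Let $\boldsymbol J=\{J_\ell\}_{\ell\in\mathbb N}$ be a measurable enumeration of the points of a Poisson point process on $(0,\infty)$ with intensity measure $\nu$, and let $\boldsymbol Y_\ell=(Y_{\ell,1},\dots,Y_{\ell,n})$, $\ell\in\mathbb N$, be i.i.d. random vectors, independent of $\boldsymbol J$, such that for each $\ell$ the components $Y_{\ell,1},\dots,Y_{\ell,n}$ are independent and $Y_{\ell,k}$ is $1$-Fréchet with scale parameter $\sigma_k$. Let $\Pi_n$ be the hitting partition of $[n]=\{1,\dots,n\}$ associated with the sub-Fréchet max-i.d. random vector with Lévy measure $\nu$, $$(\zeta_1,\dots,\zeta_n)=\Big(\bigvee_{\ell=1}^\infty J_\ell Y_{\ell,1},\dots,\bigvee_{\ell=1}^\infty J_\ell Y_{\ell,n}\Big).$$ Then: (i) if $\nu(dw)=\alpha w^{-\alpha-1}dw$ with $\alpha\in(0,1)$, then $\Pi_n$ is a $\mathrm{PD}(\alpha,0)$ partition of $[n]$; (ii) if $\nu(dw)=\theta w^{-1}e^{-w}dw$ with $\theta>0$, then $\Pi_n$ is a $\mathrm{PD}(0,\theta)$ partition of $[n]$.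
   Context: Notation: $\mathbb N=\{1,2,\dots\}$; $\bigvee$ denotes supremum. A random variable $Y$ is $1$-Fréchet with scale parameter $\sigma>0$ if $\mathbb P(Y\le x)=\exp(-\sigma/x)$ for $x\in(0,\infty)$. Both measures in (i) and (ii) satisfy $\nu((0,\infty))=\infty$ and $\int_0^\infty(1\wedge x)\,\nu(dx)<\infty$, so that the Poisson process has infinitely many points and $\sum_\ell J_\ell<\infty$ almost surely. Hitting partition: for $k=1,\dots,n$ set $\ell^*(k):=\mathrm{argmax}_{\ell\in\mathbb N}\{J_\ell Y_{\ell,k}\}$, which is uniquely defined with probability one. The hitting partition $\Pi_n$ is the random partition of $[n]$ into the equivalence classes of the relation $i\sim j$ if and only if $\ell^*(i)=\ell^*(j)$, $i,j\in[n]$. $\mathrm{PD}(\alpha,\theta)$ partition of $[n]$ (Poisson–Dirichlet partition; here $\alpha\in[0,1)$ and $\theta>-\alpha$): the random partition of $[n]$ which equals any given partition of $[n]$ with block sizes $n_1,\dots,n_k\ge 1$ ($n_1+\cdots+n_k=n$) with probability $$p_{\alpha,\theta}(n_1,\dots,n_k)=\frac{(\theta+\alpha)_{k-1\uparrow\alpha}\prod_{i=1}^k(1-\alpha)_{n_i-1\uparrow1}}{(\theta+1)_{n-1\uparrow1}},\qquad (x)_{m\uparrow\beta}:=\prod_{j=0}^{m-1}(x+j\beta),$$ with empty products equal to $1$. *)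

theory Defs
  imports "HOL-Probability.Probability"
begin

text \<open>Independence of two random elements of possibly different types
  (\<open>indep_var\<close> needs both values in the same type): independence of the
  generated sigma-algebras.\<close>

definition indep_rvs ::
    "'a measure \<Rightarrow> 'b measure \<Rightarrow> ('a \<Rightarrow> 'b) \<Rightarrow> 'c measure \<Rightarrow> ('a \<Rightarrow> 'c) \<Rightarrow> bool" where
  "indep_rvs M N X N' X' \<longleftrightarrow>
     X \<in> measurable M N \<and> X' \<in> measurable M N' \<and>
     prob_space.indep_set M (sets (vimage_algebra (space M) X N)) (sets (vimage_algebra (space M) X' N'))"

definition point_count :: "(nat \<Rightarrow> 'a \<Rightarrow> 'b) \<Rightarrow> 'b set \<Rightarrow> 'a \<Rightarrow> ennreal" where
  "point_count J A \<omega> = emeasure (count_space UNIV) {l. J l \<omega> \<in> A}"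

text \<open>The points are listed with multiplicity by \<open>J\<close>, indexed from 0.
  The Poisson law is written out because \<open>poisson_pmf\<close> excludes the rate 0;
  the Poisson law of rate \<open>\<infinity>\<close> is the point mass at \<open>\<infinity>\<close>.\<close>

definition poisson_process_enumeration ::
    "'a measure \<Rightarrow> 'b measure \<Rightarrow> (nat \<Rightarrow> 'a \<Rightarrow> 'b) \<Rightarrow> bool" where
  "poisson_process_enumeration M \<nu> J \<longleftrightarrow>
     (\<forall>l. J l \<in> measurable M \<nu>) \<and>
     (\<forall>A\<in>sets \<nu>. emeasure \<nu> A < \<infinity> \<longrightarrow>
        (\<forall>k::nat. measure M {\<omega>\<in>space M. point_count J A \<omega> = of_nat k} =
           measure \<nu> A ^ k / fact k * exp (- measure \<nu> A))) \<and>
     (\<forall>A\<in>sets \<nu>. emeasure \<nu> A = \<infinity> \<longrightarrow> (AE \<omega> in M. point_count J A \<omega> = \<infinity>)) \<and>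
     (\<forall>(I::nat set) A. finite I \<and> A ` I \<subseteq> sets \<nu> \<and> disjoint_family_on A I \<longrightarrow>
        prob_space.indep_vars M (\<lambda>_. borel) (\<lambda>i. point_count J (A i)) I)"

definition frechet1 :: "'a measure \<Rightarrow> real \<Rightarrow> ('a \<Rightarrow> real) \<Rightarrow> bool" where
  "frechet1 M \<sigma> Y \<longleftrightarrow> Y \<in> borel_measurable M \<and>
     (\<forall>x>0. measure M {\<omega>\<in>space M. Y \<omega> \<le> x} = exp (- \<sigma> / x))"

text \<open>An index \<open>l\<close> at which the supremum \<open>\<zeta> k = (\<Squnion>l. J l * Y l k)\<close> is attained.
  In the setting of interest it is almost surely unique. On the exceptional null set the least
  one is taken (a fixed unspecified index if there is none), which, unlike the choice made by
  \<open>arg_max\<close>, is measurable in \<open>\<omega>\<close>.\<close>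

definition hitting_index ::
    "(nat \<Rightarrow> 'a \<Rightarrow> real) \<Rightarrow> (nat \<Rightarrow> nat \<Rightarrow> 'a \<Rightarrow> real) \<Rightarrow> nat \<Rightarrow> 'a \<Rightarrow> nat" where
  "hitting_index J Y k \<omega> = (LEAST l. is_arg_max (\<lambda>l. J l \<omega> * Y l k \<omega>) (\<lambda>_. True) l)"

definition hitting_partition ::
    "nat \<Rightarrow> (nat \<Rightarrow> 'a \<Rightarrow> real) \<Rightarrow> (nat \<Rightarrow> nat \<Rightarrow> 'a \<Rightarrow> real) \<Rightarrow> 'a \<Rightarrow> nat set set" where
  "hitting_partition n J Y \<omega> =
     {1..n} // {(i, j). i \<in> {1..n} \<and> j \<in> {1..n} \<and> hitting_index J Y i \<omega> = hitting_index J Y j \<omega>}"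

definition rising :: "real \<Rightarrow> nat \<Rightarrow> real \<Rightarrow> real" where
  "rising x m \<beta> = (\<Prod>j<m. x + real j * \<beta>)"

definition pd_prob :: "real \<Rightarrow> real \<Rightarrow> nat list \<Rightarrow> real" where
  "pd_prob \<alpha> \<theta> ns =
     rising (\<theta> + \<alpha>) (length ns - 1) \<alpha> * (\<Prod>m\<leftarrow>ns. rising (1 - \<alpha>) (m - 1) 1) /
     rising (\<theta> + 1) (sum_list ns - 1) 1"

text \<open>A partition is presented by an arbitrary enumeration \<open>bs\<close> of its blocks.\<close>

definition pd_partition ::
    "'a measure \<Rightarrow> real \<Rightarrow> real \<Rightarrow> nat \<Rightarrow> ('a \<Rightarrow> nat set set) \<Rightarrow> bool" where
  "pd_partition M \<alpha> \<theta> n X \<longleftrightarrow>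
     0 \<le> \<alpha> \<and> \<alpha> < 1 \<and> - \<alpha> < \<theta> \<and>
     X \<in> measurable M (count_space {P. partition_on {1..n} P}) \<and>
     (\<forall>bs. distinct bs \<and> partition_on {1..n} (set bs) \<longrightarrow>
        measure M {\<omega>\<in>space M. X \<omega> = set bs} = pd_prob \<alpha> \<theta> (map card bs))"

end

theory Submission
  imports Defs
begin

text \<open>Let \<open>S = (\<Sum>l. J l)\<close>. Given \<open>J\<close>, the indices \<open>hitting_index J Y k\<close> are independent in \<open>k\<close>
  and equal \<open>l\<close> with probability \<open>J l / S\<close>, whatever the scale: a race of Frechet variables.
  Hence a partition \<open>P\<close> of \<open>{1..n}\<close> is hit with probability
  \<open>E (\<Sum>s. \<Prod>B\<in>P. J (s B) ^ card B) / S ^ n\<close>, where \<open>s\<close> ranges over the injective maps from the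
  blocks to the indices. Writing \<open>1 / S ^ n\<close> as the integral of \<open>t ^ (n - 1) / (n - 1)! * exp (- t S)\<close>,
  the multivariate Mecke formula factorises the expectation for fixed \<open>t\<close> into
  \<open>(\<Prod>B\<in>P. \<kappa> (card B) t) * exp (- \<psi> t)\<close> with \<open>\<kappa> m t = \<integral> w ^ m * exp (- t w) d\<nu>\<close> and
  \<open>\<psi> t = \<integral> 1 - exp (- t w) d\<nu>\<close>. For the two measures these are explicit, and the remaining
  integral over \<open>t\<close> is a Gamma or a Beta integral.\<close>

subsection \<open>The Laplace functional of a Poisson process\<close>

text \<open>The hypotheses on \<open>J\<close> concern only the counts
  \<open>point_count J A\<close>, so whatever is needed about the points has to be extracted from
  their Laplace functional. The denominator \<open>S ^ n\<close> couples all the points; its Gamma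
  integral replaces it by the weight exp (- t S), which is multiplicative over the points and which
  a Laplace functional can absorb. Sums over distinct indices are then generated one factor at a
  time by differentiating the functional. Expectations stay in \<open>ennreal\<close>, where sums,
  integrals and expectations can be exchanged without integrability conditions; real integrals enter
  where a derivative is taken. Finiteness of S is not a hypothesis: it follows from \<psi> t
  \<longrightarrow> 0 as t decreases to 0. The last integral closes up because the dependence of the
  product of the \<kappa> on t involves the partition only through n and the number k of blocks: the
  powers of t combine to the exponent k \<alpha> - 1 in the stable case, and in the Gamma case there
  are n factors 1 / (1 + t).\<close>

definition exp_neg :: "ennreal \<Rightarrow> ennreal" where
  "exp_neg y = (if y = \<top> then 0 else ennreal (exp (- enn2real y)))"

lemma exp_neg_ennreal: "0 \<le> r \<Longrightarrow> exp_neg (ennreal r) = ennreal (exp (- r))"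
  by (simp add: exp_neg_def)

text \<open>The value 0 at \<top> makes Laplace functionals meaningful before the point sums are
  known to be finite, and makes them detect the event that a sum is infinite.\<close>

lemma exp_neg_top [simp]: "exp_neg \<top> = 0"
  and exp_neg_0 [simp]: "exp_neg 0 = 1"
  by (simp_all add: exp_neg_def)

lemma exp_neg_add: "exp_neg (a + b) = exp_neg a * exp_neg b"
  by (cases a; cases b)
     (simp_all add: exp_neg_ennreal mult_exp_exp flip: ennreal_plus ennreal_mult)

lemma exp_neg_sum: "finite I \<Longrightarrow> exp_neg (\<Sum>i\<in>I. f i) = (\<Prod>i\<in>I. exp_neg (f i))"
  by (induction I rule: finite_induct) (simp_all add: exp_neg_add)

lemma exp_neg_antimono: "a \<le> b \<Longrightarrow> exp_neg b \<le> exp_neg a"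
  by (cases a; cases b) (simp_all add: exp_neg_ennreal ennreal_leI top_unique)

lemma exp_neg_le_1: "exp_neg a \<le> 1"
  using exp_neg_antimono[of 0 a] by simp

lemma exp_neg_less_top: "exp_neg a < \<top>"
  using exp_neg_le_1[of a] by (simp add: le_less_trans)

lemma exp_neg_measurable [measurable]: "exp_neg \<in> borel_measurable borel"
  unfolding exp_neg_def by measurable

text \<open>Continuity on all of [0, \<infinity>] carries Laplace functionals through limits that
  may reach \<top>. Below \<top> it is inherited from the real exponential; at \<top> it amounts to
  decay of the exponential.\<close>

lemma tendsto_exp_neg:
  assumes "(f \<longlongrightarrow> a) F"
  shows "((\<lambda>x. exp_neg (f x)) \<longlongrightarrow> exp_neg a) F"
proof (cases "a = \<top>")
  case False
  then obtain r where r: "0 \<le> r" "a = ennreal r" by (cases a) auto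
  have "eventually (\<lambda>x. f x < \<top>) F"
    using assms False by (intro order_tendstoD) (auto simp: top.not_eq_extremum)
  moreover have "((\<lambda>x. ennreal (exp (- enn2real (f x)))) \<longlongrightarrow> exp_neg a) F"
    using r assms by (auto simp: exp_neg_ennreal intro!: tendsto_intros tendsto_enn2real)
  ultimately show ?thesis
    by (rule_tac Lim_transform_eventually) (auto elim!: eventually_mono simp: exp_neg_def)
next
  case True
  show ?thesis
  proof (rule order_tendstoI)
    fix c :: ennreal assume c: "exp_neg a < c"
    show "eventually (\<lambda>x. exp_neg (f x) < c) F"
    proof -
      obtain d where d: "0 < d" "d < c" using c True by (metis exp_neg_top dense)
      then have "d < \<top>" by (metis le_less_trans less_le_not_le top_greatest top.not_eq_extremum)
      with d obtain e where e: "0 < e" "ennreal e < c" by (cases d) (auto simp: ennreal_less_zero_iff)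
      \<comment> \<open>Chosen so that exp (- K) \<le> e < c. The maximum with 0 is there because
        \<open>ennreal\<close> sends negative reals to 0.\<close>
      define K where "K = max 0 (- ln e)"
      have "eventually (\<lambda>x. ennreal K < f x) F"
        using assms True by (intro order_tendstoD) auto
      then show ?thesis
      proof eventually_elim
        case (elim x)
        have "exp_neg (f x) \<le> exp_neg (ennreal K)"
          using elim by (intro exp_neg_antimono) auto
        also have "\<dots> = ennreal (exp (- K))" unfolding K_def by (rule exp_neg_ennreal) simp
        also have "exp (- K) \<le> exp (ln e)" unfolding K_def by (subst exp_le_cancel_iff) auto
        also have "\<dots> = e" using e by simp
        finally show ?case using e by (meson ennreal_leI le_less_trans order_trans)
      qed
    qed
  qed (use True in auto)
qed

text \<open>The integral of \<open>f\<close> against the point process, that is, against the sum of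
  the unit masses at the points \<open>J l\<close>, with multiplicity.\<close>

definition point_sum :: "(nat \<Rightarrow> 'a \<Rightarrow> 'b) \<Rightarrow> ('b \<Rightarrow> ennreal) \<Rightarrow> 'a \<Rightarrow> ennreal" where
  "point_sum J f \<omega> = (\<Sum>l. f (J l \<omega>))"

lemma point_count_eq_point_sum: "point_count J A = point_sum J (indicator A)"
proof
  fix \<omega>
  have "point_count J A \<omega> = (\<integral>\<^sup>+l. indicator {l. J l \<omega> \<in> A} l \<partial>count_space UNIV)"
    unfolding point_count_def by simp
  also have "\<dots> = point_sum J (indicator A) \<omega>"
    unfolding point_sum_def
    by (subst nn_integral_count_space_nat) (auto simp: indicator_def intro!: suminf_cong)
  finally show "point_count J A \<omega> = point_sum J (indicator A) \<omega>" .
qed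

lemma point_sum_measurable [measurable]:
  assumes [measurable]: "\<And>l. J l \<in> measurable M N" "f \<in> borel_measurable N"
  shows "point_sum J f \<in> borel_measurable M"
  unfolding point_sum_def by measurable

lemma point_sum_add: "point_sum J (\<lambda>x. f x + g x) \<omega> = point_sum J f \<omega> + point_sum J g \<omega>"
  unfolding point_sum_def by (rule suminf_add[symmetric]) auto

lemma point_sum_cmult: "point_sum J (\<lambda>x. c * f x) \<omega> = c * point_sum J f \<omega>"
  unfolding point_sum_def by (rule ennreal_suminf_cmult)

lemma point_sum_sum: "point_sum J (\<lambda>x. \<Sum>i\<in>I. f i x) \<omega> = (\<Sum>i\<in>I. point_sum J (f i) \<omega>)"
  unfolding point_sum_def by (rule suminf_sum) auto

lemma nn_integral_exp_neg_poisson: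
  assumes "prob_space M" and [measurable]: "N \<in> borel_measurable M"
    and "0 \<le> r" "0 \<le> c"
    and N: "\<And>k::nat. measure M {\<omega>\<in>space M. N \<omega> = of_nat k} = r ^ k / fact k * exp (- r)"
  shows "(\<integral>\<^sup>+\<omega>. exp_neg (ennreal c * N \<omega>) \<partial>M) = ennreal (exp (- (r * (1 - exp (- c)))))"
proof -
  interpret prob_space M by fact
  let ?E = "\<lambda>k. {\<omega>\<in>space M. N \<omega> = of_nat k}"
  have [measurable]: "?E k \<in> sets M" for k by measurable
  have disj: "disjoint_family ?E" by (auto simp: disjoint_family_on_def)
  have exps: "(\<lambda>k. x ^ k / fact k) sums exp x" for x :: real
    using exp_converges[of x] by (simp add: divide_inverse mult.commute)
  \<comment> \<open>The masses at the finite values add up to 1, so \<open>N\<close> is almost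
    surely finite although the hypothesis does not speak of the event that it is infinite.\<close>
  have s1: "(\<lambda>k. measure M (?E k)) sums 1"
    using sums_mult2[OF exps[of r], of "exp (- r)"] by (simp add: N flip: exp_add)
  have "measure M (\<Union>k. ?E k) = 1"
    using finite_measure_UNION[OF _ disj] s1 by (simp add: sums_iff image_subset_iff)
  then have ae: "AE \<omega> in M. \<exists>k. N \<omega> = of_nat k"
    by (subst (asm) prob_eq_1) auto
  have "(\<integral>\<^sup>+\<omega>. exp_neg (ennreal c * N \<omega>) \<partial>M) =
      (\<integral>\<^sup>+\<omega>. (\<Sum>k. ennreal (exp (- (c * real k))) * indicator (?E k) \<omega>) \<partial>M)"
  proof (rule nn_integral_cong_AE, rule AE_mp[OF ae], rule AE_I2, rule impI)
    fix \<omega> assume w: "\<omega> \<in> space M" and "\<exists>k. N \<omega> = of_nat k"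
    then obtain k where k: "N \<omega> = of_nat k" by auto
    have "(\<Sum>i. ennreal (exp (- (c * real i))) * indicator (?E i) \<omega>) =
        (\<Sum>i\<in>{k}. ennreal (exp (- (c * real i))) * indicator (?E i) \<omega>)"
      by (rule suminf_finite) (auto simp: k)
    also have "\<dots> = ennreal (exp (- (c * real k)))" using w k by simp
    also have "\<dots> = exp_neg (ennreal c * N \<omega>)"
      using assms(4) exp_neg_ennreal[of "c * real k"]
      by (simp add: k ennreal_mult ennreal_of_nat_eq_real_of_nat)
    finally show "exp_neg (ennreal c * N \<omega>) =
        (\<Sum>k. ennreal (exp (- (c * real k))) * indicator (?E k) \<omega>)" ..
  qed
  also have "\<dots> = (\<Sum>k. ennreal (exp (- (c * real k))) * emeasure M (?E k))"
    by (subst nn_integral_suminf) (auto simp: nn_integral_cmult_indicator)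
  also have "\<dots> = (\<Sum>k. ennreal ((r * exp (- c)) ^ k / fact k * exp (- r)))"
    by (intro suminf_cong)
       (simp add: emeasure_eq_measure N \<open>0 \<le> r\<close> power_mult_distrib mult_ac exp_of_nat_mult
          flip: ennreal_mult exp_of_nat_mult)
  also have "\<dots> = ennreal (exp (r * exp (- c)) * exp (- r))"
    using sums_mult2[OF exps[of "r * exp (- c)"], of "exp (- r)"] \<open>0 \<le> r\<close>
    by (intro suminf_ennreal_eq) auto
  also have "exp (r * exp (- c)) * exp (- r) = exp (- (r * (1 - exp (- c))))"
    by (simp add: algebra_simps flip: exp_add)
  finally show ?thesis .
qed

locale poisson_points = prob_space M for M :: "'a measure" +
  fixes \<nu> :: "'b measure" and J :: "nat \<Rightarrow> 'a \<Rightarrow> 'b"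
  assumes enumeration: "poisson_process_enumeration M \<nu> J"
begin

lemma points_measurable [measurable]: "J l \<in> measurable M \<nu>"
  using enumeration by (simp add: poisson_process_enumeration_def)

lemma point_count_measurable [measurable]:
  "A \<in> sets \<nu> \<Longrightarrow> point_count J A \<in> borel_measurable M"
  unfolding point_count_eq_point_sum
  by (rule point_sum_measurable) (auto intro: borel_measurable_indicator)

text \<open>Counts of disjoint sets are independent and Poisson, so the expectation is a product of
  Poisson Laplace transforms. The indices are naturals because that is how
  \<open>poisson_process_enumeration\<close> provides independence.\<close>

lemma laplace_simple_sum:
  fixes I :: "nat set"
  assumes I: "finite I" and A: "\<And>i. i \<in> I \<Longrightarrow> A i \<in> sets \<nu>" "\<And>i. i \<in> I \<Longrightarrow> emeasure \<nu> (A i) < \<infinity>"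
    and disj: "disjoint_family_on A I" and c: "\<And>i. i \<in> I \<Longrightarrow> 0 \<le> c i"
  shows "(\<integral>\<^sup>+\<omega>. exp_neg (\<Sum>i\<in>I. ennreal (c i) * point_count J (A i) \<omega>) \<partial>M) =
    exp_neg (\<Sum>i\<in>I. (1 - exp_neg (ennreal (c i))) * emeasure \<nu> (A i))"
proof -
  have ind: "indep_vars (\<lambda>_. borel) (\<lambda>i. point_count J (A i)) I"
    using enumeration I A disj unfolding poisson_process_enumeration_def by blast
  have "(\<integral>\<^sup>+\<omega>. exp_neg (\<Sum>i\<in>I. ennreal (c i) * point_count J (A i) \<omega>) \<partial>M) =
      (\<integral>\<^sup>+\<omega>. (\<Prod>i\<in>I. exp_neg (ennreal (c i) * point_count J (A i) \<omega>)) \<partial>M)"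
    using I by (simp add: exp_neg_sum)
  also have "\<dots> = (\<Prod>i\<in>I. \<integral>\<^sup>+\<omega>. exp_neg (ennreal (c i) * point_count J (A i) \<omega>) \<partial>M)"
    by (intro indep_vars_nn_integral indep_vars_compose2[OF ind] I) auto
  also have "\<dots> = (\<Prod>i\<in>I. exp_neg ((1 - exp_neg (ennreal (c i))) * emeasure \<nu> (A i)))"
  proof (rule prod.cong)
    fix i assume i: "i \<in> I"
    have "(\<integral>\<^sup>+\<omega>. exp_neg (ennreal (c i) * point_count J (A i) \<omega>) \<partial>M) =
        ennreal (exp (- (measure \<nu> (A i) * (1 - exp (- c i)))))"
      using i A c enumeration
      by (intro nn_integral_exp_neg_poisson prob_space_axioms point_count_measurable)
         (auto simp: poisson_process_enumeration_def)
    also have "\<dots> = exp_neg ((1 - exp_neg (ennreal (c i))) * emeasure \<nu> (A i))"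
    proof -
      have "emeasure \<nu> (A i) = ennreal (measure \<nu> (A i))"
        using A(2)[OF i] by (simp add: emeasure_eq_ennreal_measure)
      then have "(1 - exp_neg (ennreal (c i))) * emeasure \<nu> (A i) =
          ennreal (measure \<nu> (A i) * (1 - exp (- c i)))"
        using c[OF i] by (simp add: exp_neg_ennreal ennreal_minus mult.commute
            flip: ennreal_1 ennreal_mult)
      then show ?thesis using c[OF i] by (simp add: exp_neg_ennreal)
    qed
    finally show "(\<integral>\<^sup>+\<omega>. exp_neg (ennreal (c i) * point_count J (A i) \<omega>) \<partial>M) =
      exp_neg ((1 - exp_neg (ennreal (c i))) * emeasure \<nu> (A i))" .
  qed simp
  finally show ?thesis using I by (simp add: exp_neg_sum)
qed

lemma laplace_simple_function:
  assumes g: "simple_function \<nu> g" and top: "\<And>x. g x < \<top>"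
    and fin: "emeasure \<nu> {x\<in>space \<nu>. g x \<noteq> 0} < \<infinity>"
  shows "(\<integral>\<^sup>+\<omega>. exp_neg (point_sum J g \<omega>) \<partial>M) = exp_neg (\<integral>\<^sup>+x. 1 - exp_neg (g x) \<partial>\<nu>)"
proof -
  define R where "R = g ` space \<nu> - {0}"
  have finR: "finite R" using g by (simp add: R_def simple_function_def)
  \<comment> \<open>Numbers the nonzero values of \<open>g\<close> by naturals, the index type of
    \<open>laplace_simple_sum\<close>.\<close>
  from ex_bij_betw_nat_finite[OF finR] obtain h where h: "bij_betw h {0..<card R} R" by auto
  define I where "I = {0..<card R}"
  define A where "A i = {x\<in>space \<nu>. g x = h i}" for i
  have [measurable]: "g \<in> borel_measurable \<nu>" using g by (rule borel_measurable_simple_function)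
  have hR: "h i \<in> R" if "i \<in> I" for i using h that by (auto simp: I_def bij_betw_def)
  have hinj: "i = j" if "i \<in> I" "j \<in> I" "h i = h j" for i j
    using h that by (auto simp: I_def bij_betw_def inj_on_def)
  have htop: "h i < \<top>" "h i \<noteq> 0" if "i \<in> I" for i using hR[OF that] top by (auto simp: R_def)
  have Am: "A i \<in> sets \<nu>" for i unfolding A_def by measurable
  have disj: "disjoint_family_on A I"
    unfolding disjoint_family_on_def A_def using hinj by auto
  have Afin: "emeasure \<nu> (A i) < \<infinity>" if "i \<in> I" for i
  proof -
    have "emeasure \<nu> (A i) \<le> emeasure \<nu> {x\<in>space \<nu>. g x \<noteq> 0}"
      using htop[OF that] by (intro emeasure_mono) (auto simp: A_def)
    then show ?thesis using fin by (rule le_less_trans)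
  qed
  \<comment> \<open>General in \<open>u\<close> because two cases are needed: the identity, under
    the point sum, and 1 - \<open>exp_neg\<close>, under the integral with respect to \<nu>.\<close>
  have gsum: "u (g x) = (\<Sum>i\<in>I. u (h i) * indicator (A i) x)"
    if x: "x \<in> space \<nu>" and u: "u 0 = 0" for x and u :: "ennreal \<Rightarrow> ennreal"
  proof (cases "g x = 0")
    case True
    then show ?thesis using u htop
      by (auto simp: A_def indicator_def intro!: sum.neutral[symmetric])
  next
    case False
    then have "g x \<in> R" using x by (auto simp: R_def)
    then have "g x \<in> h ` I" using h by (simp add: I_def bij_betw_def)
    then obtain i where i: "i \<in> I" "h i = g x" by auto
    have "(\<Sum>i\<in>I. u (h i) * indicator (A i) x) = (\<Sum>j\<in>{i}. u (h j) * indicator (A j) x)"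
      using i x hinj by (intro sum.mono_neutral_right) (auto simp: I_def A_def indicator_def)
    then show ?thesis using i x by (simp add: A_def)
  qed
  define c where "c i = enn2real (h i)" for i
  have hc: "h i = ennreal (c i)" "0 \<le> c i" if "i \<in> I" for i
    using htop[OF that] by (auto simp: c_def)
  have "(\<integral>\<^sup>+\<omega>. exp_neg (point_sum J g \<omega>) \<partial>M) =
      (\<integral>\<^sup>+\<omega>. exp_neg (\<Sum>i\<in>I. ennreal (c i) * point_count J (A i) \<omega>) \<partial>M)"
  proof (rule nn_integral_cong)
    fix \<omega> assume w: "\<omega> \<in> space M"
    have "point_sum J g \<omega> = point_sum J (\<lambda>x. \<Sum>i\<in>I. h i * indicator (A i) x) \<omega>"
      unfolding point_sum_def using gsum[of _ "\<lambda>x. x"] measurable_space[OF points_measurable w]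
      by (intro suminf_cong) auto
    also have "\<dots> = (\<Sum>i\<in>I. ennreal (c i) * point_count J (A i) \<omega>)"
      unfolding point_count_eq_point_sum point_sum_sum point_sum_cmult using hc by simp
    finally show "exp_neg (point_sum J g \<omega>) =
        exp_neg (\<Sum>i\<in>I. ennreal (c i) * point_count J (A i) \<omega>)" by simp
  qed
  also have "\<dots> = exp_neg (\<Sum>i\<in>I. (1 - exp_neg (ennreal (c i))) * emeasure \<nu> (A i))"
    using Am Afin disj hc by (intro laplace_simple_sum) (auto simp: I_def)
  also have "(\<Sum>i\<in>I. (1 - exp_neg (ennreal (c i))) * emeasure \<nu> (A i)) =
      (\<integral>\<^sup>+x. (\<Sum>i\<in>I. (1 - exp_neg (h i)) * indicator (A i) x) \<partial>\<nu>)"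
    using Am hc by (subst nn_integral_sum) (auto simp: nn_integral_cmult_indicator)
  also have "\<dots> = (\<integral>\<^sup>+x. 1 - exp_neg (g x) \<partial>\<nu>)"
    using gsum[of _ "\<lambda>x. 1 - exp_neg x"] by (intro nn_integral_cong) simp
  finally show ?thesis .
qed

text \<open>Approximation from below by simple functions with support of finite measure. The left
  side converges by dominated convergence with bound 1 on a probability space, the right side by
  monotone convergence of 1 - \<open>exp_neg\<close>, followed by continuity of
  \<open>exp_neg\<close>.\<close>

theorem laplace_functional:
  assumes sf: "sigma_finite_measure \<nu>" and g [measurable]: "g \<in> borel_measurable \<nu>"
  shows "(\<integral>\<^sup>+\<omega>. exp_neg (point_sum J g \<omega>) \<partial>M) = exp_neg (\<integral>\<^sup>+x. 1 - exp_neg (g x) \<partial>\<nu>)"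
proof -
  from sigma_finite_measure.sigma_finite_incseq[OF sf] obtain K
    where K: "range K \<subseteq> sets \<nu>" "(\<Union>i. K i) = space \<nu>" "\<And>i::nat. emeasure \<nu> (K i) \<noteq> \<infinity>" "incseq K"
    by blast
  have Km [measurable]: "K i \<in> sets \<nu>" for i using K by auto
  from borel_measurable_implies_simple_function_sequence'[OF g] obtain u
    where u: "\<And>i. simple_function \<nu> (u i)" "incseq u" "\<And>i x. u i x < top" "\<And>x. (SUP i. u i x) = g x"
    by blast
  have [measurable]: "u i \<in> borel_measurable \<nu>" for i
    using u(1) by (rule borel_measurable_simple_function)
  \<comment> \<open>Cutting off at \<open>K i\<close> gives a support of finite measure; the
    sequence still increases because \<open>K\<close> does.\<close>
  define v where "v i x = u i x * indicator (K i) x" for i x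
  have vs: "simple_function \<nu> (v i)" for i
    unfolding v_def by (intro simple_function_mult u simple_function_indicator Km)
  have [measurable]: "v i \<in> borel_measurable \<nu>" for i
    unfolding v_def by measurable
  have vinc: "incseq v"
  proof -
    have "v m x \<le> v n x" if "m \<le> n" for m n x
    proof (cases "x \<in> K m")
      case True
      then have "x \<in> K n" using incseqD[OF K(4) that] by auto
      then show ?thesis using True incseqD[OF u(2) that] by (simp add: v_def le_fun_def)
    qed (simp add: v_def)
    then show ?thesis by (simp add: incseq_def le_fun_def)
  qed
  have vlim: "(\<lambda>i. v i x) \<longlonglongrightarrow> g x" if x: "x \<in> space \<nu>" for x
  proof -
    obtain m where m: "x \<in> K m" using x K(2) by blast
    have "eventually (\<lambda>i. u i x = v i x) sequentially"
      using eventually_ge_at_top[of m]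
    proof eventually_elim
      case (elim i)
      then have "x \<in> K i" using m K(4) by (auto simp: incseq_def)
      then show ?case by (simp add: v_def)
    qed
    moreover have "(\<lambda>i. u i x) \<longlonglongrightarrow> g x"
      using LIMSEQ_SUP[of "\<lambda>i. u i x"] u(2,4) by (simp add: incseq_def le_fun_def)
    ultimately show ?thesis by (rule Lim_transform_eventually[rotated])
  qed
  have vinc': "incseq (\<lambda>i. v i x)" for x using vinc by (auto simp: incseq_def le_fun_def)
  have vlap: "(\<integral>\<^sup>+\<omega>. exp_neg (point_sum J (v i) \<omega>) \<partial>M) = exp_neg (\<integral>\<^sup>+x. 1 - exp_neg (v i x) \<partial>\<nu>)" for i
  proof (rule laplace_simple_function[OF vs])
    show "v i x < \<top>" for x using u(3)[of i x] by (simp add: v_def indicator_def)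
    have "emeasure \<nu> {x \<in> space \<nu>. v i x \<noteq> 0} \<le> emeasure \<nu> (K i)"
      by (intro emeasure_mono) (auto simp: v_def indicator_def)
    also have "\<dots> < \<infinity>" using K(3)[of i] by (simp add: top.not_eq_extremum)
    finally show "emeasure \<nu> {x \<in> space \<nu>. v i x \<noteq> 0} < \<infinity>" .
  qed
  have "(\<lambda>i. \<integral>\<^sup>+\<omega>. exp_neg (point_sum J (v i) \<omega>) \<partial>M) \<longlonglongrightarrow> (\<integral>\<^sup>+\<omega>. exp_neg (point_sum J g \<omega>) \<partial>M)"
  proof (rule nn_integral_dominated_convergence[where w="\<lambda>_. 1"])
    show "AE \<omega> in M. (\<lambda>i. exp_neg (point_sum J (v i) \<omega>)) \<longlonglongrightarrow> exp_neg (point_sum J g \<omega>)"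
    proof (rule AE_I2, rule tendsto_exp_neg)
      fix \<omega> assume w: "\<omega> \<in> space M"
      \<comment> \<open>Monotone convergence for the series over the points.\<close>
      have "point_sum J g \<omega> = (\<Sum>l. SUP i. v i (J l \<omega>))"
        unfolding point_sum_def
        using vlim[OF measurable_space[OF points_measurable w]] LIMSEQ_SUP[OF vinc']
        by (intro suminf_cong) (meson LIMSEQ_unique)
      also have "\<dots> = (SUP i. point_sum J (v i) \<omega>)"
        unfolding point_sum_def by (intro ennreal_suminf_SUP_eq vinc')
      finally show "(\<lambda>i. point_sum J (v i) \<omega>) \<longlonglongrightarrow> point_sum J g \<omega>"
        using vinc by (auto intro!: LIMSEQ_SUP suminf_le simp: point_sum_def incseq_def le_fun_def)
    qed
  qed (auto intro: exp_neg_le_1 simp: emeasure_space_1)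
  moreover have "(\<lambda>i. exp_neg (\<integral>\<^sup>+x. 1 - exp_neg (v i x) \<partial>\<nu>)) \<longlonglongrightarrow> exp_neg (\<integral>\<^sup>+x. 1 - exp_neg (g x) \<partial>\<nu>)"
  proof (rule tendsto_exp_neg)
    let ?h = "\<lambda>i x. 1 - exp_neg (v i x)"
    have inc: "incseq ?h"
      using vinc by (auto simp: incseq_def le_fun_def intro!: ennreal_minus_mono exp_neg_antimono)
    have "(SUP i. ?h i x) = 1 - exp_neg (g x)" if "x \<in> space \<nu>" for x
    proof (rule LIMSEQ_unique)
      show "(\<lambda>i. ?h i x) \<longlonglongrightarrow> (SUP i. ?h i x)"
        using inc by (intro LIMSEQ_SUP) (auto simp: incseq_def le_fun_def)
      show "(\<lambda>i. ?h i x) \<longlonglongrightarrow> 1 - exp_neg (g x)"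
        using vlim[OF that] exp_neg_less_top[of "g x"]
        by (intro tendsto_diff_ennreal tendsto_exp_neg) (auto simp: less_top[symmetric])
    qed
    then have "(\<integral>\<^sup>+x. 1 - exp_neg (g x) \<partial>\<nu>) = (\<integral>\<^sup>+x. (SUP i. ?h i x) \<partial>\<nu>)"
      by (intro nn_integral_cong) simp
    also have "\<dots> = (SUP i. \<integral>\<^sup>+x. ?h i x \<partial>\<nu>)"
      by (rule nn_integral_monotone_convergence_SUP[OF inc]) simp
    finally show "(\<lambda>i. \<integral>\<^sup>+x. ?h i x \<partial>\<nu>) \<longlonglongrightarrow> (\<integral>\<^sup>+x. 1 - exp_neg (g x) \<partial>\<nu>)"
      using inc by (auto intro!: LIMSEQ_SUP nn_integral_mono simp: incseq_def le_fun_def)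
  qed
  ultimately show ?thesis unfolding vlap by (rule LIMSEQ_unique)
qed

end

subsection \<open>Sums over distinct points\<close>

text \<open>Monotonicity is the point: it lets a derivative at 0 be taken under an expectation by
  monotone convergence, without any moment bound and even where y is infinite.\<close>

lemma exp_neg_difference_quotient:
  shows "incseq (\<lambda>k. 2 ^ k * (1 - exp_neg (ennreal (1 / 2 ^ k) * y)))" (is "incseq ?u")
    and "(\<lambda>k. 2 ^ k * (1 - exp_neg (ennreal (1 / 2 ^ k) * y))) \<longlonglongrightarrow> y"
proof -
  have "incseq ?u \<and> ?u \<longlonglongrightarrow> y"
  proof (cases "y = \<top>")
    case True
    then have "?u = (\<lambda>k. ennreal (2 ^ k))"
      by (simp add: fun_eq_iff ennreal_mult_top flip: ennreal_power)
    moreover have "filterlim (\<lambda>k. 2 ^ k :: real) at_top sequentially"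
      by real_asymp
    ultimately show ?thesis
      using True by (auto simp: incseq_def ennreal_tendsto_top_eq_at_top
          intro!: ennreal_leI power_increasing)
  next
    case False
    then obtain r where r: "0 \<le> r" "y = ennreal r" by (cases y) auto
    let ?v = "\<lambda>k. 2 ^ k * (1 - exp (- (r / 2 ^ k)))"
    have u: "?u = (\<lambda>k. ennreal (?v k))"
      using r by (simp add: fun_eq_iff exp_neg_ennreal ennreal_minus ennreal_mult ennreal_power[symmetric]
        flip: ennreal_mult[of "1 / 2 ^ _"] ennreal_1)
    have "incseq ?v"
    proof (rule incseq_SucI)
      fix k :: nat
      define z where "z = exp (- (r / 2 ^ Suc k))"
      \<comment> \<open>The reason for dyadic steps: passing from step 1 / 2 ^ k to its half
        replaces z ^ 2 by z, and 1 - z ^ 2 = (1 - z) * (1 + z) \<le> 2 * (1 - z).\<close>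
      have z: "exp (- (r / 2 ^ k)) = z\<^sup>2" unfolding z_def power2_eq_square
        by (simp add: mult_exp_exp)
      have "z \<le> 1" using r by (simp add: z_def)
      have "?v k = 2 ^ k * ((1 - z) * (1 + z))" by (simp add: z power2_eq_square algebra_simps)
      also have "\<dots> \<le> 2 ^ k * ((1 - z) * 2)"
        using \<open>z \<le> 1\<close> by (intro mult_left_mono) auto
      also have "\<dots> = ?v (Suc k)" by (simp add: z_def)
      finally show "?v k \<le> ?v (Suc k)" .
    qed
    moreover have "?v \<longlonglongrightarrow> r" by real_asymp
    ultimately show ?thesis
      unfolding u unfolding r(2) by (auto simp: incseq_def intro!: ennreal_leI)
  qed
  then show "incseq ?u" "?u \<longlonglongrightarrow> y" by auto
qed

text \<open>Extensionality outside \<open>I\<close> makes every injective choice of indices occur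
  exactly once.\<close>

definition inj_maps :: "'i set \<Rightarrow> ('i \<Rightarrow> nat) set" where
  "inj_maps I = {s \<in> I \<rightarrow>\<^sub>E UNIV. inj_on s I}"

text \<open>The integral of the product against the factorial measure of the configuration
  \<open>x\<close>. Distinctness is required of the indices, so points that coincide in value still
  count separately. A counting measure in place of an infinite sum gives access to reindexing by
  bijections and to Fubini.\<close>

definition distinct_sum :: "'i set \<Rightarrow> ('i \<Rightarrow> 'b \<Rightarrow> ennreal) \<Rightarrow> (nat \<Rightarrow> 'b) \<Rightarrow> ennreal" where
  "distinct_sum I f x = (\<integral>\<^sup>+s. (\<Prod>i\<in>I. f i (x (s i))) \<partial>count_space (inj_maps I))"

lemma countable_inj_maps: "finite I \<Longrightarrow> countable (inj_maps I)"
  unfolding inj_maps_def by (rule countable_subset[OF _ countable_PiE[of I "\<lambda>_. UNIV"]]) auto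

lemma distinct_sum_empty [simp]: "distinct_sum ({} :: 'i set) f x = 1"
proof -
  have "inj_maps ({} :: 'i set) = {\<lambda>_. undefined}" by (auto simp: inj_maps_def)
  then show ?thesis by (simp add: distinct_sum_def)
qed

lemma distinct_sum_measurable:
  assumes I: "finite I" and [measurable]: "\<And>i. i \<in> I \<Longrightarrow> f i \<in> borel_measurable N"
    "\<And>l. x l \<in> measurable M N"
  shows "(\<lambda>\<omega>. distinct_sum I f (\<lambda>l. x l \<omega>)) \<in> borel_measurable M"
proof -
  interpret sigma_finite_measure "count_space (inj_maps I)"
    by (rule sigma_finite_measure_count_space_countable[OF countable_inj_maps[OF I]])
  have *: "(\<lambda>s. s i) \<in> count_space (inj_maps I) \<rightarrow>\<^sub>M count_space UNIV" for i by simp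
  show ?thesis
    unfolding distinct_sum_def
  proof (rule borel_measurable_nn_integral)
    show "(\<lambda>(\<omega>, s). \<Prod>i\<in>I. f i (x (s i) \<omega>)) \<in> borel_measurable (M \<Otimes>\<^sub>M count_space (inj_maps I))"
      unfolding split_beta'
    proof (rule borel_measurable_prod_ennreal)
      fix i assume i [measurable]: "i \<in> I"
      \<comment> \<open>Evaluation of \<open>x\<close> at the varying index \<open>s i\<close> is
        measurable because only countably many \<open>s\<close> occur.\<close>
      show "(\<lambda>p. f i (x (snd p i) (fst p))) \<in> borel_measurable (M \<Otimes>\<^sub>M count_space (inj_maps I))"
        by (rule measurable_compose_countable'[where f="\<lambda>s p. f i (x (s i) (fst p))",
              OF _ measurable_snd countable_inj_maps[OF I]])
           measurable
    qed
  qed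
qed

text \<open>On the right, the index l of the extra factor either avoids the indices chosen by s,
  which gives an injective choice on \<open>insert j I\<close>, or it equals s i for exactly one i
  in \<open>I\<close>, and then \<open>f j\<close> merges into \<open>f i\<close>. The merged terms
  stand on the left as summands because differences in \<open>ennreal\<close> are truncated.\<close>

lemma distinct_sum_insert:
  assumes I: "finite I" and j: "j \<notin> I"
  shows "distinct_sum (insert j I) f x + (\<Sum>i\<in>I. distinct_sum I (f(i := \<lambda>w. f i w * f j w)) x) =
    distinct_sum I f x * (\<Sum>l. f j (x l))"
proof -
  define P where "P s = (\<Prod>i\<in>I. f i (x (s i)))" for s
  \<comment> \<open>Injective choices on \<open>I\<close> together with a fresh index; taking the
    fresh index as the value at \<open>j\<close> is the bijection used below.\<close>
  define S where "S = Sigma (inj_maps I) (\<lambda>s. - s ` I)"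
  have split: "(\<Sum>l. f j (x l)) =
      (\<integral>\<^sup>+l. f j (x l) * indicator (- s ` I) l \<partial>count_space UNIV) + (\<Sum>i\<in>I. f j (x (s i)))"
    if s: "s \<in> inj_maps I" for s
  proof -
    have "(\<Sum>l. f j (x l)) = (\<integral>\<^sup>+l. f j (x l) \<partial>count_space UNIV)"
      by (rule nn_integral_count_space_nat[symmetric])
    also have "\<dots> = (\<integral>\<^sup>+l. f j (x l) * indicator (- s ` I) l + f j (x l) * indicator (s ` I) l \<partial>count_space UNIV)"
      by (intro nn_integral_cong) (auto simp: indicator_def)
    also have "\<dots> = (\<integral>\<^sup>+l. f j (x l) * indicator (- s ` I) l \<partial>count_space UNIV) +
        (\<integral>\<^sup>+l. f j (x l) * indicator (s ` I) l \<partial>count_space UNIV)"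
      by (rule nn_integral_add) auto
    also have "(\<integral>\<^sup>+l. f j (x l) * indicator (s ` I) l \<partial>count_space UNIV) = (\<Sum>l\<in>s ` I. f j (x l))"
      using I by (simp add: nn_integral_count_space_indicator[symmetric] nn_integral_count_space_finite)
    also have "\<dots> = (\<Sum>i\<in>I. f j (x (s i)))"
      using s by (subst sum.reindex) (auto simp: inj_maps_def)
    finally show ?thesis .
  qed
  \<comment> \<open>The product for the family in which \<open>f j\<close> is absorbed into the
    factor \<open>i\<close>.\<close>
  have upd: "P s * f j (x (s i)) = (\<Prod>k\<in>I. (f(i := \<lambda>w. f i w * f j w)) k (x (s k)))" if "i \<in> I" for s i
  proof -
    have "P s * f j (x (s i)) = (f i (x (s i)) * f j (x (s i))) * (\<Prod>k\<in>I-{i}. f k (x (s k)))"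
      using that I by (simp add: P_def prod.remove[of I i] mult_ac)
    also have "(\<Prod>k\<in>I-{i}. f k (x (s k))) = (\<Prod>k\<in>I-{i}. (f(i := \<lambda>w. f i w * f j w)) k (x (s k)))"
      by (intro prod.cong) auto
    finally show ?thesis using that I by (simp add: prod.remove[of I i])
  qed
  have bij: "bij_betw (\<lambda>(s, l). s(j := l)) S (inj_maps (insert j I))"
  proof (rule bij_betw_byWitness[where f'="\<lambda>s. (restrict s I, s j)"])
    show "\<forall>a\<in>S. (\<lambda>s. (restrict s I, s j)) ((\<lambda>(s, l). s(j := l)) a) = a"
      using j by (auto simp: S_def inj_maps_def fun_eq_iff PiE_def extensional_def restrict_def)
    show "\<forall>a\<in>inj_maps (insert j I). (\<lambda>(s, l). s(j := l)) (restrict a I, a j) = a"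
      by (auto simp: inj_maps_def fun_eq_iff PiE_def extensional_def restrict_def)
    show "(\<lambda>(s, l). s(j := l)) ` S \<subseteq> inj_maps (insert j I)"
    proof safe
      fix s l assume "(s, l) \<in> S"
      then have s: "s \<in> extensional I" "inj_on s I" "l \<notin> s ` I" by (auto simp: S_def inj_maps_def PiE_def)
      have "inj_on (s(j := l)) I" using s by (intro inj_on_fun_updI) auto
      moreover have "(s(j := l)) ` (I - {j}) = s ` I" using j by auto
      ultimately show "s(j := l) \<in> inj_maps (insert j I)"
        using s j by (simp add: inj_maps_def PiE_def)
    qed
    show "(\<lambda>s. (restrict s I, s j)) ` inj_maps (insert j I) \<subseteq> S"
      using j by (auto simp: S_def inj_maps_def inj_on_def)
  qed
  have "distinct_sum (insert j I) f x =
      (\<integral>\<^sup>+p. (\<Prod>i\<in>insert j I. f i (x (((\<lambda>(s, l). s(j := l)) p) i))) \<partial>count_space S)"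
    unfolding distinct_sum_def by (rule nn_integral_bij_count_space[OF bij, symmetric])
  also have "\<dots> = (\<integral>\<^sup>+p. P (fst p) * f j (x (snd p)) \<partial>count_space S)"
  proof (intro nn_integral_cong)
    fix p assume "p \<in> space (count_space S)"
    have "(\<Prod>i\<in>I. f i (x (((fst p)(j := snd p)) i))) = P (fst p)"
      unfolding P_def using j by (intro prod.cong) auto
    then show "(\<Prod>i\<in>insert j I. f i (x (((\<lambda>(s, l). s(j := l)) p) i))) = P (fst p) * f j (x (snd p))"
      using I j by (simp add: split_beta mult.commute)
  qed
  also have "\<dots> = (\<integral>\<^sup>+s. \<integral>\<^sup>+l. P s * f j (x l) * indicator S (s, l) \<partial>count_space UNIV \<partial>count_space UNIV)"
    by (subst nn_integral_fst_count_space[where f="\<lambda>p. P (fst p) * f j (x (snd p)) * indicator S p", simplified])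
       (simp add: nn_integral_count_space_indicator)
  also have "\<dots> = (\<integral>\<^sup>+s. (\<integral>\<^sup>+l. P s * (f j (x l) * indicator (- s ` I) l) \<partial>count_space UNIV) *
      indicator (inj_maps I) s \<partial>count_space UNIV)"
    by (intro nn_integral_cong) (auto simp: S_def indicator_def intro!: nn_integral_cong)
  also have "\<dots> = (\<integral>\<^sup>+s. P s * (\<integral>\<^sup>+l. f j (x l) * indicator (- s ` I) l \<partial>count_space UNIV) \<partial>count_space (inj_maps I))"
    by (simp add: nn_integral_count_space_indicator nn_integral_cmult)
  finally have 1: "distinct_sum (insert j I) f x =
    (\<integral>\<^sup>+s. P s * (\<integral>\<^sup>+l. f j (x l) * indicator (- s ` I) l \<partial>count_space UNIV) \<partial>count_space (inj_maps I))" .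
  have 2: "(\<Sum>i\<in>I. distinct_sum I (f(i := \<lambda>w. f i w * f j w)) x) =
      (\<integral>\<^sup>+s. (\<Sum>i\<in>I. P s * f j (x (s i))) \<partial>count_space (inj_maps I))"
    unfolding distinct_sum_def by (subst nn_integral_sum) (auto simp: upd)
  show ?thesis
    unfolding 1 2 unfolding distinct_sum_def P_def[symmetric]
    by (subst nn_integral_add[symmetric]; simp flip: sum_distrib_left distrib_left add: nn_integral_multc[symmetric] split cong: nn_integral_cong_simp)
qed

text \<open>One-sided because for negative s the integrand need not be integrable. The difference
  quotients are dominated by k * h, since 1 - exp (- x) \<le> x.\<close>

lemma has_field_derivative_integral_one_minus_exp:
  fixes h k :: "'b \<Rightarrow> real"
  assumes [measurable]: "h \<in> borel_measurable N" "k \<in> borel_measurable N"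
    and nonneg: "\<And>w. w \<in> space N \<Longrightarrow> 0 \<le> h w" "\<And>w. w \<in> space N \<Longrightarrow> 0 \<le> k w"
    and int: "integrable N (\<lambda>w. k w * h w)"
  shows "((\<lambda>s. \<integral>w. k w * (1 - exp (- (s * h w))) \<partial>N) has_field_derivative (\<integral>w. k w * h w \<partial>N)) (at 0 within {0..})"
proof -
  have "((\<lambda>s. (\<integral>w. k w * (1 - exp (- (s * h w))) \<partial>N) / s) \<longlongrightarrow> (\<integral>w. k w * h w \<partial>N)) (at_right 0)"
  proof (rule tendsto_at_right_sequentially[of 0 1])
    fix S :: "nat \<Rightarrow> real" assume S: "\<And>n. 0 < S n" "S \<longlonglongrightarrow> 0"
    have "(\<lambda>n. \<integral>w. k w * (1 - exp (- (S n * h w))) / S n \<partial>N) \<longlonglongrightarrow> (\<integral>w. k w * h w \<partial>N)"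
    proof (rule integral_dominated_convergence[where w="\<lambda>w. k w * h w"])
      show "AE w in N. (\<lambda>n. k w * (1 - exp (- (S n * h w))) / S n) \<longlonglongrightarrow> k w * h w"
      proof (rule AE_I2)
        fix w
        have "((\<lambda>s. k w * (1 - exp (- (s * h w))) / s) \<longlongrightarrow> k w * h w) (at_right 0)"
          by real_asymp
        moreover have "filterlim S (at_right 0) sequentially"
          using S less_imp_neq[OF S(1)] by (auto simp: filterlim_at eventually_sequentially)
        ultimately show "(\<lambda>n. k w * (1 - exp (- (S n * h w))) / S n) \<longlonglongrightarrow> k w * h w"
          by (rule filterlim_compose)
      qed
      show "AE w in N. norm (k w * (1 - exp (- (S n * h w))) / S n) \<le> k w * h w" for n
      proof (rule AE_I2)
        fix w assume w: "w \<in> space N"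
        have "1 - exp (- (S n * h w)) \<le> S n * h w"
          using exp_ge_add_one_self[of "- (S n * h w)"] by simp
        then have "(1 - exp (- (S n * h w))) / S n \<le> h w"
          using S(1)[of n] by (simp add: divide_le_eq mult.commute)
        moreover have "0 \<le> (1 - exp (- (S n * h w))) / S n"
          using S(1)[of n] nonneg w by simp
        ultimately show "norm (k w * (1 - exp (- (S n * h w))) / S n) \<le> k w * h w"
          using nonneg(2)[OF w] mult_left_mono[of "(1 - exp (- (S n * h w))) / S n" "h w" "k w"]
          by (simp only: real_norm_def abs_mult abs_of_nonneg times_divide_eq_right[symmetric])
      qed
    qed (use int in auto)
    then show "(\<lambda>n. (\<integral>w. k w * (1 - exp (- (S n * h w))) \<partial>N) / S n) \<longlonglongrightarrow> (\<integral>w. k w * h w \<partial>N)"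
      by simp
  qed simp
  then show ?thesis
    by (simp add: has_field_derivative_iff at_within_Ici_at_right)
qed

lemma has_field_derivative_prod_within:
  fixes a :: "'i \<Rightarrow> real \<Rightarrow> real"
  assumes "\<And>i. i \<in> I \<Longrightarrow> (a i has_field_derivative d i) (at z within S)"
  shows "((\<lambda>s. \<Prod>i\<in>I. a i s) has_field_derivative (\<Sum>i\<in>I. d i * (\<Prod>j\<in>I - {i}. a j z))) (at z within S)"
proof -
  have "((\<lambda>s. \<Prod>i\<in>I. a i s) has_derivative (\<lambda>y. \<Sum>i\<in>I. d i * y * (\<Prod>j\<in>I - {i}. a j z))) (at z within S)"
    using assms by (intro has_derivative_prod) (auto simp: has_field_derivative_def)
  also have "(\<lambda>y. \<Sum>i\<in>I. d i * y * (\<Prod>j\<in>I - {i}. a j z)) = (*) (\<Sum>i\<in>I. d i * (\<Prod>j\<in>I - {i}. a j z))"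
    by (simp add: fun_eq_iff sum_distrib_left mult_ac)
  finally show ?thesis
    by (simp add: has_field_derivative_def)
qed

context poisson_points
begin

text \<open>A multivariate Campbell--Mecke formula. The new factor \<open>f j\<close> is produced by the right
  derivative at \<open>s = 0\<close> of the formula for \<open>I\<close> with \<open>g + s * f j\<close> in place of \<open>g\<close>.\<close>

theorem distinct_sum_laplace:
  fixes F :: "('b \<Rightarrow> real) set" and g\<^sub>0 :: "'b \<Rightarrow> real" and f :: "'i \<Rightarrow> 'b \<Rightarrow> real"
  assumes sf: "sigma_finite_measure \<nu>"
    and F_meas: "\<And>f. f \<in> F \<Longrightarrow> f \<in> borel_measurable \<nu>"
    and F_nonneg: "\<And>f w. f \<in> F \<Longrightarrow> w \<in> space \<nu> \<Longrightarrow> 0 \<le> f w"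
    and F_mult: "\<And>f f'. f \<in> F \<Longrightarrow> f' \<in> F \<Longrightarrow> (\<lambda>w. f w * f' w) \<in> F"
    and F_int: "\<And>f. f \<in> F \<Longrightarrow> integrable \<nu> (\<lambda>w. f w * exp (- g\<^sub>0 w))"
    and "finite I" "\<And>i. i \<in> I \<Longrightarrow> f i \<in> F"
    and "g \<in> borel_measurable \<nu>"
    and "\<And>w. w \<in> space \<nu> \<Longrightarrow> g\<^sub>0 w \<le> g w" "\<And>w. w \<in> space \<nu> \<Longrightarrow> 0 \<le> g w"
    and "integrable \<nu> (\<lambda>w. 1 - exp (- g w))"
  shows "(\<integral>\<^sup>+\<omega>. distinct_sum I (\<lambda>i w. ennreal (f i w)) (\<lambda>l. J l \<omega>) *
             exp_neg (point_sum J (\<lambda>w. ennreal (g w)) \<omega>) \<partial>M) =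
    ennreal ((\<Prod>i\<in>I. \<integral>w. f i w * exp (- g w) \<partial>\<nu>) * exp (- (\<integral>w. 1 - exp (- g w) \<partial>\<nu>)))"
  \<comment> \<open>Both \<open>f\<close> and \<open>g\<close> must vary in the induction: its step
    uses the case \<open>I\<close> for the perturbed exponents \<open>G s\<close>, and for the
    families in which \<open>f j\<close> is merged into some \<open>f i\<close>. Closure of
    \<open>F\<close> under products and the fixed lower bound \<open>g\<^sub>0\<close> keep all of
    these integrable.\<close>
  using assms(6-)
proof (induction I arbitrary: f g rule: finite_induct)
  case empty
  have "(\<integral>\<^sup>+x. 1 - exp_neg (ennreal (g x)) \<partial>\<nu>) = (\<integral>\<^sup>+x. ennreal (1 - exp (- g x)) \<partial>\<nu>)"
    using empty by (intro nn_integral_cong) (simp add: exp_neg_ennreal ennreal_minus flip: ennreal_1)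
  also have "\<dots> = ennreal (\<integral>w. 1 - exp (- g w) \<partial>\<nu>)"
    using empty by (intro nn_integral_eq_integral) auto
  finally show ?case
    using laplace_functional[OF sf, of "\<lambda>w. ennreal (g w)"] empty
    by (simp add: exp_neg_ennreal integral_nonneg_AE)
next
  case (insert j I)
  define h where "h = f j"
  define D where "D \<omega> = distinct_sum I (\<lambda>i w. ennreal (f i w)) (\<lambda>l. J l \<omega>)" for \<omega>
  define X where "X \<omega> = D \<omega> * exp_neg (point_sum J (\<lambda>w. ennreal (g w)) \<omega>)" for \<omega>
  define Y where "Y = point_sum J (\<lambda>w. ennreal (h w))"
  define G where "G s w = g w + s * h w" for s w
  define a where "a i s = (\<integral>w. f i w * exp (- G s w) \<partial>\<nu>)" for i s
  define b where "b s = (\<integral>w. 1 - exp (- G s w) \<partial>\<nu>)" for s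
  define d where "d i = (\<integral>w. f i w * exp (- g w) * h w \<partial>\<nu>)" for i
  define d' where "d' = (\<integral>w. exp (- g w) * h w \<partial>\<nu>)"
  define \<Phi> where "\<Phi> s = (\<Prod>i\<in>I. a i s) * exp (- b s)" for s
  have fF: "f i \<in> F" if "i \<in> I" for i using that insert.prems by simp
  have hF: "h \<in> F" using insert.prems by (simp add: h_def)
  note [measurable] = F_meas[OF fF] F_meas[OF hF] \<open>g \<in> borel_measurable \<nu>\<close>
  have Fg: "integrable \<nu> (\<lambda>w. k w * exp (- g w))" if k: "k \<in> F" for k
  proof (rule Bochner_Integration.integrable_bound[OF F_int[OF k]])
    show "(\<lambda>w. k w * exp (- g w)) \<in> borel_measurable \<nu>" using F_meas[OF k] by measurable
    show "AE w in \<nu>. norm (k w * exp (- g w)) \<le> norm (k w * exp (- g\<^sub>0 w))"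
      using insert.prems(3) by (intro AE_I2) (simp add: abs_mult mult_left_mono)
  qed
  have G0: "G 0 = g" by (simp add: G_def fun_eq_iff)
  have c: "((\<lambda>s. \<integral>w. k w * (1 - exp (- (s * h w))) \<partial>\<nu>) has_field_derivative (\<integral>w. k w * h w \<partial>\<nu>)) (at 0 within {0..})"
    if "k \<in> borel_measurable \<nu>" "\<And>w. w \<in> space \<nu> \<Longrightarrow> 0 \<le> k w" "integrable \<nu> (\<lambda>w. k w * h w)" for k
    using that F_nonneg[OF hF] by (intro has_field_derivative_integral_one_minus_exp) auto
  have int_c: "integrable \<nu> (\<lambda>w. k w * (1 - exp (- (s * h w))))"
    if k: "k \<in> borel_measurable \<nu>" "\<And>w. w \<in> space \<nu> \<Longrightarrow> 0 \<le> k w" "integrable \<nu> (\<lambda>w. k w * h w)"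
      and s: "0 \<le> s" for k s
  proof (rule Bochner_Integration.integrable_bound)
    show "integrable \<nu> (\<lambda>w. s * (k w * h w))" using k by simp
    show "AE w in \<nu>. norm (k w * (1 - exp (- (s * h w)))) \<le> norm (s * (k w * h w))"
    proof (rule AE_I2)
      fix w assume w: "w \<in> space \<nu>"
      have "0 \<le> s * h w" using s F_nonneg[OF hF w] by simp
      then have "0 \<le> 1 - exp (- (s * h w))" "1 - exp (- (s * h w)) \<le> s * h w"
        using exp_ge_add_one_self[of "- (s * h w)"] by auto
      then show "norm (k w * (1 - exp (- (s * h w)))) \<le> norm (s * (k w * h w))"
        using k(2)[OF w] mult_left_mono[of "1 - exp (- (s * h w))" "s * h w" "k w"] \<open>0 \<le> s * h w\<close>
        by (simp add: abs_mult mult_ac s F_nonneg[OF hF w])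
    qed
  qed (use k in measurable)
  have mult_int: "integrable \<nu> (\<lambda>w. f i w * exp (- g w) * h w)" if "i \<in> I" for i
    using Fg[OF F_mult[OF fF[OF that] hF]] by (simp add: mult_ac)
  \<comment> \<open>Isolates the dependence on s in an integral with the factor 1 - exp (- s h), the
    shape covered by the derivative lemma.\<close>
  have a_eq: "a i s = a i 0 - (\<integral>w. (f i w * exp (- g w)) * (1 - exp (- (s * h w))) \<partial>\<nu>)"
    if "i \<in> I" "0 \<le> s" for i s
  proof -
    have "a i s = (\<integral>w. f i w * exp (- g w) - (f i w * exp (- g w)) * (1 - exp (- (s * h w))) \<partial>\<nu>)"
      unfolding a_def G_def by (intro Bochner_Integration.integral_cong) (auto simp: algebra_simps mult_exp_exp)
    also have "\<dots> = a i 0 - (\<integral>w. (f i w * exp (- g w)) * (1 - exp (- (s * h w))) \<partial>\<nu>)"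
      unfolding a_def G0
      using that F_nonneg[OF fF[OF that(1)]]
      by (intro Bochner_Integration.integral_diff Fg fF int_c mult_int) auto
    finally show ?thesis .
  qed
  have int_eh: "integrable \<nu> (\<lambda>w. exp (- g w) * h w)" using Fg[OF hF] by (simp add: mult.commute)
  have G_int: "integrable \<nu> (\<lambda>w. 1 - exp (- G s w))"
    and b_eq: "b s = b 0 + (\<integral>w. exp (- g w) * (1 - exp (- (s * h w))) \<partial>\<nu>)" if "0 \<le> s" for s
  proof -
    have *: "1 - exp (- G s w) = (1 - exp (- g w)) + exp (- g w) * (1 - exp (- (s * h w)))" for w
      by (auto simp: algebra_simps mult_exp_exp G_def)
    have **: "integrable \<nu> (\<lambda>w. exp (- g w) * (1 - exp (- (s * h w))))"
      using that by (intro int_c int_eh) auto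
    show "integrable \<nu> (\<lambda>w. 1 - exp (- G s w))"
      unfolding * using ** insert.prems by (intro Bochner_Integration.integrable_add)
    show "b s = b 0 + (\<integral>w. exp (- g w) * (1 - exp (- (s * h w))) \<partial>\<nu>)"
      unfolding b_def G0 unfolding * using ** insert.prems
      by (intro Bochner_Integration.integral_add)
  qed
  have a': "(a i has_field_derivative - d i) (at 0 within {0..})" if i: "i \<in> I" for i
  proof (rule has_field_derivative_transform_within[of _ _ _ _ 1])
    show "((\<lambda>s. a i 0 - (\<integral>w. (f i w * exp (- g w)) * (1 - exp (- (s * h w))) \<partial>\<nu>))
        has_field_derivative - d i) (at 0 within {0..})"
    proof -
      have "(\<lambda>w. f i w * exp (- g w)) \<in> borel_measurable \<nu>"
        using Fg[OF fF[OF i]] by (rule borel_measurable_integrable)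
      moreover have "0 \<le> f i w * exp (- g w)" if "w \<in> space \<nu>" for w
        using F_nonneg[OF fF[OF i] that] by simp
      ultimately have "((\<lambda>s. \<integral>w. (f i w * exp (- g w)) * (1 - exp (- (s * h w))) \<partial>\<nu>)
          has_field_derivative d i) (at 0 within {0..})"
        unfolding d_def by (rule c[OF _ _ mult_int[OF i]])
      from DERIV_diff[OF DERIV_const this] show ?thesis by simp
    qed
  qed (auto intro: a_eq[OF i, symmetric])
  have b': "(b has_field_derivative d') (at 0 within {0..})"
  proof (rule has_field_derivative_transform_within[of _ _ _ _ 1])
    show "((\<lambda>s. b 0 + (\<integral>w. exp (- g w) * (1 - exp (- (s * h w))) \<partial>\<nu>))
        has_field_derivative d') (at 0 within {0..})"
    proof -
      have "((\<lambda>s. \<integral>w. exp (- g w) * (1 - exp (- (s * h w))) \<partial>\<nu>)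
          has_field_derivative d') (at 0 within {0..})"
        unfolding d'_def by (rule c[OF _ _ int_eh]) auto
      from DERIV_add[OF DERIV_const this] show ?thesis by simp
    qed
  qed (auto intro: b_eq[symmetric])
  \<comment> \<open>Minus the right derivative of \<open>\<Phi>\<close> at 0. The sum comes from
    differentiating the factors \<open>a i\<close> and will be cancelled by the merged terms; the
    other summand comes from differentiating exp (- b s) and is the value claimed for
    \<open>insert j I\<close>.\<close>
  define \<Phi>' where "\<Phi>' = (\<Sum>i\<in>I. d i * (\<Prod>k\<in>I - {i}. a k 0)) * exp (- b 0) + (\<Prod>i\<in>I. a i 0) * d' * exp (- b 0)"
  have "(\<Phi> has_field_derivative - \<Phi>') (at 0 within {0..})"
  proof -
    have P: "((\<lambda>s. \<Prod>i\<in>I. a i s) has_field_derivative (\<Sum>i\<in>I. - d i * (\<Prod>k\<in>I - {i}. a k 0))) (at 0 within {0..})"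
      by (intro has_field_derivative_prod_within a')
    show ?thesis
      unfolding \<Phi>_def[abs_def] \<Phi>'_def
      using DERIV_mult[OF P DERIV_chain2[OF DERIV_exp DERIV_minus[OF b']]]
      by (rule back_subst[where P="\<lambda>D. (_ has_field_derivative D) _"])
         (simp add: sum_negf algebra_simps)
  qed
  then have lim0: "((\<lambda>s. (\<Phi> s - \<Phi> 0) / s) \<longlongrightarrow> - \<Phi>') (at_right 0)"
    by (simp add: has_field_derivative_iff at_within_Ici_at_right)
  have lim: "(\<lambda>k. 2 ^ k * (\<Phi> 0 - \<Phi> (1 / 2 ^ k))) \<longlonglongrightarrow> \<Phi>'"
  proof -
    have "filterlim (\<lambda>k. 1 / 2 ^ k :: real) (at_right 0) sequentially" by real_asymp
    from tendsto_minus[OF filterlim_compose[OF lim0 this]] show ?thesis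
      by (simp add: algebra_simps)
  qed
  have a_nonneg: "0 \<le> a i s" if "i \<in> I" for i s
    unfolding a_def using F_nonneg[OF fF[OF that]] by (intro integral_nonneg_AE AE_I2) auto
  have d_nonneg: "0 \<le> d i" if "i \<in> I" for i
    unfolding d_def using F_nonneg[OF fF[OF that]] F_nonneg[OF hF]
    by (intro integral_nonneg_AE AE_I2) auto
  have \<Phi>_nonneg: "0 \<le> \<Phi> s" for s
    unfolding \<Phi>_def using a_nonneg by (intro mult_nonneg_nonneg prod_nonneg) auto
  have [measurable]: "D \<in> borel_measurable M"
    unfolding D_def using insert.hyps by (intro distinct_sum_measurable[where N=\<nu>]) auto
  have [measurable]: "X \<in> borel_measurable M" "Y \<in> borel_measurable M"
    unfolding X_def Y_def by measurable
  have IH: "(\<integral>\<^sup>+\<omega>. X \<omega> * exp_neg (ennreal s * Y \<omega>) \<partial>M) = ennreal (\<Phi> s)" if s: "0 \<le> s" for s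
  proof -
    have "X \<omega> * exp_neg (ennreal s * Y \<omega>) =
        D \<omega> * exp_neg (point_sum J (\<lambda>w. ennreal (G s w)) \<omega>)" if \<omega>: "\<omega> \<in> space M" for \<omega>
    proof -
      have "point_sum J (\<lambda>w. ennreal (G s w)) \<omega> =
          point_sum J (\<lambda>w. ennreal (g w) + ennreal s * ennreal (h w)) \<omega>"
        unfolding point_sum_def G_def
        using measurable_space[OF points_measurable \<omega>] s F_nonneg[OF hF] insert.prems(4)
        by (intro suminf_cong) (simp add: ennreal_mult)
      then show ?thesis
        unfolding X_def Y_def by (simp add: point_sum_add point_sum_cmult exp_neg_add mult.assoc)
    qed
    then have "(\<integral>\<^sup>+\<omega>. X \<omega> * exp_neg (ennreal s * Y \<omega>) \<partial>M) =
        (\<integral>\<^sup>+\<omega>. D \<omega> * exp_neg (point_sum J (\<lambda>w. ennreal (G s w)) \<omega>) \<partial>M)"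
      by (intro nn_integral_cong) auto
    also have "\<dots> = ennreal (\<Phi> s)"
      unfolding D_def \<Phi>_def a_def b_def
    proof (rule insert.IH)
      show "G s \<in> borel_measurable \<nu>" unfolding G_def by measurable
      show "g\<^sub>0 w \<le> G s w" if "w \<in> space \<nu>" for w
        using insert.prems(3)[OF that] s F_nonneg[OF hF that] by (simp add: G_def add_increasing2)
      show "0 \<le> G s w" if "w \<in> space \<nu>" for w
        using insert.prems(4)[OF that] s F_nonneg[OF hF that] by (simp add: G_def)
    qed (use fF s G_int in auto)
    finally show ?thesis .
  qed
  have X_int: "(\<integral>\<^sup>+\<omega>. X \<omega> \<partial>M) = ennreal (\<Phi> 0)" using IH[of 0] by simp
  \<comment> \<open>The expectation of X times the dyadic difference quotient of the exponential.
    Subtracting in \<open>ennreal\<close> is legitimate because \<open>\<Phi>\<close> takes finite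
    values.\<close>
  have quot: "(\<integral>\<^sup>+\<omega>. X \<omega> * (2 ^ k * (1 - exp_neg (ennreal (1 / 2 ^ k) * Y \<omega>))) \<partial>M) =
      ennreal (2 ^ k * (\<Phi> 0 - \<Phi> (1 / 2 ^ k)))" for k :: nat
  proof -
    let ?s = "1 / 2 ^ k :: real"
    have "(\<integral>\<^sup>+\<omega>. X \<omega> * (1 - exp_neg (ennreal ?s * Y \<omega>)) \<partial>M) + ennreal (\<Phi> ?s) =
        (\<integral>\<^sup>+\<omega>. X \<omega> * (1 - exp_neg (ennreal ?s * Y \<omega>)) + X \<omega> * exp_neg (ennreal ?s * Y \<omega>) \<partial>M)"
      by (subst nn_integral_add) (auto simp: IH)
    also have "\<dots> = (\<integral>\<^sup>+\<omega>. X \<omega> \<partial>M)"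
      by (intro nn_integral_cong) (simp add: distrib_left[symmetric] exp_neg_le_1 diff_add_cancel_ennreal)
    finally have *: "(\<integral>\<^sup>+\<omega>. X \<omega> * (1 - exp_neg (ennreal ?s * Y \<omega>)) \<partial>M) + ennreal (\<Phi> ?s) = ennreal (\<Phi> 0)"
      by (simp add: X_int)
    then have "(\<integral>\<^sup>+\<omega>. X \<omega> * (1 - exp_neg (ennreal ?s * Y \<omega>)) \<partial>M) = ennreal (\<Phi> 0) - ennreal (\<Phi> ?s)"
      by (metis ennreal_add_diff_cancel_right ennreal_neq_top)
    also have "\<dots> = ennreal (\<Phi> 0 - \<Phi> ?s)" by (simp add: ennreal_minus \<Phi>_nonneg)
    finally have "(\<integral>\<^sup>+\<omega>. 2 ^ k * (X \<omega> * (1 - exp_neg (ennreal ?s * Y \<omega>))) \<partial>M) = 2 ^ k * ennreal (\<Phi> 0 - \<Phi> ?s)"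
      by (subst nn_integral_cmult) auto
    then show ?thesis
      by (simp add: mult_ac ennreal_mult' flip: ennreal_power)
  qed
  \<comment> \<open>One sequence with two limits: the derivative of \<open>\<Phi>\<close>, and, by
    monotone convergence, the expectation of X * Y. In particular that expectation is finite, with
    no moment assumed beforehand.\<close>
  have XY: "(\<integral>\<^sup>+\<omega>. X \<omega> * Y \<omega> \<partial>M) = ennreal \<Phi>'"
  proof (rule LIMSEQ_unique)
    show "(\<lambda>k. ennreal (2 ^ k * (\<Phi> 0 - \<Phi> (1 / 2 ^ k)))) \<longlonglongrightarrow> ennreal \<Phi>'"
      by (intro tendsto_ennrealI lim)
    show "(\<lambda>k. ennreal (2 ^ k * (\<Phi> 0 - \<Phi> (1 / 2 ^ k)))) \<longlonglongrightarrow> (\<integral>\<^sup>+\<omega>. X \<omega> * Y \<omega> \<partial>M)"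
      unfolding quot[symmetric]
    proof (rule nn_integral_LIMSEQ)
      show "incseq (\<lambda>k \<omega>. X \<omega> * (2 ^ k * (1 - exp_neg (ennreal (1 / 2 ^ k) * Y \<omega>))))"
        using exp_neg_difference_quotient(1)
        by (auto simp: incseq_def le_fun_def intro!: mult_left_mono)
      let ?u = "\<lambda>k \<omega>. 2 ^ k * (1 - exp_neg (ennreal (1 / 2 ^ k) * Y \<omega>))"
      show "(\<lambda>k. X \<omega> * ?u k \<omega>) \<longlonglongrightarrow> X \<omega> * Y \<omega>" for \<omega>
      proof -
        note q = exp_neg_difference_quotient[of "Y \<omega>"]
        have "(SUP k. ?u k \<omega>) = Y \<omega>"
          using LIMSEQ_SUP[OF q(1)] q(2) by (rule LIMSEQ_unique)
        then have "X \<omega> * Y \<omega> = (SUP k. X \<omega> * ?u k \<omega>)"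
          by (simp add: SUP_mult_left_ennreal[symmetric])
        moreover have "incseq (\<lambda>k. X \<omega> * ?u k \<omega>)"
          using q(1) by (auto simp: incseq_def intro!: mult_left_mono)
        ultimately show ?thesis by (metis LIMSEQ_SUP)
      qed
    qed auto
  qed
  have prod_upd: "(\<Prod>k\<in>I. \<integral>w. (f(i := \<lambda>w. f i w * h w)) k w * exp (- g w) \<partial>\<nu>) = d i * (\<Prod>k\<in>I - {i}. a k 0)"
    if "i \<in> I" for i
  proof -
    have "(\<Prod>k\<in>I. \<integral>w. (f(i := \<lambda>w. f i w * h w)) k w * exp (- g w) \<partial>\<nu>) =
        d i * (\<Prod>k\<in>I - {i}. \<integral>w. (f(i := \<lambda>w. f i w * h w)) k w * exp (- g w) \<partial>\<nu>)"
      using insert.hyps that by (simp add: prod.remove[of I i] d_def mult_ac)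
    also have "(\<Prod>k\<in>I - {i}. \<integral>w. (f(i := \<lambda>w. f i w * h w)) k w * exp (- g w) \<partial>\<nu>) = (\<Prod>k\<in>I - {i}. a k 0)"
      by (intro prod.cong) (auto simp: a_def G0)
    finally show ?thesis .
  qed
  \<comment> \<open>The contribution of the configurations in which the index of the new factor
    coincides with the index already chosen for \<open>i\<close>.\<close>
  define E where "E i \<omega> = distinct_sum I ((\<lambda>i w. ennreal (f i w))(i := \<lambda>w. ennreal (f i w) * ennreal (h w))) (\<lambda>l. J l \<omega>) *
      exp_neg (point_sum J (\<lambda>w. ennreal (g w)) \<omega>)" for i \<omega>
  have E_int: "(\<integral>\<^sup>+\<omega>. E i \<omega> \<partial>M) = ennreal (d i * (\<Prod>k\<in>I - {i}. a k 0) * exp (- b 0))" if i: "i \<in> I" for i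
  proof -
    have "E i \<omega> = distinct_sum I (\<lambda>k w. ennreal ((f(i := \<lambda>w. f i w * h w)) k w)) (\<lambda>l. J l \<omega>) *
        exp_neg (point_sum J (\<lambda>w. ennreal (g w)) \<omega>)" if \<omega>: "\<omega> \<in> space M" for \<omega>
    proof -
      have "((\<lambda>i w. ennreal (f i w))(i := \<lambda>w. ennreal (f i w) * ennreal (h w))) k (J l \<omega>) =
          ennreal ((f(i := \<lambda>w. f i w * h w)) k (J l \<omega>))" for k l
        using measurable_space[OF points_measurable \<omega>] F_nonneg[OF hF] F_nonneg[OF fF[OF i]]
        by (auto simp: ennreal_mult)
      then show ?thesis unfolding E_def distinct_sum_def by simp
    qed
    then have "(\<integral>\<^sup>+\<omega>. E i \<omega> \<partial>M) = (\<integral>\<^sup>+\<omega>. distinct_sum I (\<lambda>k w. ennreal ((f(i := \<lambda>w. f i w * h w)) k w)) (\<lambda>l. J l \<omega>) *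
        exp_neg (point_sum J (\<lambda>w. ennreal (g w)) \<omega>) \<partial>M)"
      by (intro nn_integral_cong) auto
    also have "\<dots> = ennreal ((\<Prod>k\<in>I. \<integral>w. (f(i := \<lambda>w. f i w * h w)) k w * exp (- g w) \<partial>\<nu>) *
        exp (- (\<integral>w. 1 - exp (- g w) \<partial>\<nu>)))"
      using fF F_mult[OF fF[OF i] hF] insert.prems by (intro insert.IH) auto
    finally show ?thesis unfolding prod_upd[OF i] by (simp add: b_def G0)
  qed
  have E_meas [measurable]: "E i \<in> borel_measurable M" if "i \<in> I" for i
    unfolding E_def using insert.hyps that
    by (intro borel_measurable_times_ennreal distinct_sum_measurable[where N=\<nu>]) auto
  define Z where "Z \<omega> = distinct_sum (insert j I) (\<lambda>i w. ennreal (f i w)) (\<lambda>l. J l \<omega>) *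
      exp_neg (point_sum J (\<lambda>w. ennreal (g w)) \<omega>)" for \<omega>
  have [measurable]: "Z \<in> borel_measurable M"
    unfolding Z_def using insert.hyps F_meas[OF hF, unfolded h_def]
    by (intro borel_measurable_times_ennreal distinct_sum_measurable[where N=\<nu>]) auto
  \<comment> \<open>\<open>distinct_sum_insert\<close> multiplied by the exponential weight.\<close>
  have ZE: "Z \<omega> + (\<Sum>i\<in>I. E i \<omega>) = X \<omega> * Y \<omega>" for \<omega>
    using distinct_sum_insert[OF insert.hyps, of "\<lambda>i w. ennreal (f i w)" "\<lambda>l. J l \<omega>"]
    unfolding Z_def E_def X_def Y_def D_def point_sum_def h_def[symmetric]
      sum_distrib_right[symmetric] distrib_right[symmetric]
    by (simp only: mult.assoc mult.commute mult.left_commute)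
  have "(\<integral>\<^sup>+\<omega>. Z \<omega> \<partial>M) + (\<Sum>i\<in>I. \<integral>\<^sup>+\<omega>. E i \<omega> \<partial>M) = (\<integral>\<^sup>+\<omega>. X \<omega> * Y \<omega> \<partial>M)"
    unfolding ZE[symmetric] by (subst nn_integral_add) (auto simp: nn_integral_sum)
  moreover have "(\<Sum>i\<in>I. \<integral>\<^sup>+\<omega>. E i \<omega> \<partial>M) = ennreal ((\<Sum>i\<in>I. d i * (\<Prod>k\<in>I - {i}. a k 0)) * exp (- b 0))"
    using a_nonneg d_nonneg unfolding sum_distrib_right
    by (subst sum_ennreal[symmetric]) (auto intro!: mult_nonneg_nonneg prod_nonneg simp: E_int)
  \<comment> \<open>The merged terms have finite total expectation, equal to the first summand of
    \<open>\<Phi>'\<close>, so they can be subtracted and leave the second.\<close>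
  ultimately have "(\<integral>\<^sup>+\<omega>. Z \<omega> \<partial>M) = ennreal \<Phi>' - ennreal ((\<Sum>i\<in>I. d i * (\<Prod>k\<in>I - {i}. a k 0)) * exp (- b 0))"
    unfolding XY by (metis ennreal_add_diff_cancel_right ennreal_neq_top)
  also have "\<dots> = ennreal ((\<Prod>i\<in>I. a i 0) * d' * exp (- b 0))"
    using a_nonneg d_nonneg by (subst ennreal_minus) (auto simp: \<Phi>'_def intro!: sum_nonneg mult_nonneg_nonneg prod_nonneg)
  finally show ?case
    using insert.hyps unfolding Z_def d'_def a_def b_def G0 by (simp add: h_def mult_ac)
qed

end

subsection \<open>Gamma and Beta integrals\<close>

lemma borel_measurable_on_positive:
  assumes "sets \<nu> = sets (restrict_space borel {0<..})" and "f \<in> borel_measurable borel"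
  shows "f \<in> borel_measurable \<nu>"
  by (subst measurable_cong_sets[OF assms(1) refl]) (rule measurable_restrict_space1[OF assms(2)])

lemma nn_integral_gamma:
  assumes a: "0 < a" and b: "0 < b"
  shows "(\<integral>\<^sup>+x. ennreal (x powr (a - 1) * exp (- (b * x))) * indicator {0<..} x \<partial>lborel) =
    ennreal (Gamma a / b powr a)"
proof -
  let ?I = "\<integral>\<^sup>+x. ennreal (x powr (a - 1) * exp (- (b * x))) * indicator {0<..} x \<partial>lborel"
  have "ennreal (Gamma a) = (\<integral>\<^sup>+t. ennreal (indicator {0..} t * t powr (a - 1) / exp t) \<partial>lborel)"
    by (rule Gamma_conv_nn_integral_real[OF a])
  also have "\<dots> = ennreal \<bar>b\<bar> * (\<integral>\<^sup>+x. ennreal (indicator {0..} (0 + b * x) * (0 + b * x) powr (a - 1) / exp (0 + b * x)) \<partial>lborel)"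
    using b by (intro nn_integral_real_affine) auto
  also have "(\<integral>\<^sup>+x. ennreal (indicator {0..} (0 + b * x) * (0 + b * x) powr (a - 1) / exp (0 + b * x)) \<partial>lborel) =
     (\<integral>\<^sup>+x. ennreal (b powr (a - 1)) * (ennreal (x powr (a - 1) * exp (- (b * x))) * indicator {0<..} x) \<partial>lborel)"
  proof (rule nn_integral_cong)
    fix x :: real
    \<comment> \<open>At x = 0 both sides vanish because 0 powr (a - 1) = 0, so the closed half-line
      of the Gamma integral and the open one here agree pointwise.\<close>
    consider "x < 0" | "x = 0" | "x > 0" by linarith
    then show "ennreal (indicator {0..} (0 + b * x) * (0 + b * x) powr (a - 1) / exp (0 + b * x)) =
      ennreal (b powr (a - 1)) * (ennreal (x powr (a - 1) * exp (- (b * x))) * indicator {0<..} x)"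
      using b by cases
        (auto simp: indicator_def powr_mult exp_minus field_simps zero_le_mult_iff simp flip: ennreal_mult)
  qed
  also have "\<dots> = ennreal (b powr (a - 1)) * ?I"
    by (rule nn_integral_cmult) auto
  also have "ennreal \<bar>b\<bar> * \<dots> = ennreal (b powr a) * ?I"
    using b by (simp add: mult.assoc[symmetric] powr_diff flip: ennreal_mult)
  finally have *: "ennreal (Gamma a) = ennreal (b powr a) * ?I" .
  have "ennreal (Gamma a / b powr a) = ennreal (1 / b powr a) * ennreal (Gamma a)"
    using a b by (simp flip: ennreal_mult add: Gamma_real_pos less_imp_le)
  also have "\<dots> = ennreal (1 / b powr a) * ennreal (b powr a) * ?I"
    by (simp only: * mult.assoc)
  also have "\<dots> = ?I" using b by (simp flip: ennreal_mult)
  finally show ?thesis ..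
qed

lemma nn_integral_gamma_nat:
  assumes "1 \<le> n" "0 < b"
  shows "(\<integral>\<^sup>+x. ennreal (x ^ (n - 1) * exp (- (b * x))) * indicator {0<..} x \<partial>lborel) =
    ennreal (fact (n - 1) / b ^ n)"
proof -
  have "(\<integral>\<^sup>+x. ennreal (x ^ (n - 1) * exp (- (b * x))) * indicator {0<..} x \<partial>lborel) =
      (\<integral>\<^sup>+x. ennreal (x powr (real n - 1) * exp (- (b * x))) * indicator {0<..} x \<partial>lborel)"
    using assms by (intro nn_integral_cong) (auto simp: indicator_def of_nat_diff simp flip: powr_realpow)
  also have "\<dots> = ennreal (Gamma (real n) / b powr real n)"
    using assms by (intro nn_integral_gamma) auto
  finally show ?thesis
    using assms Gamma_fact[of "n - 1", where 'a=real] by (simp add: powr_realpow of_nat_diff)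
qed

text \<open>The substitution v = t powr \<alpha> in the Gamma integral. Change of variables is
  applied to absolutely integrable functions, hence the passage from the nonnegative integral to
  \<open>has_integral\<close> and back. In the application p is the number of blocks.\<close>

lemma nn_integral_powr_exp_powr:
  assumes \<alpha>: "0 < \<alpha>" and c: "0 < c" and p: "0 < p"
  shows "(\<integral>\<^sup>+t. ennreal (t powr (p * \<alpha> - 1) * exp (- (c * t powr \<alpha>))) * indicator {0<..} t \<partial>lborel) =
    ennreal (Gamma p / (\<alpha> * c powr p))"
proof -
  let ?S = "{0<..} :: real set" and ?f = "\<lambda>v. v powr (p - 1) * exp (- (c * v)) :: real"
    and ?g = "\<lambda>t::real. t powr \<alpha>" and ?g' = "\<lambda>t. \<alpha> * t powr (\<alpha> - 1)"
  have Gp: "0 < Gamma p / c powr p" using p c by (simp add: Gamma_real_pos)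
  have "((\<lambda>v. indicator ?S v * ?f v) has_integral (Gamma p / c powr p)) UNIV"
  proof (rule nn_integral_has_integral)
    have "(\<integral>\<^sup>+v. ennreal (indicator ?S v * ?f v) \<partial>lborel) = (\<integral>\<^sup>+v. ennreal (?f v) * indicator ?S v \<partial>lborel)"
      by (intro nn_integral_cong) (auto simp: indicator_def)
    also have "\<dots> = ennreal (Gamma p / c powr p)"
      by (rule nn_integral_gamma[OF p c])
    finally show "(\<integral>\<^sup>+v. ennreal (indicator ?S v * ?f v) \<partial>lborel) = ennreal (Gamma p / c powr p)" .
    show "(\<lambda>v. indicator ?S v * ?f v) \<in> borel_measurable borel" by measurable
    show "0 \<le> indicator ?S v * ?f v" for v by auto
    show "0 \<le> Gamma p / c powr p" using Gp by (rule less_imp_le)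
  qed
  moreover have "(\<lambda>v. indicator ?S v * ?f v) = (\<lambda>v. if v \<in> ?S then ?f v else 0)"
    by (auto simp: indicator_def)
  ultimately have "((\<lambda>v. if v \<in> ?S then ?f v else 0) has_integral (Gamma p / c powr p)) UNIV"
    by (rule back_subst[where P="\<lambda>h. (h has_integral _) _"])
  then have "(?f has_integral (Gamma p / c powr p)) ?S"
    by (rule has_integral_restrict_UNIV[THEN iffD1])
  then have f: "?f absolutely_integrable_on ?S \<and> integral ?S ?f = Gamma p / c powr p"
  proof (intro conjI nonnegative_absolutely_integrable_1)
    assume "(?f has_integral (Gamma p / c powr p)) ?S"
    then show "?f integrable_on ?S" "integral ?S ?f = Gamma p / c powr p"
      by (rule has_integral_integrable, rule integral_unique)
  qed simp
  have img: "?g ` ?S = ?S"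
  proof (intro antisym subsetI)
    fix y :: real assume "y \<in> ?S"
    then have "y = ?g (y powr (1 / \<alpha>))" "y powr (1 / \<alpha>) \<in> ?S" using \<alpha> by (auto simp: powr_powr)
    then show "y \<in> ?g ` ?S" by (rule image_eqI)
  qed auto
  have "(\<lambda>t. \<bar>?g' t\<bar> * ?f (?g t)) absolutely_integrable_on ?S \<and>
      integral ?S (\<lambda>t. \<bar>?g' t\<bar> * ?f (?g t)) = Gamma p / c powr p"
  proof (rule iffD2[OF has_absolute_integral_change_of_variables_1'[where g="?g" and g'="?g'"]])
    show "(?g has_real_derivative ?g' t) (at t within ?S)" if "t \<in> ?S" for t
      using that by (auto intro!: derivative_eq_intros)
    show "inj_on ?g ?S"
    proof (rule inj_onI)
      fix x y :: real assume "x \<in> ?S" "y \<in> ?S" "?g x = ?g y"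
      then have "(x powr \<alpha>) powr (1 / \<alpha>) = (y powr \<alpha>) powr (1 / \<alpha>)" by simp
      then show "x = y" using \<open>x \<in> ?S\<close> \<open>y \<in> ?S\<close> \<alpha> by (simp add: powr_powr)
    qed
    show "?f absolutely_integrable_on ?g ` ?S \<and> integral (?g ` ?S) ?f = Gamma p / c powr p"
      unfolding img by (rule f)
  qed simp
  then have hi: "((\<lambda>t. \<bar>?g' t\<bar> * ?f (?g t)) has_integral Gamma p / c powr p) ?S"
    unfolding has_integral_integrable_integral
    using set_lebesgue_integral_eq_integral(1) by blast
  have "((\<lambda>t. t powr (p * \<alpha> - 1) * exp (- (c * t powr \<alpha>))) has_integral (1 / \<alpha>) * (Gamma p / c powr p)) ?S"
  proof (rule has_integral_eq[OF _ has_integral_mult_right[OF hi]])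
    show "(1 / \<alpha>) * (\<bar>?g' t\<bar> * ?f (?g t)) = t powr (p * \<alpha> - 1) * exp (- (c * t powr \<alpha>))"
      if "t \<in> ?S" for t
    proof -
      have "t powr (\<alpha> - 1) * (t powr \<alpha>) powr (p - 1) = t powr (p * \<alpha> - 1)"
        using that by (simp add: powr_powr powr_add[symmetric] algebra_simps)
      then show ?thesis using \<alpha> by (simp add: abs_mult mult.assoc[symmetric])
    qed
  qed
  from nn_integral_has_integral_lebesgue[OF _ this]
  have "(\<integral>\<^sup>+t. ennreal (indicator ?S t * (t powr (p * \<alpha> - 1) * exp (- (c * t powr \<alpha>)))) \<partial>lborel) =
    ennreal (Gamma p / (\<alpha> * c powr p))" using Gp \<alpha> by (simp add: less_imp_le)
  moreover have "(\<integral>\<^sup>+t. ennreal (t powr (p * \<alpha> - 1) * exp (- (c * t powr \<alpha>))) * indicator {0<..} t \<partial>lborel) =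
    (\<integral>\<^sup>+t. ennreal (indicator ?S t * (t powr (p * \<alpha> - 1) * exp (- (c * t powr \<alpha>)))) \<partial>lborel)"
    by (intro nn_integral_cong) (auto simp: indicator_def)
  ultimately show ?thesis by (rule trans[rotated])
qed

text \<open>The Beta function of a and \<theta> as an integral over the half-line. After
  multiplication by Gamma (a + \<theta>), the power of 1 + t becomes a Gamma integral in x;
  exchanging the order leaves a Gamma integral in t and then one in x.\<close>

lemma nn_integral_beta_prime:
  assumes a: "0 < a" and \<theta>: "0 < \<theta>"
  shows "(\<integral>\<^sup>+t. ennreal (t powr (a - 1) * (1 + t) powr (- (a + \<theta>))) * indicator {0<..} t \<partial>lborel) =
    ennreal (Gamma a * Gamma \<theta> / Gamma (a + \<theta>))"
proof -
  let ?G = "Gamma (a + \<theta>)"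
  have G: "0 < ?G" "0 < Gamma a" "0 < Gamma \<theta>" using assms by (auto intro!: Gamma_real_pos)
  let ?h = "\<lambda>t x. t powr (a - 1) * (x powr (a + \<theta> - 1) * exp (- ((1 + t) * x))) :: real"
  have "ennreal ?G * (\<integral>\<^sup>+t. ennreal (t powr (a - 1) * (1 + t) powr (- (a + \<theta>))) * indicator {0<..} t \<partial>lborel) =
      (\<integral>\<^sup>+t. (\<integral>\<^sup>+x. ennreal (?h t x) * indicator {0<..} x * indicator {0<..} t \<partial>lborel) \<partial>lborel)"
  proof (subst nn_integral_cmult[symmetric], simp, rule nn_integral_cong)
    fix t :: real
    show "ennreal ?G * (ennreal (t powr (a - 1) * (1 + t) powr (- (a + \<theta>))) * indicator {0<..} t) =
      (\<integral>\<^sup>+x. ennreal (?h t x) * indicator {0<..} x * indicator {0<..} t \<partial>lborel)"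
    proof (cases "0 < t")
      case True
      have "(\<integral>\<^sup>+x. ennreal (?h t x) * indicator {0<..} x * indicator {0<..} t \<partial>lborel) =
         (\<integral>\<^sup>+x. ennreal (t powr (a - 1)) * (ennreal (x powr (a + \<theta> - 1) * exp (- ((1 + t) * x))) * indicator {0<..} x) \<partial>lborel)"
        using True by (intro nn_integral_cong) (auto simp: indicator_def simp flip: ennreal_mult)
      also have "\<dots> = ennreal (t powr (a - 1)) * ennreal (?G / (1 + t) powr (a + \<theta>))"
        using nn_integral_gamma[of "a + \<theta>" "1 + t"] True assms by (subst nn_integral_cmult) auto
      also have "?G / (1 + t) powr (a + \<theta>) = ?G * (1 + t) powr (- (a + \<theta>))"
        by (simp only: powr_minus divide_inverse)
      finally show ?thesis using True G by (simp add: ennreal_mult mult_ac)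
    qed simp
  qed
  also have "\<dots> = (\<integral>\<^sup>+x. (\<integral>\<^sup>+t. ennreal (?h t x) * indicator {0<..} x * indicator {0<..} t \<partial>lborel) \<partial>lborel)"
    by (rule lborel_pair.Fubini') simp
  also have "\<dots> = (\<integral>\<^sup>+x. ennreal (Gamma a) * (ennreal (x powr (\<theta> - 1) * exp (- (1 * x))) * indicator {0<..} x) \<partial>lborel)"
  proof (rule nn_integral_cong)
    fix x :: real
    show "(\<integral>\<^sup>+t. ennreal (?h t x) * indicator {0<..} x * indicator {0<..} t \<partial>lborel) =
      ennreal (Gamma a) * (ennreal (x powr (\<theta> - 1) * exp (- (1 * x))) * indicator {0<..} x)"
    proof (cases "0 < x")
      case True
      have "(\<integral>\<^sup>+t. ennreal (?h t x) * indicator {0<..} x * indicator {0<..} t \<partial>lborel) =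
         (\<integral>\<^sup>+t. ennreal (x powr (a + \<theta> - 1) * exp (- x)) * (ennreal (t powr (a - 1) * exp (- (x * t))) * indicator {0<..} t) \<partial>lborel)"
        using True by (intro nn_integral_cong)
          (auto simp: indicator_def algebra_simps exp_diff exp_minus field_simps mult_exp_exp simp flip: ennreal_mult)
      also have "\<dots> = ennreal (x powr (a + \<theta> - 1) * exp (- x)) * ennreal (Gamma a / x powr a)"
        using nn_integral_gamma[of a x] True assms by (subst nn_integral_cmult) auto
      also have "\<dots> = ennreal (Gamma a * (x powr (\<theta> - 1) * exp (- x)))"
        using True G by (simp add: powr_add powr_diff field_simps flip: ennreal_mult)
      finally show ?thesis using True G by (simp add: ennreal_mult)
    qed simp
  qed
  also have "\<dots> = ennreal (Gamma a) * ennreal (Gamma \<theta>)"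
    using nn_integral_gamma[of \<theta> 1] \<theta> by (subst nn_integral_cmult) auto
  finally have *: "ennreal ?G * (\<integral>\<^sup>+t. ennreal (t powr (a - 1) * (1 + t) powr (- (a + \<theta>))) * indicator {0<..} t \<partial>lborel) =
    ennreal (Gamma a * Gamma \<theta>)" using G by (simp add: ennreal_mult)
  have "ennreal (Gamma a * Gamma \<theta> / ?G) = ennreal (1 / ?G) * ennreal (Gamma a * Gamma \<theta>)"
    using G by (simp flip: ennreal_mult)
  also note *[symmetric]
  finally show ?thesis using G by (simp add: mult.assoc[symmetric] flip: ennreal_mult)
qed

text \<open>Since 1 - exp (- t w) is the integral of w * exp (- u w) over u from 0 to t, the Laplace
  exponent \<psi> is a primitive of \<kappa> 1. The interval excludes 0 because the moment formulas
  hold for positive u.\<close>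

lemma nn_integral_one_minus_exp:
  fixes \<nu> :: "real measure"
  assumes sf: "sigma_finite_measure \<nu>" and sets: "sets \<nu> = sets (restrict_space borel {0<..})"
    and t: "0 < t"
  shows "(\<integral>\<^sup>+w. ennreal (1 - exp (- (t * w))) \<partial>\<nu>) =
    (\<integral>\<^sup>+u. (\<integral>\<^sup>+w. ennreal (w * exp (- (u * w))) \<partial>\<nu>) * indicator {0<..t} u \<partial>lborel)"
proof -
  interpret \<nu>: sigma_finite_measure \<nu> by fact
  interpret pair_sigma_finite \<nu> lborel by standard
  have sp: "space \<nu> = {0<..}" using sets_eq_imp_space_eq[OF sets] by (simp add: space_restrict_space)
  have id: "(\<lambda>w. w) \<in> measurable \<nu> borel" by (rule borel_measurable_on_positive[OF sets]) simp
  have fst: "fst \<in> measurable (\<nu> \<Otimes>\<^sub>M lborel) borel"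
    by (rule measurable_compose[OF measurable_fst id])
  have "(\<integral>\<^sup>+w. ennreal (1 - exp (- (t * w))) \<partial>\<nu>) =
      (\<integral>\<^sup>+w. (\<integral>\<^sup>+u. ennreal (w * exp (- (u * w))) * indicator {0<..t} u \<partial>lborel) \<partial>\<nu>)"
  proof (rule nn_integral_cong)
    fix w assume "w \<in> space \<nu>"
    then have w: "0 < w" by (simp add: sp)
    have "(\<integral>\<^sup>+u. ennreal (w * exp (- (u * w))) * indicator {0..t} u \<partial>lborel) =
        ennreal (- exp (- (t * w)) - (- exp (- (0 * w))))"
    proof (rule nn_integral_FTC_Icc)
      show "((\<lambda>u. - exp (- (u * w))) has_real_derivative w * exp (- (u * w))) (at u)" for u
        by (rule derivative_eq_intros refl)+ simp
    qed (use t w in auto)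
    moreover have "(\<integral>\<^sup>+u. ennreal (w * exp (- (u * w))) * indicator {0..t} u \<partial>lborel) =
        (\<integral>\<^sup>+u. ennreal (w * exp (- (u * w))) * indicator {0<..t} u \<partial>lborel)"
      by (rule nn_integral_cong_AE, rule AE_mp[OF AE_lborel_singleton[of 0]]) (auto simp: indicator_def)
    ultimately show "ennreal (1 - exp (- (t * w))) =
        (\<integral>\<^sup>+u. ennreal (w * exp (- (u * w))) * indicator {0<..t} u \<partial>lborel)" by simp
  qed
  also have "\<dots> = (\<integral>\<^sup>+u. (\<integral>\<^sup>+w. ennreal (w * exp (- (u * w))) * indicator {0<..t} u \<partial>\<nu>) \<partial>lborel)"
  proof (rule Fubini'[symmetric])
    have [measurable]: "snd \<in> measurable (\<nu> \<Otimes>\<^sub>M lborel) borel"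
      using measurable_snd[of \<nu> lborel] by simp
    note fst [measurable]
    show "(\<lambda>(w, u). ennreal (w * exp (- (u * w))) * indicator {0<..t} u) \<in> borel_measurable (\<nu> \<Otimes>\<^sub>M lborel)"
      unfolding split_beta' by measurable
  qed
  also have "\<dots> = (\<integral>\<^sup>+u. (\<integral>\<^sup>+w. ennreal (w * exp (- (u * w))) \<partial>\<nu>) * indicator {0<..t} u \<partial>lborel)"
    by (intro nn_integral_cong nn_integral_multc) (rule measurable_compose[OF id], measurable)
  finally show ?thesis .
qed

subsection \<open>The race of Frechet variables\<close>

context prob_space
begin

text \<open>Takes the place of conditioning on \<open>X\<close>: the value of \<open>X\<close> is
  frozen and \<open>X'\<close> is drawn from a separate \<omega>'. The hypothesis is the bare
  product rule, so that it can be obtained from \<open>indep_var\<close> as well as from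
  \<open>indep_rvs\<close>.\<close>

lemma emeasure_independent_pair:
  assumes [measurable]: "X \<in> measurable M N" "X' \<in> measurable M N'"
    and ind: "\<And>A B. A \<in> sets N \<Longrightarrow> B \<in> sets N' \<Longrightarrow>
      prob ((X -` A \<inter> space M) \<inter> (X' -` B \<inter> space M)) = prob (X -` A \<inter> space M) * prob (X' -` B \<inter> space M)"
    and Q: "Q \<in> sets (N \<Otimes>\<^sub>M N')"
  shows "emeasure M {\<omega>\<in>space M. (X \<omega>, X' \<omega>) \<in> Q} =
    (\<integral>\<^sup>+\<omega>. emeasure M {\<omega>'\<in>space M. (X \<omega>, X' \<omega>') \<in> Q} \<partial>M)"
proof -
  interpret D: prob_space "distr M N X" by (rule prob_space_distr) measurable
  interpret D': prob_space "distr M N' X'" by (rule prob_space_distr) measurable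
  have eq: "distr M N X \<Otimes>\<^sub>M distr M N' X' = distr M (N \<Otimes>\<^sub>M N') (\<lambda>\<omega>. (X \<omega>, X' \<omega>))"
  proof (rule pair_measure_eqI)
    fix A B assume AB: "A \<in> sets (distr M N X)" "B \<in> sets (distr M N' X')"
    have "(\<lambda>\<omega>. (X \<omega>, X' \<omega>)) -` (A \<times> B) \<inter> space M = (X -` A \<inter> space M) \<inter> (X' -` B \<inter> space M)"
      by auto
    then show "emeasure (distr M N X) A * emeasure (distr M N' X') B =
        emeasure (distr M (N \<Otimes>\<^sub>M N') (\<lambda>\<omega>. (X \<omega>, X' \<omega>))) (A \<times> B)"
      using AB ind[of A B] by (simp add: emeasure_distr emeasure_eq_measure flip: ennreal_mult)
  qed (auto intro: D.sigma_finite_measure D'.sigma_finite_measure)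
  have "emeasure M {\<omega>\<in>space M. (X \<omega>, X' \<omega>) \<in> Q} = emeasure (distr M N X \<Otimes>\<^sub>M distr M N' X') Q"
    unfolding eq using Q by (subst emeasure_distr) (auto intro!: arg_cong[where f="emeasure M"])
  also have "\<dots> = (\<integral>\<^sup>+x. emeasure (distr M N' X') (Pair x -` Q) \<partial>distr M N X)"
    using Q by (intro D'.emeasure_pair_measure_alt) (simp cong: sets_pair_measure_cong)
  also have "\<dots> = (\<integral>\<^sup>+\<omega>. emeasure (distr M N' X') (Pair (X \<omega>) -` Q) \<partial>M)"
  proof (rule nn_integral_distr)
    have "Q \<in> sets (N \<Otimes>\<^sub>M distr M N' X')" using Q by (simp cong: sets_pair_measure_cong)
    then show "(\<lambda>x. emeasure (distr M N' X') (Pair x -` Q)) \<in> borel_measurable (distr M N X)"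
      using D'.measurable_emeasure_Pair by simp
  qed measurable
  also have "\<dots> = (\<integral>\<^sup>+\<omega>. emeasure M {\<omega>'\<in>space M. (X \<omega>, X' \<omega>') \<in> Q} \<partial>M)"
  proof (rule nn_integral_cong)
    fix \<omega> assume "\<omega> \<in> space M"
    have "Pair (X \<omega>) -` Q \<in> sets N'" using Q by (rule sets_Pair1)
    then show "emeasure (distr M N' X') (Pair (X \<omega>) -` Q) = emeasure M {\<omega>'\<in>space M. (X \<omega>, X' \<omega>') \<in> Q}"
      by (subst emeasure_distr) (auto intro!: arg_cong[where f="emeasure M"])
  qed
  finally show ?thesis .
qed

text \<open>\<open>frechet1\<close> fixes the distribution function on positive arguments; the value
  at 0 is bounded by exp (- \<sigma> / x) along x = 1 / (k + 1).\<close>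

lemma frechet1_positive:
  assumes Z: "frechet1 M \<sigma> Z" and "0 < \<sigma>"
  shows "prob {\<omega>\<in>space M. Z \<omega> \<le> 0} = 0"
proof -
  have [measurable]: "Z \<in> borel_measurable M" using Z by (simp add: frechet1_def)
  have "prob {\<omega>\<in>space M. Z \<omega> \<le> 0} \<le> exp (- \<sigma> * real (Suc k))" for k
  proof -
    have "prob {\<omega>\<in>space M. Z \<omega> \<le> 0} \<le> prob {\<omega>\<in>space M. Z \<omega> \<le> 1 / real (Suc k)}"
      by (intro finite_measure_mono) (auto intro: order_trans)
    then show ?thesis using Z by (simp add: frechet1_def)
  qed
  moreover have "(\<lambda>k. exp (- \<sigma> * real (Suc k))) \<longlonglongrightarrow> 0" using \<open>0 < \<sigma>\<close> by real_asymp
  ultimately have "prob {\<omega>\<in>space M. Z \<omega> \<le> 0} \<le> 0" by (intro LIMSEQ_le_const) auto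
  then show ?thesis by (simp add: measure_le_0_iff)
qed

text \<open>There is no atom at \<open>y\<close> because exp (- \<sigma> / x) is continuous
  there.\<close>

lemma frechet1_less:
  assumes Z: "frechet1 M \<sigma> Z" and y: "0 < y"
  shows "prob {\<omega>\<in>space M. Z \<omega> < y} = exp (- \<sigma> / y)"
proof (rule LIMSEQ_unique)
  have [measurable]: "Z \<in> borel_measurable M" using Z by (simp add: frechet1_def)
  \<comment> \<open>Increases to \<open>y\<close> from strictly below; the shift by 2 keeps all
    terms positive, where the distribution function is known.\<close>
  let ?y = "\<lambda>k. y * (1 - 1 / real (k + 2))"
  let ?A = "\<lambda>k. {\<omega>\<in>space M. Z \<omega> \<le> ?y k}"
  have "(\<Union>k. ?A k) = {\<omega>\<in>space M. Z \<omega> < y}"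
  proof safe
    fix \<omega> k assume "Z \<omega> \<le> ?y k"
    also have "?y k < y * 1" using y by (intro mult_strict_left_mono) auto
    finally show "Z \<omega> < y" by simp
  next
    fix \<omega> assume w: "\<omega> \<in> space M" "Z \<omega> < y"
    have "?y \<longlonglongrightarrow> y" by real_asymp
    from order_tendstoD(1)[OF this w(2)] obtain k where "Z \<omega> < ?y k"
      by (auto simp: eventually_sequentially)
    then show "\<omega> \<in> (\<Union>k. ?A k)" using w by (auto intro: less_imp_le)
  qed
  moreover have "incseq ?A"
  proof (rule incseq_SucI, safe)
    fix k \<omega> assume "Z \<omega> \<le> ?y k"
    also have "?y k \<le> ?y (Suc k)" using y by (intro mult_left_mono) (auto simp: field_simps)
    finally show "Z \<omega> \<le> ?y (Suc k)" .
  qed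
  ultimately show "(\<lambda>k. prob (?A k)) \<longlonglongrightarrow> prob {\<omega>\<in>space M. Z \<omega> < y}"
    using finite_Lim_measure_incseq[of ?A] by (simp add: image_subset_iff)
  have "prob (?A k) = exp (- \<sigma> / ?y k)" for k
    using Z y by (simp add: frechet1_def)
  moreover have "(\<lambda>k. exp (- \<sigma> / ?y k)) \<longlonglongrightarrow> exp (- \<sigma> / y)"
  proof (intro tendsto_intros)
    show "?y \<longlonglongrightarrow> y" by real_asymp
  qed (use y in simp)
  ultimately show "(\<lambda>k. prob (?A k)) \<longlonglongrightarrow> exp (- \<sigma> / y)" by simp
qed

text \<open>\<sigma> / Z is standard exponential, with Laplace transform 1 / (1 + c). This is where
  the scale parameter disappears.\<close>

lemma nn_integral_frechet1:
  assumes Z: "frechet1 M \<sigma> Z" and \<sigma>: "0 < \<sigma>" and c: "0 \<le> c"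
  shows "(\<integral>\<^sup>+\<omega>. ennreal (exp (- (c * (\<sigma> / Z \<omega>)))) \<partial>M) = ennreal (1 / (1 + c))"
proof -
  have [measurable]: "Z \<in> borel_measurable M" using Z by (simp add: frechet1_def)
  have D: "distributed M lborel (\<lambda>\<omega>. \<sigma> / Z \<omega>) (exponential_density 1)"
  proof (rule exponential_distributedI)
    fix a :: real assume a: "0 \<le> a"
    have ae: "AE \<omega> in M. 0 < Z \<omega>"
      using frechet1_positive[OF Z \<sigma>] by (subst (asm) prob_eq_0) (auto elim!: eventually_mono)
    have "prob {x \<in> space M. \<sigma> / Z x \<le> a} = 1 - exp (- a * 1)"
    proof (cases "a = 0")
      case True
      then have "prob {x \<in> space M. \<sigma> / Z x \<le> a} = 0"
        using ae \<sigma> by (subst prob_eq_0) (auto elim!: eventually_mono simp: divide_le_0_iff)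
      then show ?thesis using True by simp
    next
      case False
      then have a: "0 < a" using a by simp
      have "prob {x \<in> space M. \<sigma> / Z x \<le> a} = prob (space M - {\<omega>\<in>space M. Z \<omega> < \<sigma> / a})"
      proof (rule finite_measure_eq_AE)
        show "AE x in M. (x \<in> {x \<in> space M. \<sigma> / Z x \<le> a}) = (x \<in> space M - {\<omega> \<in> space M. Z \<omega> < \<sigma> / a})"
          using ae by eventually_elim (use a in \<open>auto simp: field_simps\<close>)
      qed measurable
      also have "\<dots> = 1 - exp (- \<sigma> / (\<sigma> / a))"
        using frechet1_less[OF Z, of "\<sigma> / a"] \<sigma> a by (subst prob_compl) auto
      finally show ?thesis using \<sigma> a by simp
    qed
    then show "emeasure M {x \<in> space M. \<sigma> / Z x \<le> a} = 1 - ennreal (exp (- a * 1))"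
      using a by (simp add: emeasure_eq_measure ennreal_minus flip: ennreal_1)
  qed auto
  have "(\<integral>\<^sup>+\<omega>. ennreal (exp (- (c * (\<sigma> / Z \<omega>)))) \<partial>M) =
      (\<integral>\<^sup>+e. ennreal (exponential_density 1 e) * ennreal (exp (- (c * e))) \<partial>lborel)"
    by (rule distributed_nn_integral[OF D, symmetric]) simp
  also have "\<dots> = (\<integral>\<^sup>+e. ennreal (e powr (1 - 1) * exp (- ((1 + c) * e))) * indicator {0<..} e \<partial>lborel)"
  proof (rule nn_integral_cong_AE, rule AE_mp[OF AE_lborel_singleton[of 0]], rule AE_I2, rule impI)
    fix e :: real assume "e \<noteq> 0"
    then show "ennreal (exponential_density 1 e) * ennreal (exp (- (c * e))) =
        ennreal (e powr (1 - 1) * exp (- ((1 + c) * e))) * indicator {0<..} e"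
      by (auto simp: exponential_density_def indicator_def algebra_simps mult_exp_exp simp flip: ennreal_mult)
  qed
  also have "\<dots> = ennreal (Gamma 1 / (1 + c) powr 1)"
    using c by (intro nn_integral_gamma) auto
  finally show ?thesis using c by simp
qed

text \<open>Given Z m = z and y = x m * z, all other scores stay below y with probability exp (-
  \<sigma> * (S - x m) / y), S being the total weight. Averaging over z is the Laplace transform
  above at c = (S - x m) / x m, and 1 / (1 + c) = x m / S.\<close>

lemma frechet1_race:
  assumes ind: "indep_vars (\<lambda>_. borel) Z (UNIV :: nat set)"
    and Z: "\<And>l. frechet1 M \<sigma> (Z l)" and \<sigma>: "0 < \<sigma>"
    and x: "\<And>l. 0 < x l" and sx: "summable x"
  shows "prob {\<omega>\<in>space M. \<forall>l\<in>UNIV - {m}. x l * Z l \<omega> < x m * Z m \<omega>} = x m / suminf x"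
proof -
  let ?R = "UNIV - {m}"
  have [measurable]: "Z l \<in> borel_measurable M" for l using Z by (simp add: frechet1_def)
  have S: "0 < suminf x" using x sx by (simp add: suminf_pos)
  have Sm: "x m \<le> suminf x" using sum_le_suminf[OF sx, of "{m}"] x by (simp add: less_imp_le)
  define X where "X = (\<lambda>\<omega>. restrict (\<lambda>l. Z l \<omega>) {m})"
  define X' where "X' = (\<lambda>\<omega>. restrict (\<lambda>l. Z l \<omega>) ?R)"
  let ?N = "\<Pi>\<^sub>M l\<in>{m}. (borel :: real measure)" and ?N' = "\<Pi>\<^sub>M l\<in>?R. (borel :: real measure)"
  have [measurable]: "X \<in> measurable M ?N" "X' \<in> measurable M ?N'"
    unfolding X_def X'_def by measurable
  have iv: "indep_var ?N X ?N' X'"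
    unfolding X_def X'_def by (rule indep_var_restrict[OF ind]) auto
  define Q where "Q = {p \<in> space (?N \<Otimes>\<^sub>M ?N'). \<forall>l\<in>?R. x l * snd p l < x m * fst p m}"
  have Q: "Q \<in> sets (?N \<Otimes>\<^sub>M ?N')" unfolding Q_def by measurable
  have inQ: "(X \<omega>, X' \<omega>') \<in> Q \<longleftrightarrow> (\<forall>l\<in>?R. x l * Z l \<omega>' < x m * Z m \<omega>)"
    if "\<omega> \<in> space M" "\<omega>' \<in> space M" for \<omega> \<omega>'
    by (auto simp: Q_def space_pair_measure space_PiM X_def X'_def)
  have "emeasure M {\<omega>\<in>space M. \<forall>l\<in>?R. x l * Z l \<omega> < x m * Z m \<omega>} = emeasure M {\<omega>\<in>space M. (X \<omega>, X' \<omega>) \<in> Q}"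
    using inQ by (auto intro!: arg_cong[where f="emeasure M"])
  also have "\<dots> = (\<integral>\<^sup>+\<omega>. emeasure M {\<omega>'\<in>space M. (X \<omega>, X' \<omega>') \<in> Q} \<partial>M)"
  proof (rule emeasure_independent_pair[OF _ _ _ Q])
    fix A B assume "A \<in> sets ?N" "B \<in> sets ?N'"
    from indep_varD[OF iv this]
    show "prob ((X -` A \<inter> space M) \<inter> (X' -` B \<inter> space M)) = prob (X -` A \<inter> space M) * prob (X' -` B \<inter> space M)"
      by (simp add: Int_assoc[symmetric] vimage_def Collect_conj_eq[symmetric] conj_commute Int_def conj_left_commute cong: conj_cong)
  qed measurable
  also have "\<dots> = (\<integral>\<^sup>+\<omega>. ennreal (exp (- ((suminf x - x m) / x m * (\<sigma> / Z m \<omega>)))) \<partial>M)"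
  proof (rule nn_integral_cong_AE)
    have "AE \<omega> in M. 0 < Z m \<omega>"
      using frechet1_positive[OF Z \<sigma>, of m] by (subst (asm) prob_eq_0) (auto elim!: eventually_mono)
    then show "AE \<omega> in M. emeasure M {\<omega>'\<in>space M. (X \<omega>, X' \<omega>') \<in> Q} =
        ennreal (exp (- ((suminf x - x m) / x m * (\<sigma> / Z m \<omega>))))"
    proof (rule AE_mp, intro AE_I2 impI)
      fix \<omega> assume w: "\<omega> \<in> space M" and pos: "0 < Z m \<omega>"
      define y where "y = x m * Z m \<omega>"
      have y: "0 < y" using pos x by (simp add: y_def)
      \<comment> \<open>The infinitely many constraints are the decreasing limit of the first k of
        them.\<close>
      let ?A = "\<lambda>k. {\<omega>'\<in>space M. \<forall>l\<in>{..<k} - {m}. x l * Z l \<omega>' < y}"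
      have A: "prob (?A k) = exp (- (\<sigma> / y) * (\<Sum>l\<in>{..<k} - {m}. x l))" for k
      proof (cases "{..<k} - {m} = {}")
        case False
        have "?A k = (\<Inter>l\<in>{..<k} - {m}. Z l -` {..<y / x l} \<inter> space M)"
          using False x by (auto simp: pos_less_divide_eq mult.commute)
        also have "prob \<dots> = (\<Prod>l\<in>{..<k} - {m}. prob (Z l -` {..<y / x l} \<inter> space M))"
          using False by (intro indep_varsD[OF ind]) auto
        also have "\<dots> = (\<Prod>l\<in>{..<k} - {m}. exp (- (\<sigma> / y) * x l))"
        proof (rule prod.cong)
          fix l
          have "Z l -` {..<y / x l} \<inter> space M = {\<omega>\<in>space M. Z l \<omega> < y / x l}" by auto
          then show "prob (Z l -` {..<y / x l} \<inter> space M) = exp (- (\<sigma> / y) * x l)"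
            using frechet1_less[OF Z, of "y / x l" l] y x[of l] by simp
        qed simp
        finally show ?thesis by (simp add: exp_sum sum_distrib_left)
      next
        case True
        then show ?thesis unfolding True by (simp add: prob_space)
      qed
      have "(\<Inter>k. ?A k) = {\<omega>'\<in>space M. (X \<omega>, X' \<omega>') \<in> Q}"
        using inQ[OF w] by (auto simp: y_def)
      moreover have "decseq ?A" by (auto simp: decseq_def)
      ultimately have "(\<lambda>k. prob (?A k)) \<longlonglongrightarrow> prob {\<omega>'\<in>space M. (X \<omega>, X' \<omega>') \<in> Q}"
        using finite_Lim_measure_decseq[of ?A] by (simp add: image_subset_iff)
      moreover have "(\<lambda>k. prob (?A k)) \<longlonglongrightarrow> exp (- (\<sigma> / y) * (suminf x - x m))"
        unfolding A
      proof (intro tendsto_intros)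
        have "(\<lambda>k. (\<Sum>l<k. x l) - x m) \<longlonglongrightarrow> suminf x - x m"
          using summable_LIMSEQ[OF sx] by (intro tendsto_intros)
        then show "(\<lambda>k. \<Sum>l\<in>{..<k} - {m}. x l) \<longlonglongrightarrow> suminf x - x m"
          by (rule Lim_transform_eventually)
             (use eventually_gt_at_top[of m] in eventually_elim, simp add: sum_diff1)
      qed
      ultimately have "prob {\<omega>'\<in>space M. (X \<omega>, X' \<omega>') \<in> Q} = exp (- (\<sigma> / y) * (suminf x - x m))"
        by (rule LIMSEQ_unique)
      also have "- (\<sigma> / y) * (suminf x - x m) = - ((suminf x - x m) / x m * (\<sigma> / Z m \<omega>))"
        by (simp add: y_def)
      finally show "emeasure M {\<omega>'\<in>space M. (X \<omega>, X' \<omega>') \<in> Q} =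
          ennreal (exp (- ((suminf x - x m) / x m * (\<sigma> / Z m \<omega>))))"
        by (simp add: emeasure_eq_measure)
    qed
  qed
  also have "\<dots> = ennreal (1 / (1 + (suminf x - x m) / x m))"
    using x[of m] Sm by (intro nn_integral_frechet1[OF Z \<sigma>]) simp
  also have "1 / (1 + (suminf x - x m) / x m) = x m / suminf x"
    using x[of m] S by (simp add: field_simps)
  finally show ?thesis
    using S x[of m] by (simp add: emeasure_eq_measure less_imp_le)
qed

end

text \<open>The hitting index as a function of one sequence of scores, so that the points can be
  frozen while the Frechet variables stay random.\<close>

definition first_argmax :: "(nat \<Rightarrow> real) \<Rightarrow> nat" where
  "first_argmax u = (LEAST l. is_arg_max u (\<lambda>_. True) l)"

lemma first_argmax_measurable [measurable (raw)]:
  assumes [measurable]: "\<And>l. u l \<in> borel_measurable N"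
  shows "(\<lambda>\<omega>. first_argmax (\<lambda>l. u l \<omega>)) \<in> measurable N (count_space UNIV)"
  unfolding first_argmax_def is_arg_max_def by measurable

lemma first_argmax_eqI:
  assumes "\<And>l. l \<noteq> m \<Longrightarrow> u l < u m"
  shows "first_argmax u = m"
  unfolding first_argmax_def
proof (rule Least_equality)
  show "is_arg_max u (\<lambda>_. True) m"
    using assms by (metis is_arg_max_def less_asym)
  show "m \<le> l" if "is_arg_max u (\<lambda>_. True) l" for l
    using that assms[of l] by (cases "l = m") (auto simp: is_arg_max_def)
qed

text \<open>A strict winner m is the argmax, so the race bounds the probability below by x m / S.
  Both families sum to 1 over m, so the bounds are equalities; ties and unattained suprema need no
  separate treatment.\<close>

lemma (in prob_space) prob_first_argmax:
  assumes ind: "indep_vars (\<lambda>_. borel) Z (UNIV :: nat set)"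
    and Z: "\<And>l. frechet1 M \<sigma> (Z l)" and \<sigma>: "0 < \<sigma>"
    and x: "\<And>l. 0 < x l" and sx: "summable x"
  shows "prob {\<omega>\<in>space M. first_argmax (\<lambda>l. x l * Z l \<omega>) = m} = x m / suminf x"
proof -
  have [measurable]: "Z l \<in> borel_measurable M" for l using Z by (simp add: frechet1_def)
  let ?p = "\<lambda>m. prob {\<omega>\<in>space M. first_argmax (\<lambda>l. x l * Z l \<omega>) = m}"
  let ?q = "\<lambda>m. x m / suminf x"
  have S: "0 < suminf x" using x sx by (simp add: suminf_pos)
  have le: "?q m \<le> ?p m" for m
    unfolding frechet1_race[OF ind Z \<sigma> x sx, of m, symmetric]
    by (intro finite_measure_mono) (auto intro: first_argmax_eqI)
  have p: "?p sums 1"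
  proof -
    let ?A = "\<lambda>m. {\<omega>\<in>space M. first_argmax (\<lambda>l. x l * Z l \<omega>) = m}"
    have "?p sums prob (\<Union>m. ?A m)"
      by (rule finite_measure_UNION) (auto simp: disjoint_family_on_def)
    also have "(\<Union>m. ?A m) = space M" by auto
    finally show ?thesis by (simp add: prob_space)
  qed
  have q: "?q sums 1"
    using sums_divide[OF summable_sums[OF sx], of "suminf x"] S by simp
  have pq: "(\<lambda>m. ?p m - ?q m) sums 0" using sums_diff[OF p q] by simp
  have "?p m - ?q m \<le> (\<Sum>m. ?p m - ?q m)"
    using sum_le_suminf[OF sums_summable[OF pq], of "{m}"] le by simp
  then show ?thesis using le[of m] sums_unique[OF pq] by simp
qed

section \<open>Independence of the races in different coordinates\<close>

context prob_space
begin

text \<open>The assumptions concern rows, whereas the race in coordinate k runs along column k;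
  joint independence of all entries allows the regrouping. A finite family of constraints on entries
  becomes a product of events about whole rows once the free entries are constrained to the whole
  space.\<close>

lemma indep_vars_rows_imp_entries:
  assumes K: "finite K"
    and rows: "indep_vars (\<lambda>_. \<Pi>\<^sub>M k\<in>K. N k) (\<lambda>l \<omega>. \<lambda>k\<in>K. Y l k \<omega>) L"
    and comps: "\<And>l. l \<in> L \<Longrightarrow> indep_vars N (Y l) K"
  shows "indep_vars (\<lambda>(l, k). N k) (\<lambda>(l, k). Y l k) (L \<times> K)"
  unfolding indep_vars_def2
proof (intro conjI ballI)
  have rv: "Y l k \<in> measurable M (N k)" if "l \<in> L" "k \<in> K" for l k
    using comps[OF that(1)] that(2) by (auto simp: indep_vars_def)
  then show "(case p of (l, k) \<Rightarrow> Y l k) \<in> measurable M (case p of (l, k) \<Rightarrow> N k)" if "p \<in> L \<times> K" for p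
    using that by auto
  show "indep_sets (\<lambda>p. {(case p of (l, k) \<Rightarrow> Y l k) -` A \<inter> space M |A. A \<in> sets (case p of (l, k) \<Rightarrow> N k)}) (L \<times> K)"
  proof (rule indep_setsI)
    show "{(case p of (l, k) \<Rightarrow> Y l k) -` A \<inter> space M |A. A \<in> sets (case p of (l, k) \<Rightarrow> N k)} \<subseteq> events"
      if "p \<in> L \<times> K" for p
      using that rv by (auto intro: measurable_sets)
    fix A P assume P: "P \<noteq> {}" "P \<subseteq> L \<times> K" "finite P"
      and A: "\<forall>p\<in>P. A p \<in> {(case p of (l, k) \<Rightarrow> Y l k) -` A \<inter> space M |A. A \<in> sets (case p of (l, k) \<Rightarrow> N k)}"
    have "\<forall>p\<in>P. \<exists>B. A p = Y (fst p) (snd p) -` B \<inter> space M \<and> B \<in> sets (N (snd p))"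
      using A by (auto simp: split_beta)
    then obtain B where B: "\<And>p. p \<in> P \<Longrightarrow> A p = Y (fst p) (snd p) -` B p \<inter> space M"
      "\<And>p. p \<in> P \<Longrightarrow> B p \<in> sets (N (snd p))" by metis
    \<comment> \<open>The trivial constraint outside \<open>P\<close> completes every row that
      \<open>P\<close> meets; it contributes the factor 1.\<close>
    define C where "C p = (if p \<in> P then B p else space (N (snd p)))" for p
    have C [measurable]: "C (l, k) \<in> sets (N k)" for l k
      using B(2)[of "(l, k)"] by (auto simp: C_def)
    define R where "R = fst ` P"
    have R: "finite R" "R \<noteq> {}" "R \<subseteq> L" using P by (auto simp: R_def)
    have K0: "K \<noteq> {}" using P by auto
    let ?D = "\<lambda>l. PiE K (\<lambda>k. C (l, k))"
    have row: "(\<lambda>\<omega>. \<lambda>k\<in>K. Y l k \<omega>) -` ?D l \<inter> space M = (\<Inter>k\<in>K. Y l k -` C (l, k) \<inter> space M)" for l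
      using K0 by (auto simp: PiE_iff)
    have outside: "Y l k -` C (l, k) \<inter> space M = space M" if "l \<in> L" "k \<in> K" "(l, k) \<notin> P" for l k
      using that measurable_space[OF rv[OF that(1,2)]] by (auto simp: C_def)
    have "(\<Inter>p\<in>P. A p) = (\<Inter>l\<in>R. (\<lambda>\<omega>. \<lambda>k\<in>K. Y l k \<omega>) -` ?D l \<inter> space M)"
    proof (rule antisym; rule subsetI)
      fix \<omega> assume w: "\<omega> \<in> (\<Inter>p\<in>P. A p)"
      have sp: "\<omega> \<in> space M" using w P(1) B(1) by blast
      have "Y l k \<omega> \<in> C (l, k)" if "l \<in> R" "k \<in> K" for l k
      proof (cases "(l, k) \<in> P")
        case True
        then show ?thesis using w B(1)[OF True] by (auto simp: C_def)
      next
        case False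
        then show ?thesis using outside[of l k] sp that R by auto
      qed
      then show "\<omega> \<in> (\<Inter>l\<in>R. (\<lambda>\<omega>. \<lambda>k\<in>K. Y l k \<omega>) -` ?D l \<inter> space M)"
        using sp by (auto simp: PiE_iff)
    next
      fix \<omega> assume w: "\<omega> \<in> (\<Inter>l\<in>R. (\<lambda>\<omega>. \<lambda>k\<in>K. Y l k \<omega>) -` ?D l \<inter> space M)"
      show "\<omega> \<in> (\<Inter>p\<in>P. A p)"
      proof
        fix p assume p: "p \<in> P"
        then have "fst p \<in> R" "snd p \<in> K" using P by (auto simp: R_def)
        then have "\<omega> \<in> space M" "Y (fst p) (snd p) \<omega> \<in> C p"
          using w R(2) by (auto simp: PiE_iff Pi_iff dest!: bspec[of R _ "fst p"] split: if_splits)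
        then show "\<omega> \<in> A p" using B(1)[OF p] p by (simp add: C_def)
      qed
    qed
    then have "prob (\<Inter>p\<in>P. A p) = prob (\<Inter>l\<in>R. (\<lambda>\<omega>. \<lambda>k\<in>K. Y l k \<omega>) -` ?D l \<inter> space M)"
      by simp
    also have "\<dots> = (\<Prod>l\<in>R. prob ((\<lambda>\<omega>. \<lambda>k\<in>K. Y l k \<omega>) -` ?D l \<inter> space M))"
      using R K by (intro indep_varsD[OF rows]) (auto intro!: sets_PiM_I_finite)
    also have "\<dots> = (\<Prod>l\<in>R. \<Prod>k\<in>K. prob (Y l k -` C (l, k) \<inter> space M))"
    proof (rule prod.cong)
      fix l assume "l \<in> R"
      then show "prob ((\<lambda>\<omega>. \<lambda>k\<in>K. Y l k \<omega>) -` ?D l \<inter> space M) = (\<Prod>k\<in>K. prob (Y l k -` C (l, k) \<inter> space M))"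
        unfolding row using R K K0 by (intro indep_varsD_finite[OF comps]) auto
    qed simp
    also have "\<dots> = (\<Prod>p\<in>R \<times> K. prob (Y (fst p) (snd p) -` C p \<inter> space M))"
      by (simp add: prod.cartesian_product split_beta)
    also have "\<dots> = (\<Prod>p\<in>P. prob (Y (fst p) (snd p) -` C p \<inter> space M))"
    proof (rule prod.mono_neutral_right)
      show "P \<subseteq> R \<times> K" using P by (force simp: R_def)
      show "\<forall>p\<in>R \<times> K - P. prob (Y (fst p) (snd p) -` C p \<inter> space M) = 1"
        using outside R by (auto simp: prob_space subset_eq)
    qed (use R K in auto)
    also have "\<dots> = (\<Prod>p\<in>P. prob (A p))"
      by (intro prod.cong) (auto simp: B C_def)
    finally show "prob (\<Inter>p\<in>P. A p) = (\<Prod>p\<in>P. prob (A p))" .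
  qed
qed

text \<open>Grouped by columns, the entries give independent vectors, and the winner in coordinate k
  is a function of column k alone. Hence the product over k of the single-race
  probabilities.\<close>

lemma prob_first_argmax_pattern:
  fixes Y :: "nat \<Rightarrow> 'k \<Rightarrow> 'a \<Rightarrow> real"
  assumes K: "finite K" "K \<noteq> {}"
    and rows: "indep_vars (\<lambda>_. \<Pi>\<^sub>M k\<in>K. borel) (\<lambda>l \<omega>. \<lambda>k\<in>K. Y l k \<omega>) UNIV"
    and comps: "\<And>l. indep_vars (\<lambda>_. borel) (Y l) K"
    and Y: "\<And>l k. k \<in> K \<Longrightarrow> frechet1 M (\<sigma> k) (Y l k)" and \<sigma>: "\<And>k. k \<in> K \<Longrightarrow> 0 < \<sigma> k"
    and x: "\<And>l. 0 < x l" and sx: "summable x"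
  shows "prob {\<omega>\<in>space M. \<forall>k\<in>K. first_argmax (\<lambda>l. x l * Y l k \<omega>) = s k} =
    (\<Prod>k\<in>K. x (s k) / suminf x)"
proof -
  let ?C = "\<lambda>k. UNIV \<times> {k}"
  have "indep_vars (\<lambda>_. borel) (\<lambda>(l, k). Y l k) (UNIV \<times> K)"
    using indep_vars_rows_imp_entries[OF K(1) rows comps] by (simp add: split_beta')
  from indep_vars_restrict[OF this, of K ?C]
  have cols: "indep_vars (\<lambda>k. \<Pi>\<^sub>M p\<in>?C k. borel) (\<lambda>k \<omega>. \<lambda>p\<in>?C k. (case p of (l, k) \<Rightarrow> Y l k) \<omega>) K"
    by (auto simp: disjoint_family_on_def)
  have "indep_vars (\<lambda>_. count_space UNIV)
      (\<lambda>k \<omega>. first_argmax (\<lambda>l. x l * (\<lambda>p\<in>?C k. (case p of (l, k) \<Rightarrow> Y l k) \<omega>) (l, k))) K"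
    by (rule indep_vars_compose2[OF cols, of "\<lambda>k c. first_argmax (\<lambda>l. x l * c (l, k))"])
       (intro first_argmax_measurable borel_measurable_times measurable_const measurable_component_singleton; simp)
  then have ind: "indep_vars (\<lambda>_. count_space UNIV) (\<lambda>k \<omega>. first_argmax (\<lambda>l. x l * Y l k \<omega>)) K"
    by simp
  have "{\<omega>\<in>space M. \<forall>k\<in>K. first_argmax (\<lambda>l. x l * Y l k \<omega>) = s k} =
      (\<Inter>k\<in>K. (\<lambda>\<omega>. first_argmax (\<lambda>l. x l * Y l k \<omega>)) -` {s k} \<inter> space M)"
    using K by auto
  also have "prob \<dots> = (\<Prod>k\<in>K. prob ((\<lambda>\<omega>. first_argmax (\<lambda>l. x l * Y l k \<omega>)) -` {s k} \<inter> space M))"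
    using K by (intro indep_varsD_finite[OF ind]) auto
  also have "\<dots> = (\<Prod>k\<in>K. x (s k) / suminf x)"
  proof (rule prod.cong)
    fix k assume k: "k \<in> K"
    have "indep_vars (\<lambda>_. borel) (\<lambda>l \<omega>. (\<lambda>k\<in>K. Y l k \<omega>) k) UNIV"
      by (rule indep_vars_compose2[OF rows, of "\<lambda>_ r. r k"]) (use k in simp)
    then have "indep_vars (\<lambda>_. borel) (\<lambda>l. Y l k) UNIV" using k by simp
    from prob_first_argmax[OF this Y[OF k] \<sigma>[OF k] x sx, of "s k"]
    show "prob ((\<lambda>\<omega>. first_argmax (\<lambda>l. x l * Y l k \<omega>)) -` {s k} \<inter> space M) = x (s k) / suminf x"
      by (simp add: vimage_def Int_def conj_commute)
  qed simp
  finally show ?thesis .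
qed

lemma hitting_index_eq: "hitting_index J Y k \<omega> = first_argmax (\<lambda>l. J l \<omega> * Y l k \<omega>)"
  by (simp add: hitting_index_def first_argmax_def)

text \<open>Independence of points and marks allows freezing the points: for almost every \<omega>
  the inner probability is that of a pattern with the deterministic summable weights
  \<open>J l \<omega>\<close>.\<close>

lemma emeasure_hitting_pattern:
  fixes Y :: "nat \<Rightarrow> nat \<Rightarrow> 'a \<Rightarrow> real"
  assumes K: "finite K" "K \<noteq> {}"
    and rows: "indep_vars (\<lambda>_. \<Pi>\<^sub>M k\<in>K. borel) (\<lambda>l \<omega>. \<lambda>k\<in>K. Y l k \<omega>) UNIV"
    and comps: "\<And>l. indep_vars (\<lambda>_. borel) (Y l) K"
    and Y: "\<And>l k. k \<in> K \<Longrightarrow> frechet1 M (\<sigma> k) (Y l k)" and \<sigma>: "\<And>k. k \<in> K \<Longrightarrow> 0 < \<sigma> k"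
    and sets: "sets \<nu> = sets (restrict_space borel {0<..})"
    and ind: "indep_rvs M (\<Pi>\<^sub>M l\<in>UNIV. \<nu>) (\<lambda>\<omega> l. J l \<omega>)
           (\<Pi>\<^sub>M l\<in>UNIV. \<Pi>\<^sub>M k\<in>K. borel) (\<lambda>\<omega> l. \<lambda>k\<in>K. Y l k \<omega>)"
    and sJ: "AE \<omega> in M. summable (\<lambda>l. J l \<omega>)"
  shows "emeasure M {\<omega>\<in>space M. \<forall>k\<in>K. hitting_index J Y k \<omega> = s k} =
    (\<integral>\<^sup>+\<omega>. ennreal (\<Prod>k\<in>K. J (s k) \<omega> / (\<Sum>l. J l \<omega>)) \<partial>M)"
proof -
  let ?N = "\<Pi>\<^sub>M l\<in>(UNIV::nat set). \<nu>" and ?N' = "\<Pi>\<^sub>M l\<in>(UNIV::nat set). \<Pi>\<^sub>M k\<in>K. (borel :: real measure)"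
  let ?X = "\<lambda>\<omega> l. J l \<omega>" and ?X' = "\<lambda>\<omega> l. \<lambda>k\<in>K. Y l k \<omega>"
  have X [measurable]: "?X \<in> measurable M ?N" "?X' \<in> measurable M ?N'"
    and iset: "indep_set (sets (vimage_algebra (space M) ?X ?N)) (sets (vimage_algebra (space M) ?X' ?N'))"
    using ind by (auto simp: indep_rvs_def)
  have sp: "space \<nu> = {0<..}" using sets_eq_imp_space_eq[OF sets] by (simp add: space_restrict_space)
  have pos: "0 < J l \<omega>" if "\<omega> \<in> space M" for l \<omega>
    using measurable_space[OF X(1) that] by (auto simp: space_PiM sp)
  have id: "(\<lambda>w. w) \<in> measurable \<nu> borel" by (rule borel_measurable_on_positive[OF sets]) simp
  define Q where "Q = {p \<in> space (?N \<Otimes>\<^sub>M ?N'). \<forall>k\<in>K. first_argmax (\<lambda>l. fst p l * snd p l k) = s k}"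
  have Q: "Q \<in> sets (?N \<Otimes>\<^sub>M ?N')"
  proof -
    have 1: "(\<lambda>p. fst p l) \<in> borel_measurable (?N \<Otimes>\<^sub>M ?N')" for l
      by (rule measurable_compose[OF _ id]) measurable
    have 2: "(\<lambda>p. snd p l k) \<in> borel_measurable (?N \<Otimes>\<^sub>M ?N')" if "k \<in> K" for l k
    proof -
      have "(\<lambda>p. snd p l) \<in> measurable (?N \<Otimes>\<^sub>M ?N') (\<Pi>\<^sub>M k\<in>K. borel)" by measurable
      then show ?thesis by (rule measurable_compose[OF _ measurable_component_singleton[OF that]])
    qed
    have "(\<lambda>p. first_argmax (\<lambda>l. fst p l * snd p l k)) \<in> measurable (?N \<Otimes>\<^sub>M ?N') (count_space UNIV)" if "k \<in> K" for k
      by (intro first_argmax_measurable borel_measurable_times 1 2 that)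
    then have "{p \<in> space (?N \<Otimes>\<^sub>M ?N'). first_argmax (\<lambda>l. fst p l * snd p l k) = s k} \<in> sets (?N \<Otimes>\<^sub>M ?N')" if "k \<in> K" for k
      using that by measurable
    then show ?thesis
      unfolding Q_def using K by (intro sets.sets_Collect_finite_All) auto
  qed
  have inQ: "(?X \<omega>, ?X' \<omega>') \<in> Q \<longleftrightarrow> (\<forall>k\<in>K. first_argmax (\<lambda>l. J l \<omega> * Y l k \<omega>') = s k)"
    if "\<omega> \<in> space M" "\<omega>' \<in> space M" for \<omega> \<omega>'
    using measurable_space[OF X(1) that(1)] measurable_space[OF X(2) that(2)]
    by (simp add: Q_def space_pair_measure)
  have "emeasure M {\<omega>\<in>space M. \<forall>k\<in>K. hitting_index J Y k \<omega> = s k} = emeasure M {\<omega>\<in>space M. (?X \<omega>, ?X' \<omega>) \<in> Q}"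
    using inQ by (auto intro!: arg_cong[where f="emeasure M"] simp: hitting_index_eq)
  also have "\<dots> = (\<integral>\<^sup>+\<omega>. emeasure M {\<omega>'\<in>space M. (?X \<omega>, ?X' \<omega>') \<in> Q} \<partial>M)"
  proof (rule emeasure_independent_pair[OF X _ Q])
    fix A B assume "A \<in> sets ?N" "B \<in> sets ?N'"
    then show "prob ((?X -` A \<inter> space M) \<inter> (?X' -` B \<inter> space M)) = prob (?X -` A \<inter> space M) * prob (?X' -` B \<inter> space M)"
      by (intro indep_setD[OF iset] in_vimage_algebra)
  qed
  also have "\<dots> = (\<integral>\<^sup>+\<omega>. ennreal (\<Prod>k\<in>K. J (s k) \<omega> / (\<Sum>l. J l \<omega>)) \<partial>M)"
  proof (rule nn_integral_cong_AE, rule AE_mp[OF sJ], intro AE_I2 impI)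
    fix \<omega> assume w: "\<omega> \<in> space M" and su: "summable (\<lambda>l. J l \<omega>)"
    have "{\<omega>'\<in>space M. (?X \<omega>, ?X' \<omega>') \<in> Q} = {\<omega>'\<in>space M. \<forall>k\<in>K. first_argmax (\<lambda>l. J l \<omega> * Y l k \<omega>') = s k}"
      using inQ[OF w] by auto
    then show "emeasure M {\<omega>'\<in>space M. (?X \<omega>, ?X' \<omega>') \<in> Q} = ennreal (\<Prod>k\<in>K. J (s k) \<omega> / (\<Sum>l. J l \<omega>))"
      using prob_first_argmax_pattern[OF K rows comps Y \<sigma> pos[OF w] su, of s]
      by (simp add: emeasure_eq_measure)
  qed
  finally show ?thesis .
qed

end

subsection \<open>The law of the hitting partition\<close>

text \<open>Constancy of \<open>h\<close> on the blocks says that no block of P is split;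
  injectivity of s says that no two blocks are joined.\<close>

lemma quotient_eq_partition_iff:
  fixes h :: "'k \<Rightarrow> nat"
  assumes P: "partition_on A P"
  shows "A // {(i, j). i \<in> A \<and> j \<in> A \<and> h i = h j} = P \<longleftrightarrow>
    (\<exists>s\<in>inj_maps P. \<forall>B\<in>P. \<forall>k\<in>B. h k = s B)"
proof
  let ?r = "{(i, j). i \<in> A \<and> j \<in> A \<and> h i = h j}"
  have cls: "?r `` {i} = {j\<in>A. h j = h i}" if "i \<in> A" for i using that by auto
  note PU = partition_onD1[OF P] and Pd = partition_onD2[OF P] and Pn = partition_onD3[OF P]
  {
    assume q: "A // ?r = P"
    \<comment> \<open>The value at an arbitrary representative; \<open>sB\<close> shows that the
      choice is immaterial.\<close>
    define s where "s = (\<lambda>B\<in>P. h (SOME k. k \<in> B))"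
    have B: "\<exists>i\<in>A. B = {j\<in>A. h j = h i}" if "B \<in> P" for B
      using that cls unfolding q[symmetric] quotient_def by blast
    have sB: "h k = s B" if "B \<in> P" "k \<in> B" for k B
    proof -
      obtain i where i: "B = {j\<in>A. h j = h i}" using B[OF \<open>B \<in> P\<close>] by blast
      have "(SOME k. k \<in> B) \<in> B" using that(2) by (rule someI)
      then have "h (SOME k. k \<in> B) = h i" "h k = h i" using that(2) i by blast+
      then show ?thesis using that(1) by (simp add: s_def)
    qed
    have "B = B'" if BB: "B \<in> P" "B' \<in> P" "s B = s B'" for B B'
    proof -
      obtain i where i: "i \<in> A" "B = {j\<in>A. h j = h i}" using B[OF BB(1)] by auto
      obtain i' where i': "i' \<in> A" "B' = {j\<in>A. h j = h i'}" using B[OF BB(2)] by auto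
      have "i \<in> B" "i' \<in> B'" using i i' by simp_all
      then have "h i = h i'" using sB[OF BB(1)] sB[OF BB(2)] BB(3) by metis
      then show ?thesis by (simp only: i(2) i'(2))
    qed
    then have "s \<in> inj_maps P" by (auto simp: inj_maps_def inj_on_def s_def)
    then show "\<exists>s\<in>inj_maps P. \<forall>B\<in>P. \<forall>k\<in>B. h k = s B" using sB by blast
  }
  {
    assume "\<exists>s\<in>inj_maps P. \<forall>B\<in>P. \<forall>k\<in>B. h k = s B"
    then obtain s where s: "inj_on s P" and sB: "\<And>B k. B \<in> P \<Longrightarrow> k \<in> B \<Longrightarrow> h k = s B"
      by (auto simp: inj_maps_def)
    have class_eq: "?r `` {i} = B" if "B \<in> P" "i \<in> B" for B i
    proof -
      have iA: "i \<in> A" using that PU by auto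
      have "j \<in> B" if j: "j \<in> A" "h j = h i" for j
      proof -
        obtain B' where B': "B' \<in> P" "j \<in> B'" using j PU by auto
        then have "s B' = s B" using sB[of B' j] sB[OF \<open>B \<in> P\<close> \<open>i \<in> B\<close>] j by simp
        then show ?thesis using s B' \<open>B \<in> P\<close> by (auto dest: inj_onD)
      qed
      moreover have "B \<subseteq> A" using that PU by auto
      moreover have "h j = h i" if "j \<in> B" for j
        using sB[OF \<open>B \<in> P\<close>] that \<open>i \<in> B\<close> by metis
      ultimately have "{j\<in>A. h j = h i} = B" by blast
      then show ?thesis by (simp only: cls[OF iA])
    qed
    show "A // ?r = P"
    proof (rule antisym; rule subsetI)
      fix C assume "C \<in> A // ?r"
      then obtain i where i: "i \<in> A" "C = ?r `` {i}" by (auto simp: quotient_def)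
      then obtain B where "B \<in> P" "i \<in> B" using PU by auto
      then show "C \<in> P" by (simp only: i(2) class_eq)
    next
      fix B assume "B \<in> P"
      then obtain i where "i \<in> B" using Pn by (metis ex_in_conv)
      moreover from this have "i \<in> A" using \<open>B \<in> P\<close> PU by blast
      ultimately show "B \<in> A // ?r"
        using quotientI[of i A ?r] by (simp only: class_eq[OF \<open>B \<in> P\<close>])
    qed
  }
qed

text \<open>Blocks are nonempty, so \<open>h\<close> determines the map on blocks. This makes the
  events for different maps disjoint.\<close>

lemma inj_maps_eq_on_partition:
  assumes "partition_on A P" "s \<in> inj_maps P" "s' \<in> inj_maps P"
    and "\<And>B k. B \<in> P \<Longrightarrow> k \<in> B \<Longrightarrow> h k = s B" "\<And>B k. B \<in> P \<Longrightarrow> k \<in> B \<Longrightarrow> h k = s' B"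
  shows "s = s'"
proof (rule PiE_ext)
  show "s \<in> P \<rightarrow>\<^sub>E UNIV" "s' \<in> P \<rightarrow>\<^sub>E UNIV" using assms by (auto simp: inj_maps_def)
  fix B assume B: "B \<in> P"
  then obtain k where "k \<in> B" using partition_onD3[OF assms(1)] by (metis ex_in_conv)
  then show "s B = s' B" using assms(4,5)[OF B] by metis
qed

lemma partition_on_hitting_partition: "partition_on {1..n} (hitting_partition n J Y \<omega>)"
  unfolding hitting_partition_def
  by (rule partition_on_quotient) (auto simp: equiv_def refl_on_def sym_def trans_def)

lemma hitting_partition_eq_iff:
  assumes "partition_on {1..n} P"
  shows "hitting_partition n J Y \<omega> = P \<longleftrightarrow>
    (\<exists>s\<in>inj_maps P. \<forall>B\<in>P. \<forall>k\<in>B. hitting_index J Y k \<omega> = s B)"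
  unfolding hitting_partition_def by (rule quotient_eq_partition_iff[OF assms])

section \<open>The partition probability as an integral over t\<close>

lemma ennreal_inverse_power_eq_integral:
  assumes S: "0 < S" and n: "1 \<le> n"
  shows "ennreal (1 / S ^ n) =
    (\<integral>\<^sup>+t. ennreal (t ^ (n - 1) / fact (n - 1) * exp (- (S * t))) * indicator {0<..} t \<partial>lborel)"
proof -
  have "(\<integral>\<^sup>+t. ennreal (t ^ (n - 1) / fact (n - 1) * exp (- (S * t))) * indicator {0<..} t \<partial>lborel) =
      (\<integral>\<^sup>+t. ennreal (1 / fact (n - 1)) * (ennreal (t ^ (n - 1) * exp (- (S * t))) * indicator {0<..} t) \<partial>lborel)"
    by (intro nn_integral_cong) (auto simp: indicator_def simp flip: ennreal_mult)
  also have "\<dots> = ennreal (1 / fact (n - 1)) * ennreal (fact (n - 1) / S ^ n)"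
    using nn_integral_gamma_nat[OF n S] by (subst nn_integral_cmult) auto
  finally show ?thesis using S by (simp flip: ennreal_mult)
qed

context prob_space
begin

lemma hitting_partition_measurable:
  assumes J: "\<And>l. J l \<in> borel_measurable M" and Y: "\<And>l k. k \<in> {1..n} \<Longrightarrow> Y l k \<in> borel_measurable M"
  shows "hitting_partition n J Y \<in> measurable M (count_space {P. partition_on {1..n} P})"
proof -
  have h [measurable]: "hitting_index J Y k \<in> measurable M (count_space UNIV)" if "k \<in> {1..n}" for k
    unfolding hitting_index_eq using Y[OF that] J by measurable
  have "finite {P. partition_on {1..n} P}"
    by (rule finite_subset[of _ "Pow (Pow {1..n})"]) (auto dest: partition_onD1)
  moreover have "hitting_partition n J Y -` {P} \<inter> space M \<in> sets M" if P: "partition_on {1..n} P" for P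
  proof -
    have "finite P" using P by (rule finite_elements[rotated]) simp
    have fB: "finite B" "B \<subseteq> {1..n}" if "B \<in> P" for B
    proof -
      show "B \<subseteq> {1..n}" using partition_onD1[OF P] that by auto
      then show "finite B" by (rule finite_subset) simp
    qed
    have "hitting_partition n J Y -` {P} \<inter> space M = {\<omega>\<in>space M. hitting_partition n J Y \<omega> = P}"
      by auto
    also have "\<dots> = (\<Union>s\<in>inj_maps P. {\<omega>\<in>space M. \<forall>B\<in>P. \<forall>k\<in>B. hitting_index J Y k \<omega> = s B})"
      unfolding hitting_partition_eq_iff[OF P] by auto
    also have "\<dots> \<in> sets M"
    proof (intro sets.countable_UN'' countable_inj_maps)
      show "{\<omega> \<in> space M. \<forall>B\<in>P. \<forall>k\<in>B. hitting_index J Y k \<omega> = s B} \<in> sets M" for s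
      proof (rule sets.sets_Collect_finite_All, rule sets.sets_Collect_finite_All)
        fix B k assume "B \<in> P" "k \<in> B"
        then have [measurable]: "hitting_index J Y k \<in> measurable M (count_space UNIV)" using fB h by blast
        show "{\<omega> \<in> space M. hitting_index J Y k \<omega> = s B} \<in> sets M" by measurable
      qed (use \<open>finite P\<close> fB in auto)
    qed (use \<open>finite P\<close> in auto)
    finally show ?thesis .
  qed
  ultimately show ?thesis
    by (subst measurable_count_space_eq2) (auto simp: partition_on_hitting_partition simp del: One_nat_def)
qed

end

text \<open>With T the total of the points, exp (- t T) vanishes where T is infinite, so that event
  has probability at most 1 - exp (- \<psi> t) for every t > 0. This bound tends to 0 with
  t.\<close>

lemma AE_summable_points:
  fixes J :: "nat \<Rightarrow> 'a \<Rightarrow> real"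
  assumes "poisson_points M \<nu> J" and sf: "sigma_finite_measure \<nu>"
    and sets: "sets \<nu> = sets (restrict_space borel {0<..})"
    and \<psi>: "\<And>t. 0 < t \<Longrightarrow> (\<integral>\<^sup>+w. ennreal (1 - exp (- (t * w))) \<partial>\<nu>) = ennreal (\<psi> t)"
    and \<psi>_nonneg: "\<And>t. 0 < t \<Longrightarrow> 0 \<le> \<psi> t"
    and \<psi>_lim: "(\<psi> \<longlongrightarrow> 0) (at_right 0)"
  shows "AE \<omega> in M. summable (\<lambda>l. J l \<omega>)"
proof -
  interpret poisson_points M \<nu> J by fact
  have sp: "space \<nu> = {0<..}" using sets_eq_imp_space_eq[OF sets] by (simp add: space_restrict_space)
  have pos: "0 < J l \<omega>" if "\<omega> \<in> space M" for l \<omega>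
    using measurable_space[OF points_measurable that] by (simp add: sp)
  note meas = borel_measurable_on_positive[OF sets]
  define T where "T = point_sum J ennreal"
  have [measurable]: "T \<in> borel_measurable M"
    unfolding T_def by (rule point_sum_measurable[OF points_measurable meas]) simp
  let ?A = "{\<omega>\<in>space M. T \<omega> = \<top>}"
  have "prob ?A \<le> 1 - exp (- \<psi> t)" if t: "0 < t" for t
  proof -
    have "ennreal (exp (- \<psi> t)) = exp_neg (\<integral>\<^sup>+w. ennreal (1 - exp (- (t * w))) \<partial>\<nu>)"
      using t by (simp add: \<psi> \<psi>_nonneg exp_neg_ennreal)
    also have "\<dots> = exp_neg (\<integral>\<^sup>+w. 1 - exp_neg (ennreal t * ennreal w) \<partial>\<nu>)"
      using t by (intro arg_cong[where f=exp_neg] nn_integral_cong)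
        (simp add: sp exp_neg_ennreal ennreal_minus flip: ennreal_1 ennreal_mult)
    also have "\<dots> = (\<integral>\<^sup>+\<omega>. exp_neg (point_sum J (\<lambda>w. ennreal t * ennreal w) \<omega>) \<partial>M)"
      by (rule laplace_functional[OF sf, symmetric]) (rule meas, simp)
    also have "\<dots> = (\<integral>\<^sup>+\<omega>. exp_neg (ennreal t * T \<omega>) \<partial>M)"
      by (simp add: point_sum_cmult T_def)
    also have "\<dots> \<le> (\<integral>\<^sup>+\<omega>. indicator (space M - ?A) \<omega> \<partial>M)"
      using t by (intro nn_integral_mono) (auto simp: indicator_def exp_neg_le_1 ennreal_mult_top)
    also have "\<dots> = ennreal (1 - prob ?A)"
      by (subst nn_integral_indicator) (auto simp: emeasure_eq_measure prob_compl)
    finally show ?thesis by simp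
  qed
  moreover have "((\<lambda>t. 1 - exp (- \<psi> t)) \<longlongrightarrow> 1 - exp (- 0)) (at_right 0)"
    by (intro tendsto_intros \<psi>_lim)
  ultimately have "prob ?A \<le> 1 - exp (- 0)"
    by (intro tendsto_lowerbound) (auto simp: eventually_at_right_less eventually_at_filter)
  then have "prob ?A = 0" by (simp add: measure_le_0_iff)
  then have "AE \<omega> in M. T \<omega> \<noteq> \<top>" by (subst (asm) prob_eq_0) auto
  then show ?thesis
  proof (rule AE_mp, intro AE_I2 impI)
    fix \<omega> assume "\<omega> \<in> space M" "T \<omega> \<noteq> \<top>"
    then show "summable (\<lambda>l. J l \<omega>)"
      using pos[of \<omega>] by (intro summable_suminf_not_top) (auto simp: T_def point_sum_def less_imp_le)
  qed
qed

text \<open>The Mecke formula for the family of monomials of positive degree, with the linear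
  exponent t w. Degree 0 is left out because the measures of interest are infinite near 0, where the
  exponential gives no help; positive degrees are closed under products.\<close>

lemma distinct_sum_power_laplace:
  fixes J :: "nat \<Rightarrow> 'a \<Rightarrow> real" and m :: "'i \<Rightarrow> nat"
  assumes "poisson_points M \<nu> J" and sf: "sigma_finite_measure \<nu>"
    and sets: "sets \<nu> = sets (restrict_space borel {0<..})"
    and \<kappa>: "\<And>m t. 1 \<le> m \<Longrightarrow> 0 < t \<Longrightarrow> (\<integral>\<^sup>+w. ennreal (w ^ m * exp (- (t * w))) \<partial>\<nu>) = ennreal (\<kappa> m t)"
    and \<kappa>_nonneg: "\<And>m t. 1 \<le> m \<Longrightarrow> 0 < t \<Longrightarrow> 0 \<le> \<kappa> m t"
    and \<psi>: "\<And>t. 0 < t \<Longrightarrow> (\<integral>\<^sup>+w. ennreal (1 - exp (- (t * w))) \<partial>\<nu>) = ennreal (\<psi> t)"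
    and \<psi>_nonneg: "\<And>t. 0 < t \<Longrightarrow> 0 \<le> \<psi> t"
    and I: "finite I" "\<And>i. i \<in> I \<Longrightarrow> 1 \<le> m i" and t: "0 < t"
  shows "(\<integral>\<^sup>+\<omega>. distinct_sum I (\<lambda>i w. ennreal (w ^ m i)) (\<lambda>l. J l \<omega>) *
      exp_neg (point_sum J (\<lambda>w. ennreal (t * w)) \<omega>) \<partial>M) =
    ennreal ((\<Prod>i\<in>I. \<kappa> (m i) t) * exp (- \<psi> t))"
proof -
  interpret poisson_points M \<nu> J by fact
  have sp: "space \<nu> = {0<..}" using sets_eq_imp_space_eq[OF sets] by (simp add: space_restrict_space)
  note meas = borel_measurable_on_positive[OF sets]
  have kint: "has_bochner_integral \<nu> (\<lambda>w. w ^ k * exp (- (t * w))) (\<kappa> k t)" if "1 \<le> k" for k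
    using t that by (intro has_bochner_integral_nn_integral meas \<kappa> \<kappa>_nonneg) (auto simp: sp intro!: AE_I2)
  have pint: "has_bochner_integral \<nu> (\<lambda>w. 1 - exp (- (t * w))) (\<psi> t)"
    using t by (intro has_bochner_integral_nn_integral meas \<psi> \<psi>_nonneg) (auto simp: sp intro!: AE_I2)
  have "(\<integral>\<^sup>+\<omega>. distinct_sum I (\<lambda>i w. ennreal (w ^ m i)) (\<lambda>l. J l \<omega>) *
      exp_neg (point_sum J (\<lambda>w. ennreal (t * w)) \<omega>) \<partial>M) =
    ennreal ((\<Prod>i\<in>I. \<integral>w. w ^ m i * exp (- (t * w)) \<partial>\<nu>) * exp (- (\<integral>w. 1 - exp (- (t * w)) \<partial>\<nu>)))"
  proof (rule distinct_sum_laplace[OF sf, where F="{\<lambda>w. w ^ k | k. 1 \<le> k}" and g\<^sub>0="\<lambda>w. t * w"])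
    fix f :: "real \<Rightarrow> real" assume "f \<in> {\<lambda>w. w ^ k | k. 1 \<le> k}"
    then obtain k :: nat where k: "1 \<le> k" "f = (\<lambda>w. w ^ k)" by auto
    show "f \<in> borel_measurable \<nu>" unfolding k(2) by (rule meas) simp
    show "0 \<le> f w" if "w \<in> space \<nu>" for w using that by (simp add: k(2) sp)
    show "integrable \<nu> (\<lambda>w. f w * exp (- (t * w)))"
      unfolding k(2) using kint[OF k(1)] by (rule integrable.intros)
    fix f' :: "real \<Rightarrow> real" assume "f' \<in> {\<lambda>w. w ^ k | k. 1 \<le> k}"
    then obtain k' :: nat where k': "1 \<le> k'" "f' = (\<lambda>w. w ^ k')" by auto
    show "(\<lambda>w. f w * f' w) \<in> {\<lambda>w. w ^ k | k. 1 \<le> k}"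
      unfolding k(2) k'(2) using k(1) by (auto intro!: exI[of _ "k + k'"] simp: power_add)
  next
    show "(\<lambda>w. t * w) \<in> borel_measurable \<nu>" by (rule meas) simp
    show "integrable \<nu> (\<lambda>w. 1 - exp (- (t * w)))" using pint by (rule integrable.intros)
    show "0 \<le> t * w" if "w \<in> space \<nu>" for w using that t by (simp add: sp)
  qed (use I in auto)
  moreover have "(\<Prod>i\<in>I. \<integral>w. w ^ m i * exp (- (t * w)) \<partial>\<nu>) = (\<Prod>i\<in>I. \<kappa> (m i) t)"
    using I(2) kint by (intro prod.cong refl has_bochner_integral_integral_eq) auto
  ultimately show ?thesis using pint by (simp add: has_bochner_integral_integral_eq)
qed

theorem emeasure_hitting_partition:
  fixes J :: "nat \<Rightarrow> 'a \<Rightarrow> real" and Y :: "nat \<Rightarrow> nat \<Rightarrow> 'a \<Rightarrow> real"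
  assumes pp: "poisson_points M \<nu> J" and sf: "sigma_finite_measure \<nu>"
    and sets: "sets \<nu> = sets (restrict_space borel {0<..})"
    and n: "1 \<le> n" and \<sigma>: "\<And>k. k \<in> {1..n} \<Longrightarrow> 0 < \<sigma> k"
    and rows: "prob_space.indep_vars M (\<lambda>_. \<Pi>\<^sub>M k\<in>{1..n}. borel) (\<lambda>l \<omega>. \<lambda>k\<in>{1..n}. Y l k \<omega>) UNIV"
    and ind: "indep_rvs M (\<Pi>\<^sub>M l\<in>UNIV. \<nu>) (\<lambda>\<omega> l. J l \<omega>)
           (\<Pi>\<^sub>M l\<in>UNIV. \<Pi>\<^sub>M k\<in>{1..n}. borel) (\<lambda>\<omega> l. \<lambda>k\<in>{1..n}. Y l k \<omega>)"
    and comps: "\<And>l. prob_space.indep_vars M (\<lambda>_. borel) (Y l) {1..n}"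
    and Y: "\<And>l k. k \<in> {1..n} \<Longrightarrow> frechet1 M (\<sigma> k) (Y l k)"
    and \<kappa>: "\<And>m t. 1 \<le> m \<Longrightarrow> 0 < t \<Longrightarrow> (\<integral>\<^sup>+w. ennreal (w ^ m * exp (- (t * w))) \<partial>\<nu>) = ennreal (\<kappa> m t)"
    and \<kappa>_nonneg: "\<And>m t. 1 \<le> m \<Longrightarrow> 0 < t \<Longrightarrow> 0 \<le> \<kappa> m t"
    and \<psi>: "\<And>t. 0 < t \<Longrightarrow> (\<integral>\<^sup>+w. ennreal (1 - exp (- (t * w))) \<partial>\<nu>) = ennreal (\<psi> t)"
    and \<psi>_nonneg: "\<And>t. 0 < t \<Longrightarrow> 0 \<le> \<psi> t"
    and \<psi>_lim: "(\<psi> \<longlongrightarrow> 0) (at_right 0)"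
    and P: "partition_on {1..n} P"
  shows "emeasure M {\<omega>\<in>space M. hitting_partition n J Y \<omega> = P} =
    (\<integral>\<^sup>+t. ennreal (t ^ (n - 1) / fact (n - 1) * (\<Prod>B\<in>P. \<kappa> (card B) t) * exp (- \<psi> t)) *
      indicator {0<..} t \<partial>lborel)"
proof -
  interpret poisson_points M \<nu> J by fact
  have sp: "space \<nu> = {0<..}" using sets_eq_imp_space_eq[OF sets] by (simp add: space_restrict_space)
  have pos: "0 < J l \<omega>" if "\<omega> \<in> space M" for l \<omega>
    using measurable_space[OF points_measurable that] by (simp add: sp)
  have id: "(\<lambda>w. w) \<in> measurable \<nu> borel" by (rule borel_measurable_on_positive[OF sets]) simp
  have Jm [measurable]: "J l \<in> borel_measurable M" for l
    using measurable_compose[OF points_measurable id] by simp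
  have Ym [measurable]: "Y l k \<in> borel_measurable M" if "k \<in> {1..n}" for l k
    using Y[OF that] by (simp add: frechet1_def)
  have sJ: "AE \<omega> in M. summable (\<lambda>l. J l \<omega>)"
    by (rule AE_summable_points[OF pp sf sets \<psi> \<psi>_nonneg \<psi>_lim])
  have finP: "finite P" using P by (rule finite_elements[rotated]) simp
  have B: "finite B" "B \<subseteq> {1..n}" "1 \<le> card B" if "B \<in> P" for B
  proof -
    show "B \<subseteq> {1..n}" using partition_onD1[OF P] that by auto
    then show "finite B" by (rule finite_subset) simp
    moreover have "B \<noteq> {}" using partition_onD3[OF P] that by auto
    ultimately show "1 \<le> card B" by (simp add: Suc_le_eq card_gt_0_iff)
  qed
  \<comment> \<open>The block containing \<open>k\<close>: it turns a map s on blocks into the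
    coordinate pattern \<open>\<lambda>k. s (c k)\<close> that
    \<open>emeasure_hitting_pattern\<close> expects.\<close>
  define c where "c k = (THE B. B \<in> P \<and> k \<in> B)" for k
  have c: "c k = B" if "B \<in> P" "k \<in> B" for B k
    unfolding c_def using that partition_onD2[OF P]
    by (intro the_equality) (auto simp: disjoint_def)
  have U: "{1..n} = \<Union>P" by (rule partition_onD1[OF P])
  define S where "S \<omega> = (\<Sum>l. J l \<omega>)" for \<omega>
  have [measurable]: "S \<in> borel_measurable M" unfolding S_def by measurable
  define D where "D \<omega> = distinct_sum P (\<lambda>B w. ennreal (w ^ card B)) (\<lambda>l. J l \<omega>)" for \<omega>
  have [measurable]: "D \<in> borel_measurable M"
    unfolding D_def using finP by (intro distinct_sum_measurable[where N=borel]) auto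
  let ?E = "\<lambda>s. {\<omega>\<in>space M. \<forall>k\<in>{1..n}. hitting_index J Y k \<omega> = s (c k)}"
  have E_iff: "(\<forall>k\<in>{1..n}. hitting_index J Y k \<omega> = s (c k)) \<longleftrightarrow>
      (\<forall>B\<in>P. \<forall>k\<in>B. hitting_index J Y k \<omega> = s B)" for \<omega> s
    unfolding U using c by fastforce
  have h [measurable]: "hitting_index J Y k \<in> measurable M (count_space UNIV)" if "k \<in> {1..n}" for k
    unfolding hitting_index_eq using Ym[OF that] by measurable
  have Em: "?E s \<in> sets M" for s
  proof (rule sets.sets_Collect_finite_All)
    fix k assume "k \<in> {1..n}"
    note h[OF this, measurable]
    show "{\<omega>\<in>space M. hitting_index J Y k \<omega> = s (c k)} \<in> sets M" by measurable
  qed simp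
  have "{\<omega>\<in>space M. hitting_partition n J Y \<omega> = P} = (\<Union>s\<in>inj_maps P. ?E s)"
    unfolding E_iff hitting_partition_eq_iff[OF P] by auto
  then have "emeasure M {\<omega>\<in>space M. hitting_partition n J Y \<omega> = P} = emeasure M (\<Union>s\<in>inj_maps P. ?E s)"
    by simp
  \<comment> \<open>A countable disjoint union; its sum is kept as an integral so that it can be
    exchanged with the expectation.\<close>
  also have "\<dots> = (\<integral>\<^sup>+s. emeasure M (?E s) \<partial>count_space (inj_maps P))"
  proof (intro emeasure_UN_countable countable_inj_maps finP Em)
    show "disjoint_family_on ?E (inj_maps P)"
      unfolding disjoint_family_on_def
    proof (intro ballI impI equals0I)
      fix s s' \<omega> assume s: "s \<in> inj_maps P" "s' \<in> inj_maps P" "s \<noteq> s'" and w: "\<omega> \<in> ?E s \<inter> ?E s'"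
      have "s = s'"
        by (rule inj_maps_eq_on_partition[OF P s(1,2), of "\<lambda>k. hitting_index J Y k \<omega>"])
           (use w[unfolded E_iff] in blast)+
      with s(3) show False by simp
    qed
  qed
  also have "\<dots> = (\<integral>\<^sup>+s. (\<integral>\<^sup>+\<omega>. ennreal (\<Prod>k\<in>{1..n}. J (s (c k)) \<omega> / S \<omega>) \<partial>M) \<partial>count_space (inj_maps P))"
    unfolding S_def using n
    by (intro nn_integral_cong emeasure_hitting_pattern[OF _ _ rows comps Y \<sigma> sets ind sJ]) auto
  also have "\<dots> = (\<integral>\<^sup>+\<omega>. (\<integral>\<^sup>+s. ennreal (\<Prod>k\<in>{1..n}. J (s (c k)) \<omega> / S \<omega>) \<partial>count_space (inj_maps P)) \<partial>M)"
    by (rule nn_integral_count_space_nn_integral[symmetric]) (simp_all add: countable_inj_maps finP)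
  \<comment> \<open>Summing the numerators over the patterns gives \<open>D\<close>, and the common
    denominator is replaced by its Gamma integral. The identity is almost sure: without summability
    the real number \<open>S \<omega>\<close> is not the total of the points.\<close>
  also have "\<dots> = (\<integral>\<^sup>+\<omega>. (\<integral>\<^sup>+t. D \<omega> * (ennreal (t ^ (n - 1) / fact (n - 1) * exp (- (S \<omega> * t))) *
      indicator {0<..} t) \<partial>lborel) \<partial>M)"
  proof (rule nn_integral_cong_AE, rule AE_mp[OF sJ], intro AE_I2 impI)
    fix \<omega> assume w: "\<omega> \<in> space M" and su: "summable (\<lambda>l. J l \<omega>)"
    have S: "0 < S \<omega>" unfolding S_def using su pos[OF w] by (rule suminf_pos)
    have prod_eq: "(\<Prod>k\<in>{1..n}. J (s (c k)) \<omega> / S \<omega>) = (\<Prod>B\<in>P. J (s B) \<omega> ^ card B) * (1 / S \<omega> ^ n)" for s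
    proof -
      have "(\<Prod>k\<in>{1..n}. J (s (c k)) \<omega>) = (\<Prod>B\<in>P. \<Prod>k\<in>B. J (s (c k)) \<omega>)"
        unfolding U using B(1) partition_onD2[OF P]
        by (subst prod.Union_disjoint) (auto simp: disjoint_def)
      also have "\<dots> = (\<Prod>B\<in>P. J (s B) \<omega> ^ card B)"
        using c by (intro prod.cong) (auto simp: prod_constant)
      finally show ?thesis by (simp add: prod_dividef)
    qed
    have "(\<integral>\<^sup>+s. ennreal (\<Prod>k\<in>{1..n}. J (s (c k)) \<omega> / S \<omega>) \<partial>count_space (inj_maps P)) =
        (\<integral>\<^sup>+s. (\<Prod>B\<in>P. ennreal (J (s B) \<omega> ^ card B)) * ennreal (1 / S \<omega> ^ n) \<partial>count_space (inj_maps P))"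
    proof (rule nn_integral_cong)
      fix s
      show "ennreal (\<Prod>k\<in>{1..n}. J (s (c k)) \<omega> / S \<omega>) =
          (\<Prod>B\<in>P. ennreal (J (s B) \<omega> ^ card B)) * ennreal (1 / S \<omega> ^ n)"
        unfolding prod_eq using pos[OF w] S
        by (subst ennreal_mult) (simp_all add: prod_ennreal prod_nonneg less_imp_le)
    qed
    also have "\<dots> = D \<omega> * ennreal (1 / S \<omega> ^ n)"
      unfolding D_def distinct_sum_def by (rule nn_integral_multc) simp
    also have "\<dots> = (\<integral>\<^sup>+t. D \<omega> * (ennreal (t ^ (n - 1) / fact (n - 1) * exp (- (S \<omega> * t))) * indicator {0<..} t) \<partial>lborel)"
      unfolding ennreal_inverse_power_eq_integral[OF S n] by (rule nn_integral_cmult[symmetric]) measurable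
    finally show "(\<integral>\<^sup>+s. ennreal (\<Prod>k\<in>{1..n}. J (s (c k)) \<omega> / S \<omega>) \<partial>count_space (inj_maps P)) =
      (\<integral>\<^sup>+t. D \<omega> * (ennreal (t ^ (n - 1) / fact (n - 1) * exp (- (S \<omega> * t))) * indicator {0<..} t) \<partial>lborel)" .
  qed
  also have "\<dots> = (\<integral>\<^sup>+t. (\<integral>\<^sup>+\<omega>. D \<omega> * (ennreal (t ^ (n - 1) / fact (n - 1) * exp (- (S \<omega> * t))) *
      indicator {0<..} t) \<partial>M) \<partial>lborel)"
  proof -
    interpret pair_sigma_finite M lborel by standard
    show ?thesis by (rule Fubini'[symmetric]) measurable
  qed
  also have "\<dots> = (\<integral>\<^sup>+t. ennreal (t ^ (n - 1) / fact (n - 1) * (\<Prod>B\<in>P. \<kappa> (card B) t) * exp (- \<psi> t)) *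
      indicator {0<..} t \<partial>lborel)"
  proof (rule nn_integral_cong)
    fix t :: real
    show "(\<integral>\<^sup>+\<omega>. D \<omega> * (ennreal (t ^ (n - 1) / fact (n - 1) * exp (- (S \<omega> * t))) * indicator {0<..} t) \<partial>M) =
      ennreal (t ^ (n - 1) / fact (n - 1) * (\<Prod>B\<in>P. \<kappa> (card B) t) * exp (- \<psi> t)) * indicator {0<..} t"
    proof (cases "0 < t")
      case t: True
      have "(\<integral>\<^sup>+\<omega>. D \<omega> * (ennreal (t ^ (n - 1) / fact (n - 1) * exp (- (S \<omega> * t))) * indicator {0<..} t) \<partial>M) =
          (\<integral>\<^sup>+\<omega>. ennreal (t ^ (n - 1) / fact (n - 1)) * (D \<omega> * exp_neg (point_sum J (\<lambda>w. ennreal (t * w)) \<omega>)) \<partial>M)"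
      proof (rule nn_integral_cong_AE, rule AE_mp[OF sJ], intro AE_I2 impI)
        fix \<omega> assume w: "\<omega> \<in> space M" and su: "summable (\<lambda>l. J l \<omega>)"
        \<comment> \<open>Recognises the factor exp (- t S) as the weight of a Laplace
          functional.\<close>
        have "point_sum J (\<lambda>w. ennreal (t * w)) \<omega> = ennreal (\<Sum>l. t * J l \<omega>)"
          unfolding point_sum_def using t pos[OF w] su
          by (intro suminf_ennreal2) (auto simp: less_imp_le intro: summable_mult)
        also have "(\<Sum>l. t * J l \<omega>) = S \<omega> * t"
          using suminf_mult[OF su, of t] by (simp add: S_def mult.commute)
        finally have eq: "exp_neg (point_sum J (\<lambda>w. ennreal (t * w)) \<omega>) = ennreal (exp (- (S \<omega> * t)))"
          using t suminf_nonneg[OF su] pos[OF w] by (simp add: exp_neg_ennreal S_def less_imp_le)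
        have "ennreal (t ^ (n - 1) / fact (n - 1) * exp (- (S \<omega> * t))) =
            ennreal (t ^ (n - 1) / fact (n - 1)) * ennreal (exp (- (S \<omega> * t)))"
          using t by (intro ennreal_mult) auto
        then show "D \<omega> * (ennreal (t ^ (n - 1) / fact (n - 1) * exp (- (S \<omega> * t))) * indicator {0<..} t) =
            ennreal (t ^ (n - 1) / fact (n - 1)) * (D \<omega> * exp_neg (point_sum J (\<lambda>w. ennreal (t * w)) \<omega>))"
          unfolding eq using t by (simp add: mult_ac)
      qed
      also have "\<dots> = ennreal (t ^ (n - 1) / fact (n - 1)) *
          (\<integral>\<^sup>+\<omega>. D \<omega> * exp_neg (point_sum J (\<lambda>w. ennreal (t * w)) \<omega>) \<partial>M)"
      proof (rule nn_integral_cmult)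
        have [measurable]: "point_sum J (\<lambda>w. ennreal (t * w)) \<in> borel_measurable M"
          by (rule point_sum_measurable[where N=borel]) measurable
        show "(\<lambda>\<omega>. D \<omega> * exp_neg (point_sum J (\<lambda>w. ennreal (t * w)) \<omega>)) \<in> borel_measurable M"
          by measurable
      qed
      also have "(\<integral>\<^sup>+\<omega>. D \<omega> * exp_neg (point_sum J (\<lambda>w. ennreal (t * w)) \<omega>) \<partial>M) =
          ennreal ((\<Prod>B\<in>P. \<kappa> (card B) t) * exp (- \<psi> t))"
        unfolding D_def by (rule distinct_sum_power_laplace[OF pp sf sets \<kappa> \<kappa>_nonneg \<psi> \<psi>_nonneg finP B(3) t])
      finally show ?thesis
        using t \<kappa>_nonneg B(3) by (simp add: prod_nonneg mult.assoc flip: ennreal_mult)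
    qed simp
  qed
  finally show ?thesis .
qed

subsection \<open>The stable and the Gamma case\<close>

lemma nn_integral_density_positive:
  fixes f \<rho> :: "real \<Rightarrow> real"
  assumes [measurable]: "\<rho> \<in> borel_measurable borel" "f \<in> borel_measurable borel"
    and \<rho>: "\<And>w. 0 < w \<Longrightarrow> 0 \<le> \<rho> w"
  shows "(\<integral>\<^sup>+w. ennreal (f w) \<partial>density (restrict_space lborel {0<..}) (\<lambda>w. ennreal (\<rho> w))) =
    (\<integral>\<^sup>+w. ennreal (\<rho> w * f w) * indicator {0<..} w \<partial>lborel)"
proof -
  have m: "h \<in> borel_measurable (restrict_space lborel {0<..})" if "h \<in> borel_measurable borel"
    for h :: "real \<Rightarrow> ennreal"
    using that by (intro measurable_restrict_space1) simp
  have "(\<integral>\<^sup>+w. ennreal (f w) \<partial>density (restrict_space lborel {0<..}) (\<lambda>w. ennreal (\<rho> w))) =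
      (\<integral>\<^sup>+w. ennreal (\<rho> w) * ennreal (f w) \<partial>restrict_space lborel {0<..})"
    by (rule nn_integral_density; rule m; measurable)
  also have "\<dots> = (\<integral>\<^sup>+w. ennreal (\<rho> w) * ennreal (f w) * indicator {0<..} w \<partial>lborel)"
    by (rule nn_integral_restrict_space) simp
  also have "\<dots> = (\<integral>\<^sup>+w. ennreal (\<rho> w * f w) * indicator {0<..} w \<partial>lborel)"
    by (intro nn_integral_cong) (auto simp: indicator_def ennreal_mult' \<rho>)
  finally show ?thesis .
qed

lemma sigma_finite_density_positive:
  assumes [measurable]: "\<rho> \<in> borel_measurable borel"
  shows "sigma_finite_measure (density (restrict_space lborel {0<..}) (\<lambda>w. ennreal (\<rho> (w::real))))"
proof -
  interpret R: sigma_finite_measure "restrict_space lborel {0<..} :: real measure"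
    by (rule sigma_finite_measure_restrict_space) (auto intro: lborel.sigma_finite_measure_axioms)
  have "(\<lambda>w. ennreal (\<rho> w)) \<in> borel_measurable (restrict_space lborel {0<..})"
    by (intro measurable_restrict_space1) simp
  then show ?thesis by (subst R.sigma_finite_iff_density_finite) auto
qed

section \<open>Poisson-Dirichlet weights from Gamma and Beta integrals\<close>

lemma rising_1_eq_pochhammer: "rising x m 1 = pochhammer x m"
  by (simp add: rising_def pochhammer_prod atLeast0LessThan)

text \<open>The shape of the leading factor of \<open>pd_prob\<close> for \<theta> = 0, where base
  and step are both \<alpha>.\<close>

lemma rising_self: "rising x m x = x ^ m * fact m"
proof -
  have "rising x m x = (\<Prod>j<m. x * (1 + real j))"
    unfolding rising_def by (intro prod.cong) (auto simp: algebra_simps)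
  also have "\<dots> = x ^ m * pochhammer 1 m"
    by (simp add: prod.distrib pochhammer_prod atLeast0LessThan)
  finally show ?thesis by (simp add: pochhammer_fact)
qed

text \<open>The shape of the leading factor of \<open>pd_prob\<close> for \<alpha> = 0.\<close>

lemma rising_0: "rising x m 0 = x ^ m"
  by (simp add: rising_def)

lemma pd_prob_partition:
  assumes "distinct bs" and P: "partition_on {1..n} (set bs)"
  shows "pd_prob \<alpha> \<theta> (map card bs) = rising (\<theta> + \<alpha>) (card (set bs) - 1) \<alpha> *
    (\<Prod>B\<in>set bs. pochhammer (1 - \<alpha>) (card B - 1)) / pochhammer (\<theta> + 1) (n - 1)"
proof -
  have fin: "finite B" if "B \<in> set bs" for B
  proof (rule finite_subset)
    show "B \<subseteq> {1..n}" using partition_onD1[OF P] that by auto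
  qed simp
  have "sum_list (map card bs) = (\<Sum>B\<in>set bs. card B)"
    using assms(1) by (simp add: sum_list_distinct_conv_sum_set)
  also have "\<dots> = n" using product_partition[OF P fin] by simp
  finally have "sum_list (map card bs) = n" .
  moreover have "(\<Prod>m\<leftarrow>map card bs. rising (1 - \<alpha>) (m - 1) 1) = (\<Prod>B\<in>set bs. pochhammer (1 - \<alpha>) (card B - 1))"
    using assms(1) by (simp add: rising_1_eq_pochhammer prod.distinct_set_conv_list o_def)
  ultimately show ?thesis
    using assms(1) by (simp add: pd_prob_def distinct_card rising_1_eq_pochhammer)
qed

text \<open>The block sizes sum to n, so for k blocks the powers of t combine to k \<alpha> - 1, and
  the integral is Gamma k / (\<alpha> * c ^ k) with c = Gamma (1 - \<alpha>). Since Gamma (m -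
  \<alpha>) is c times a rising factorial of 1 - \<alpha>, the factor c ^ k cancels; the division by
  \<alpha> leaves \<alpha> ^ (k - 1) * (k - 1)!, the leading factor of the weight.\<close>

lemma nn_integral_stable_pd:
  assumes \<alpha>: "0 < \<alpha>" "\<alpha> < 1" and n: "1 \<le> n" and bs: "distinct bs" and P: "partition_on {1..n} (set bs)"
  shows "(\<integral>\<^sup>+t. ennreal (t ^ (n - 1) / fact (n - 1) *
        (\<Prod>B\<in>set bs. \<alpha> * Gamma (real (card B) - \<alpha>) / t powr (real (card B) - \<alpha>)) *
        exp (- (Gamma (1 - \<alpha>) * t powr \<alpha>))) * indicator {0<..} t \<partial>lborel) =
    ennreal (pd_prob \<alpha> 0 (map card bs))"
proof -
  define k where "k = card (set bs)"
  define c where "c = Gamma (1 - \<alpha>)"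
  define A where "A = (\<Prod>B\<in>set bs. pochhammer (1 - \<alpha>) (card B - 1))"
  have c: "0 < c" using \<alpha> by (simp add: c_def Gamma_real_pos)
  have fin: "finite B" "1 \<le> card B" if "B \<in> set bs" for B
  proof -
    have "B \<subseteq> {1..n}" using partition_onD1[OF P] that by auto
    then show "finite B" by (rule finite_subset) simp
    moreover have "B \<noteq> {}" using partition_onD3[OF P] that by auto
    ultimately show "1 \<le> card B" by (simp add: Suc_le_eq card_gt_0_iff)
  qed
  have k: "1 \<le> k"
  proof -
    have "set bs \<noteq> {}" using partition_onD1[OF P] n by auto
    then show ?thesis by (simp add: k_def Suc_le_eq card_gt_0_iff)
  qed
  have n_sum: "(\<Sum>B\<in>set bs. real (card B)) = real n"
    using product_partition[OF P fin(1)] by (simp flip: of_nat_sum)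
  have Gam: "Gamma (real (card B) - \<alpha>) = c * pochhammer (1 - \<alpha>) (card B - 1)" if "B \<in> set bs" for B
  proof -
    have "1 - \<alpha> \<notin> \<int>\<^sub>\<le>\<^sub>0" using \<alpha> by (auto dest: nonpos_Ints_nonpos)
    from pochhammer_Gamma[OF this, of "card B - 1"] show ?thesis
      using c fin(2)[OF that] by (simp add: c_def[symmetric] field_simps of_nat_diff)
  qed
  have A: "0 \<le> A" unfolding A_def using \<alpha> by (intro prod_nonneg pochhammer_nonneg) auto
  define C where "C = \<alpha> ^ k * c ^ k * A / fact (n - 1)"
  have C: "0 \<le> C" using \<alpha> c A by (simp add: C_def)
  have "(\<integral>\<^sup>+t. ennreal (t ^ (n - 1) / fact (n - 1) *
        (\<Prod>B\<in>set bs. \<alpha> * Gamma (real (card B) - \<alpha>) / t powr (real (card B) - \<alpha>)) *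
        exp (- (Gamma (1 - \<alpha>) * t powr \<alpha>))) * indicator {0<..} t \<partial>lborel) =
      (\<integral>\<^sup>+t. ennreal C * (ennreal (t powr (real k * \<alpha> - 1) * exp (- (c * t powr \<alpha>))) * indicator {0<..} t) \<partial>lborel)"
  proof (rule nn_integral_cong)
    fix t :: real
    show "ennreal (t ^ (n - 1) / fact (n - 1) *
        (\<Prod>B\<in>set bs. \<alpha> * Gamma (real (card B) - \<alpha>) / t powr (real (card B) - \<alpha>)) *
        exp (- (Gamma (1 - \<alpha>) * t powr \<alpha>))) * indicator {0<..} t =
      ennreal C * (ennreal (t powr (real k * \<alpha> - 1) * exp (- (c * t powr \<alpha>))) * indicator {0<..} t)"
    proof (cases "0 < t")
      case t: True
      have "(\<Prod>B\<in>set bs. \<alpha> * Gamma (real (card B) - \<alpha>) / t powr (real (card B) - \<alpha>)) =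
          (\<Prod>B\<in>set bs. \<alpha> * c * pochhammer (1 - \<alpha>) (card B - 1)) / (\<Prod>B\<in>set bs. t powr (real (card B) - \<alpha>))"
        unfolding prod_dividef by (intro arg_cong2[where f="(/)"] prod.cong) (auto simp: Gam)
      also have "(\<Prod>B\<in>set bs. \<alpha> * c * pochhammer (1 - \<alpha>) (card B - 1)) = \<alpha> ^ k * c ^ k * A"
        by (simp add: prod.distrib k_def A_def power_mult_distrib)
      also have "(\<Prod>B\<in>set bs. t powr (real (card B) - \<alpha>)) = t powr (\<Sum>B\<in>set bs. real (card B) - \<alpha>)"
        using t by (intro powr_sum[symmetric]) auto
      also have "(\<Sum>B\<in>set bs. real (card B) - \<alpha>) = real n - real k * \<alpha>"
        by (simp add: sum_subtractf n_sum k_def)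
      finally have "(\<Prod>B\<in>set bs. \<alpha> * Gamma (real (card B) - \<alpha>) / t powr (real (card B) - \<alpha>)) =
          \<alpha> ^ k * c ^ k * A / t powr (real n - real k * \<alpha>)" .
      moreover have "t ^ (n - 1) = t powr (real n - real k * \<alpha>) * t powr (real k * \<alpha> - 1)"
        using t n by (simp add: powr_add[symmetric] of_nat_diff flip: powr_realpow)
      ultimately have "t ^ (n - 1) / fact (n - 1) *
        (\<Prod>B\<in>set bs. \<alpha> * Gamma (real (card B) - \<alpha>) / t powr (real (card B) - \<alpha>)) *
        exp (- (Gamma (1 - \<alpha>) * t powr \<alpha>)) = C * (t powr (real k * \<alpha> - 1) * exp (- (c * t powr \<alpha>)))"
        using t by (simp add: C_def c_def)
      then show ?thesis using t C by (simp add: ennreal_mult)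
    qed simp
  qed
  also have "\<dots> = ennreal C * ennreal (Gamma (real k) / (\<alpha> * c powr real k))"
    using nn_integral_powr_exp_powr[of \<alpha> c "real k"] \<alpha> c k by (subst nn_integral_cmult) auto
  also have "\<dots> = ennreal (pd_prob \<alpha> 0 (map card bs))"
  proof -
    have "pd_prob \<alpha> 0 (map card bs) = \<alpha> ^ (k - 1) * fact (k - 1) * A / fact (n - 1)"
      unfolding pd_prob_partition[OF bs P] by (simp add: rising_self A_def k_def pochhammer_fact)
    moreover have "Gamma (real k) = fact (k - 1)"
      using Gamma_fact[of "k - 1", where 'a=real] k by (simp add: of_nat_diff)
    moreover have "\<alpha> ^ k = \<alpha> * \<alpha> ^ (k - 1)" using k by (simp add: power_eq_if)
    ultimately have "C * (Gamma (real k) / (\<alpha> * c powr real k)) = pd_prob \<alpha> 0 (map card bs)"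
      using \<alpha> c by (simp add: C_def powr_realpow)
    then show ?thesis using C \<alpha> c k by (simp add: Gamma_real_pos less_imp_le flip: ennreal_mult)
  qed
  finally show ?thesis .
qed

text \<open>The blocks contribute (1 + t) ^ n in the denominator whatever their sizes, and the
  exponential is (1 + t) powr (- \<theta>), so the integral is the Beta function of n and \<theta>.
  Here Gamma n cancels (n - 1)!, and Gamma (n + \<theta>) / Gamma \<theta> is \<theta> times the
  rising factorial in the denominator of the weight; the extra \<theta> lowers \<theta> ^ k to
  \<theta> ^ (k - 1).\<close>

lemma nn_integral_gamma_pd:
  assumes \<theta>: "0 < \<theta>" and n: "1 \<le> n" and bs: "distinct bs" and P: "partition_on {1..n} (set bs)"
  shows "(\<integral>\<^sup>+t. ennreal (t ^ (n - 1) / fact (n - 1) *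
        (\<Prod>B\<in>set bs. \<theta> * fact (card B - 1) / (1 + t) ^ card B) *
        exp (- (\<theta> * ln (1 + t)))) * indicator {0<..} t \<partial>lborel) =
    ennreal (pd_prob 0 \<theta> (map card bs))"
proof -
  define k where "k = card (set bs)"
  define A where "A = (\<Prod>B\<in>set bs. fact (card B - 1) :: real)"
  have fin: "finite B" if "B \<in> set bs" for B
  proof (rule finite_subset)
    show "B \<subseteq> {1..n}" using partition_onD1[OF P] that by auto
  qed simp
  have k: "1 \<le> k"
  proof -
    have "set bs \<noteq> {}" using partition_onD1[OF P] n by auto
    then show ?thesis by (simp add: k_def Suc_le_eq card_gt_0_iff)
  qed
  have n_sum: "(\<Sum>B\<in>set bs. card B) = n"
    using product_partition[OF P fin] by simp
  have A: "0 \<le> A" unfolding A_def by (intro prod_nonneg) auto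
  define C where "C = \<theta> ^ k * A / fact (n - 1)"
  have C: "0 \<le> C" using \<theta> A by (simp add: C_def)
  have "(\<integral>\<^sup>+t. ennreal (t ^ (n - 1) / fact (n - 1) *
        (\<Prod>B\<in>set bs. \<theta> * fact (card B - 1) / (1 + t) ^ card B) *
        exp (- (\<theta> * ln (1 + t)))) * indicator {0<..} t \<partial>lborel) =
      (\<integral>\<^sup>+t. ennreal C * (ennreal (t powr (real n - 1) * (1 + t) powr (- (real n + \<theta>))) * indicator {0<..} t) \<partial>lborel)"
  proof (rule nn_integral_cong)
    fix t :: real
    show "ennreal (t ^ (n - 1) / fact (n - 1) *
        (\<Prod>B\<in>set bs. \<theta> * fact (card B - 1) / (1 + t) ^ card B) *
        exp (- (\<theta> * ln (1 + t)))) * indicator {0<..} t =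
      ennreal C * (ennreal (t powr (real n - 1) * (1 + t) powr (- (real n + \<theta>))) * indicator {0<..} t)"
    proof (cases "0 < t")
      case t: True
      have "(\<Prod>B\<in>set bs. \<theta> * fact (card B - 1) / (1 + t) ^ card B) = \<theta> ^ k * A / (1 + t) ^ n"
        by (simp add: prod_dividef prod.distrib k_def A_def n_sum flip: power_sum)
      moreover have "t ^ (n - 1) = t powr (real n - 1)"
        using t n by (simp add: of_nat_diff flip: powr_realpow)
      moreover have e: "exp (- (\<theta> * ln (1 + t))) / (1 + t) ^ n = (1 + t) powr (- (real n + \<theta>))"
      proof -
        have "(1 + t) powr (- (real n + \<theta>)) = (1 + t) powr (- real n) * (1 + t) powr (- \<theta>)"
          using t by (simp add: powr_add[symmetric])
        also have "(1 + t) powr (- real n) = 1 / (1 + t) ^ n"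
          using t by (simp add: powr_minus powr_realpow divide_inverse)
        also have "(1 + t) powr (- \<theta>) = exp (- (\<theta> * ln (1 + t)))" using t by (simp add: powr_def)
        finally show ?thesis by simp
      qed
      ultimately have "t ^ (n - 1) / fact (n - 1) *
        (\<Prod>B\<in>set bs. \<theta> * fact (card B - 1) / (1 + t) ^ card B) *
        exp (- (\<theta> * ln (1 + t))) = C * (t powr (real n - 1) * (1 + t) powr (- (real n + \<theta>)))"
        unfolding e[symmetric] by (simp add: C_def)
      then show ?thesis using t C by (simp add: ennreal_mult)
    qed simp
  qed
  also have "\<dots> = ennreal C * ennreal (Gamma (real n) * Gamma \<theta> / Gamma (real n + \<theta>))"
    using nn_integral_beta_prime[of "real n" \<theta>] \<theta> n by (subst nn_integral_cmult) auto
  also have "\<dots> = ennreal (pd_prob 0 \<theta> (map card bs))"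
  proof -
    have G\<theta>: "0 < Gamma \<theta>" using \<theta> by (rule Gamma_real_pos)
    have G0: "Gamma \<theta> \<noteq> 0" using G\<theta> by linarith
    have poch: "0 < pochhammer (\<theta> + 1) (n - 1)" using \<theta> by (intro pochhammer_pos) auto
    have "pd_prob 0 \<theta> (map card bs) = \<theta> ^ (k - 1) * A / pochhammer (\<theta> + 1) (n - 1)"
      unfolding pd_prob_partition[OF bs P] by (simp add: rising_0 A_def k_def pochhammer_fact)
    moreover have "Gamma (real n) = fact (n - 1)"
      using Gamma_fact[of "n - 1", where 'a=real] n by (simp add: of_nat_diff)
    moreover have "Gamma (real n + \<theta>) = \<theta> * pochhammer (\<theta> + 1) (n - 1) * Gamma \<theta>"
    proof -
      have "\<theta> \<notin> \<int>\<^sub>\<le>\<^sub>0" using \<theta> by (auto dest: nonpos_Ints_nonpos)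
      from pochhammer_Gamma[OF this, of n] have "Gamma (real n + \<theta>) = pochhammer \<theta> n * Gamma \<theta>"
        using G\<theta> by (simp add: add.commute)
      also have "pochhammer \<theta> n = \<theta> * pochhammer (\<theta> + 1) (n - 1)"
        using pochhammer_rec[of \<theta> "n - 1"] n by simp
      finally show ?thesis .
    qed
    moreover have "\<theta> ^ k = \<theta> * \<theta> ^ (k - 1)" using k by (simp add: power_eq_if)
    ultimately have "C * (Gamma (real n) * Gamma \<theta> / Gamma (real n + \<theta>)) = pd_prob 0 \<theta> (map card bs)"
      using \<theta> G0 poch by (simp add: C_def)
    moreover have "0 \<le> Gamma (real n) * Gamma \<theta> / Gamma (real n + \<theta>)"
      using n \<theta> by (simp add: Gamma_real_pos less_imp_le)
    ultimately show ?thesis using C by (simp flip: ennreal_mult)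
  qed
  finally show ?thesis .
qed

text \<open>Going back from \<open>ennreal\<close> to real probabilities needs nonnegative weights,
  since \<open>ennreal\<close> would hide a negative one.\<close>

lemma pd_partitionI:
  fixes X :: "'a \<Rightarrow> nat set set"
  assumes "prob_space M" and "0 \<le> \<alpha>" "\<alpha> < 1" "- \<alpha> < \<theta>"
    and "X \<in> measurable M (count_space {P. partition_on {1..n} P})"
    and em: "\<And>bs. distinct bs \<Longrightarrow> partition_on {1..n} (set bs) \<Longrightarrow>
      emeasure M {\<omega>\<in>space M. X \<omega> = set bs} = ennreal (pd_prob \<alpha> \<theta> (map card bs))"
  shows "pd_partition M \<alpha> \<theta> n X"
proof -
  interpret prob_space M by fact
  have "measure M {\<omega>\<in>space M. X \<omega> = set bs} = pd_prob \<alpha> \<theta> (map card bs)"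
    if bs: "distinct bs" "partition_on {1..n} (set bs)" for bs
  proof -
    have "0 \<le> pd_prob \<alpha> \<theta> (map card bs)"
      unfolding pd_prob_partition[OF bs] rising_def
      using assms(2-4)
      by (intro divide_nonneg_nonneg mult_nonneg_nonneg prod_nonneg pochhammer_nonneg)
         (auto intro!: add_nonneg_nonneg)
    then show ?thesis using em[OF bs] by (simp add: emeasure_eq_measure)
  qed
  then show ?thesis using assms by (simp add: pd_partition_def)
qed

text \<open>The moments are Gamma integrals of exponent m - \<alpha>, positive because m \<ge> 1 >
  \<alpha>. The Laplace exponent is the integral of the first moment, \<alpha> * Gamma (1 -
  \<alpha>) * u powr (\<alpha> - 1), over u up to t.\<close>

lemma stable_levy_integrals:
  assumes \<alpha>: "0 < \<alpha>" "\<alpha> < 1" and sets: "sets \<nu> = sets (restrict_space borel {0<..})"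
    and \<nu>: "\<nu> = density (restrict_space lborel {0<..}) (\<lambda>w. ennreal (\<alpha> * w powr (- \<alpha> - 1)))"
    and t: "0 < t"
  shows "1 \<le> m \<Longrightarrow> (\<integral>\<^sup>+w. ennreal (w ^ m * exp (- (t * w))) \<partial>\<nu>) =
      ennreal (\<alpha> * Gamma (real m - \<alpha>) / t powr (real m - \<alpha>))"
    and "(\<integral>\<^sup>+w. ennreal (1 - exp (- (t * w))) \<partial>\<nu>) = ennreal (Gamma (1 - \<alpha>) * t powr \<alpha>)"
proof -
  \<comment> \<open>For all positive u and not just for t, since the second claim integrates the
    first moment over u.\<close>
  have moment: "(\<integral>\<^sup>+w. ennreal (w ^ m * exp (- (u * w))) \<partial>\<nu>) =
      ennreal (\<alpha> * Gamma (real m - \<alpha>) / u powr (real m - \<alpha>))" if "1 \<le> m" "0 < u" for m u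
  proof -
    have "(\<integral>\<^sup>+w. ennreal (w ^ m * exp (- (u * w))) \<partial>\<nu>) =
        (\<integral>\<^sup>+w. ennreal (\<alpha> * w powr (- \<alpha> - 1) * (w ^ m * exp (- (u * w)))) * indicator {0<..} w \<partial>lborel)"
      unfolding \<nu> using \<alpha> by (intro nn_integral_density_positive) auto
    also have "\<dots> = (\<integral>\<^sup>+w. ennreal \<alpha> * (ennreal (w powr (real m - \<alpha> - 1) * exp (- (u * w))) * indicator {0<..} w) \<partial>lborel)"
    proof (rule nn_integral_cong)
      fix w :: real
      have "\<alpha> * w powr (- \<alpha> - 1) * (w ^ m * exp (- (u * w))) = \<alpha> * (w powr (real m - \<alpha> - 1) * exp (- (u * w)))"
        if "0 < w"
      proof -
        have "w powr (real m - \<alpha> - 1) = w powr (- \<alpha> - 1) * w ^ m"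
          using that by (simp add: powr_add[symmetric] algebra_simps flip: powr_realpow)
        then show ?thesis by simp
      qed
      then show "ennreal (\<alpha> * w powr (- \<alpha> - 1) * (w ^ m * exp (- (u * w)))) * indicator {0<..} w =
          ennreal \<alpha> * (ennreal (w powr (real m - \<alpha> - 1) * exp (- (u * w))) * indicator {0<..} w)"
        using \<alpha> by (cases "0 < w") (simp_all flip: ennreal_mult')
    qed
    also have "\<dots> = ennreal \<alpha> * ennreal (Gamma (real m - \<alpha>) / u powr (real m - \<alpha>))"
      using nn_integral_gamma[of "real m - \<alpha>" u] \<alpha> that by (subst nn_integral_cmult) auto
    also have "\<dots> = ennreal (\<alpha> * Gamma (real m - \<alpha>) / u powr (real m - \<alpha>))"
      using \<alpha> by (simp flip: ennreal_mult')
    finally show ?thesis .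
  qed
  then show "1 \<le> m \<Longrightarrow> (\<integral>\<^sup>+w. ennreal (w ^ m * exp (- (t * w))) \<partial>\<nu>) =
      ennreal (\<alpha> * Gamma (real m - \<alpha>) / t powr (real m - \<alpha>))" using t by blast
  have G: "0 < Gamma (1 - \<alpha>)" using \<alpha> by (simp add: Gamma_real_pos)
  have "sigma_finite_measure \<nu>" unfolding \<nu> by (rule sigma_finite_density_positive) simp
  from nn_integral_one_minus_exp[OF this sets t]
  have "(\<integral>\<^sup>+w. ennreal (1 - exp (- (t * w))) \<partial>\<nu>) =
      (\<integral>\<^sup>+u. (\<integral>\<^sup>+w. ennreal (w * exp (- (u * w))) \<partial>\<nu>) * indicator {0<..t} u \<partial>lborel)" .
  also have "\<dots> = (\<integral>\<^sup>+u. ennreal (\<alpha> * Gamma (1 - \<alpha>)) * ennreal (indicator {0..t} u * u powr (\<alpha> - 1)) \<partial>lborel)"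
  proof (rule nn_integral_cong_AE, rule AE_mp[OF AE_lborel_singleton[of 0]], rule AE_I2, rule impI)
    fix u :: real assume "u \<noteq> 0"
    show "(\<integral>\<^sup>+w. ennreal (w * exp (- (u * w))) \<partial>\<nu>) * indicator {0<..t} u =
        ennreal (\<alpha> * Gamma (1 - \<alpha>)) * ennreal (indicator {0..t} u * u powr (\<alpha> - 1))"
    proof (cases "0 < u \<and> u \<le> t")
      case True
      have "1 / u powr (1 - \<alpha>) = u powr (\<alpha> - 1)" by (simp add: powr_minus_divide[symmetric])
      then have "\<alpha> * Gamma (1 - \<alpha>) / u powr (1 - \<alpha>) = \<alpha> * Gamma (1 - \<alpha>) * u powr (\<alpha> - 1)"
        by (metis mult.right_neutral times_divide_eq_right)
      then show ?thesis using True moment[of 1 u] \<alpha> G by (simp flip: ennreal_mult)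
    qed (use \<open>u \<noteq> 0\<close> in \<open>auto simp: indicator_def\<close>)
  qed
  also have "\<dots> = ennreal (\<alpha> * Gamma (1 - \<alpha>)) * ennreal (t powr \<alpha> / \<alpha>)"
  proof (subst nn_integral_cmult)
    \<comment> \<open>The singularity at 0 is integrable because \<alpha> > 0.\<close>
    have "((\<lambda>u. u powr (\<alpha> - 1)) has_integral t powr (\<alpha> - 1 + 1) / (\<alpha> - 1 + 1)) {0..t}"
      using \<alpha> t by (intro has_integral_powr_from_0) auto
    from nn_integral_has_integral_lebesgue[OF _ this]
    show "ennreal (\<alpha> * Gamma (1 - \<alpha>)) * (\<integral>\<^sup>+u. ennreal (indicator {0..t} u * u powr (\<alpha> - 1)) \<partial>lborel) =
        ennreal (\<alpha> * Gamma (1 - \<alpha>)) * ennreal (t powr \<alpha> / \<alpha>)" by simp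
  qed simp
  also have "\<dots> = ennreal (Gamma (1 - \<alpha>) * t powr \<alpha>)"
    using \<alpha> G by (simp flip: ennreal_mult)
  finally show "(\<integral>\<^sup>+w. ennreal (1 - exp (- (t * w))) \<partial>\<nu>) = ennreal (Gamma (1 - \<alpha>) * t powr \<alpha>)" .
qed

text \<open>The factor exp (- w) of the density shifts the rate u to 1 + u, and the factor 1 / w
  lowers the power, so the moments are Gamma integrals at integers. The first moment \<theta> / (1 +
  u) integrates to the logarithm.\<close>

lemma gamma_levy_integrals:
  assumes \<theta>: "0 < \<theta>" and sets: "sets \<nu> = sets (restrict_space borel {0<..})"
    and \<nu>: "\<nu> = density (restrict_space lborel {0<..}) (\<lambda>w. ennreal (\<theta> * inverse w * exp (- w)))"
    and t: "0 < t"
  shows "1 \<le> m \<Longrightarrow> (\<integral>\<^sup>+w. ennreal (w ^ m * exp (- (t * w))) \<partial>\<nu>) =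
      ennreal (\<theta> * fact (m - 1) / (1 + t) ^ m)"
    and "(\<integral>\<^sup>+w. ennreal (1 - exp (- (t * w))) \<partial>\<nu>) = ennreal (\<theta> * ln (1 + t))"
proof -
  have moment: "(\<integral>\<^sup>+w. ennreal (w ^ m * exp (- (u * w))) \<partial>\<nu>) = ennreal (\<theta> * fact (m - 1) / (1 + u) ^ m)"
    if "1 \<le> m" "0 < u" for m :: nat and u
  proof -
    have "(\<integral>\<^sup>+w. ennreal (w ^ m * exp (- (u * w))) \<partial>\<nu>) =
        (\<integral>\<^sup>+w. ennreal (\<theta> * inverse w * exp (- w) * (w ^ m * exp (- (u * w)))) * indicator {0<..} w \<partial>lborel)"
      unfolding \<nu> using \<theta> by (intro nn_integral_density_positive) auto
    also have "\<dots> = (\<integral>\<^sup>+w. ennreal \<theta> * (ennreal (w ^ (m - 1) * exp (- ((1 + u) * w))) * indicator {0<..} w) \<partial>lborel)"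
    proof (rule nn_integral_cong)
      fix w :: real
      have "\<theta> * inverse w * exp (- w) * (w ^ m * exp (- (u * w))) = \<theta> * (w ^ (m - 1) * exp (- ((1 + u) * w)))"
        if "0 < w"
      proof -
        have "w ^ m = w * w ^ (m - 1)" using \<open>1 \<le> m\<close> by (simp add: power_eq_if)
        moreover have "exp (- ((1 + u) * w)) = exp (- w) * exp (- (u * w))"
          by (simp add: mult_exp_exp algebra_simps)
        ultimately show ?thesis using that by simp
      qed
      then show "ennreal (\<theta> * inverse w * exp (- w) * (w ^ m * exp (- (u * w)))) * indicator {0<..} w =
          ennreal \<theta> * (ennreal (w ^ (m - 1) * exp (- ((1 + u) * w))) * indicator {0<..} w)"
        using \<theta> by (cases "0 < w") (simp_all flip: ennreal_mult')
    qed
    also have "\<dots> = ennreal \<theta> * ennreal (fact (m - 1) / (1 + u) ^ m)"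
      using nn_integral_gamma_nat[of m "1 + u"] that by (subst nn_integral_cmult) auto
    also have "\<dots> = ennreal (\<theta> * fact (m - 1) / (1 + u) ^ m)"
      using \<theta> by (simp flip: ennreal_mult')
    finally show ?thesis .
  qed
  then show "1 \<le> m \<Longrightarrow> (\<integral>\<^sup>+w. ennreal (w ^ m * exp (- (t * w))) \<partial>\<nu>) =
      ennreal (\<theta> * fact (m - 1) / (1 + t) ^ m)" using t by blast
  have "sigma_finite_measure \<nu>" unfolding \<nu> by (rule sigma_finite_density_positive) simp
  from nn_integral_one_minus_exp[OF this sets t]
  have "(\<integral>\<^sup>+w. ennreal (1 - exp (- (t * w))) \<partial>\<nu>) =
      (\<integral>\<^sup>+u. (\<integral>\<^sup>+w. ennreal (w * exp (- (u * w))) \<partial>\<nu>) * indicator {0<..t} u \<partial>lborel)" .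
  also have "\<dots> = (\<integral>\<^sup>+u. ennreal (\<theta> / (1 + u)) * indicator {0..t} u \<partial>lborel)"
  \<comment> \<open>The two intervals differ at u = 0, a null set; the closed one suits the
    fundamental theorem of calculus.\<close>
  proof (rule nn_integral_cong_AE, rule AE_mp[OF AE_lborel_singleton[of 0]], rule AE_I2, rule impI)
    fix u :: real assume "u \<noteq> 0"
    then show "(\<integral>\<^sup>+w. ennreal (w * exp (- (u * w))) \<partial>\<nu>) * indicator {0<..t} u =
        ennreal (\<theta> / (1 + u)) * indicator {0..t} u"
      using moment[of 1 u] by (cases "0 < u \<and> u \<le> t") (auto simp: indicator_def)
  qed
  also have "\<dots> = ennreal (\<theta> * ln (1 + t) - \<theta> * ln (1 + 0))"
  proof (rule nn_integral_FTC_Icc)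
    show "((\<lambda>u. \<theta> * ln (1 + u)) has_real_derivative \<theta> / (1 + u)) (at u)" if "u \<in> {0..t}" for u
      using that by (auto intro!: derivative_eq_intros)
  qed (use t \<theta> in auto)
  finally show "(\<integral>\<^sup>+w. ennreal (1 - exp (- (t * w))) \<partial>\<nu>) = ennreal (\<theta> * ln (1 + t))" by simp
qed

theorem corollary2p4:
  fixes M :: "'a measure" and \<nu> :: "real measure" and n :: nat and \<sigma> :: "nat \<Rightarrow> real"
    and J :: "nat \<Rightarrow> 'a \<Rightarrow> real" and Y :: "nat \<Rightarrow> nat \<Rightarrow> 'a \<Rightarrow> real"
  assumes "prob_space M"
    and "sets \<nu> = sets (restrict_space borel {0<..})"
    and "1 \<le> n"
    and "\<And>k. k \<in> {1..n} \<Longrightarrow> 0 < \<sigma> k"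
    and "poisson_process_enumeration M \<nu> J"
    and "prob_space.indep_vars M (\<lambda>_. \<Pi>\<^sub>M k\<in>{1..n}. borel) (\<lambda>l \<omega>. \<lambda>k\<in>{1..n}. Y l k \<omega>) UNIV"
    and "\<And>l m. distr M (\<Pi>\<^sub>M k\<in>{1..n}. borel) (\<lambda>\<omega>. \<lambda>k\<in>{1..n}. Y l k \<omega>) =
                distr M (\<Pi>\<^sub>M k\<in>{1..n}. borel) (\<lambda>\<omega>. \<lambda>k\<in>{1..n}. Y m k \<omega>)"
    and "indep_rvs M
           (\<Pi>\<^sub>M l\<in>UNIV. \<nu>) (\<lambda>\<omega> l. J l \<omega>)
           (\<Pi>\<^sub>M l\<in>UNIV. \<Pi>\<^sub>M k\<in>{1..n}. borel) (\<lambda>\<omega> l. \<lambda>k\<in>{1..n}. Y l k \<omega>)"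
    and "\<And>l. prob_space.indep_vars M (\<lambda>_. borel) (Y l) {1..n}"
    and "\<And>l k. k \<in> {1..n} \<Longrightarrow> frechet1 M (\<sigma> k) (Y l k)"
  shows "(\<forall>\<alpha>. 0 < \<alpha> \<and> \<alpha> < 1 \<and>
            \<nu> = density (restrict_space lborel {0<..}) (\<lambda>w. ennreal (\<alpha> * w powr (- \<alpha> - 1)))
            \<longrightarrow> pd_partition M \<alpha> 0 n (hitting_partition n J Y)) \<and>
         (\<forall>\<theta>. 0 < \<theta> \<and>
            \<nu> = density (restrict_space lborel {0<..}) (\<lambda>w. ennreal (\<theta> * inverse w * exp (- w)))
            \<longrightarrow> pd_partition M 0 \<theta> n (hitting_partition n J Y))"
proof -
  interpret prob_space M by fact
  have pp: "poisson_points M \<nu> J"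
    using assms(5) by unfold_locales
  interpret poisson_points M \<nu> J by (rule pp)
  have Jm: "J l \<in> borel_measurable M" for l
    by (rule measurable_compose[OF points_measurable borel_measurable_on_positive[OF assms(2)]]) simp
  have meas: "hitting_partition n J Y \<in> measurable M (count_space {P. partition_on {1..n} P})"
    using assms(10) by (intro hitting_partition_measurable Jm) (simp add: frechet1_def)
  show ?thesis
  proof (intro conjI allI impI; elim conjE)
    fix \<alpha> :: real
    assume \<alpha>: "0 < \<alpha>" "\<alpha> < 1"
      and \<nu>: "\<nu> = density (restrict_space lborel {0<..}) (\<lambda>w. ennreal (\<alpha> * w powr (- \<alpha> - 1)))"
    have sf: "sigma_finite_measure \<nu>" unfolding \<nu> by (rule sigma_finite_density_positive) simp
    note levy = stable_levy_integrals[OF \<alpha> assms(2) \<nu>]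
    show "pd_partition M \<alpha> 0 n (hitting_partition n J Y)"
    proof (rule pd_partitionI[OF assms(1) _ _ _ meas])
      fix bs assume bs: "distinct bs" "partition_on {1..n} (set bs)"
      \<comment> \<open>The limit behind the almost sure summability of the points.\<close>
      have "((\<lambda>t. Gamma (1 - \<alpha>) * t powr \<alpha>) \<longlongrightarrow> 0) (at_right 0)"
        using \<alpha> by real_asymp
      then show "emeasure M {\<omega>\<in>space M. hitting_partition n J Y \<omega> = set bs} = ennreal (pd_prob \<alpha> 0 (map card bs))"
        \<comment> \<open>Turns the weight back into an integral over t, so that
          \<open>emeasure_hitting_partition\<close> applies with \<kappa> and \<psi> read off from
          \<open>levy\<close>.\<close>
        unfolding nn_integral_stable_pd[OF \<alpha> assms(3) bs, symmetric]
        using \<alpha>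
        by (intro emeasure_hitting_partition[OF pp sf assms(2,3,4,6,8,9,10) levy(1) _ levy(2)] bs)
           (auto simp: Gamma_real_pos less_imp_le)
    qed (use \<alpha> in auto)
  next
    fix \<theta> :: real
    assume \<theta>: "0 < \<theta>"
      and \<nu>: "\<nu> = density (restrict_space lborel {0<..}) (\<lambda>w. ennreal (\<theta> * inverse w * exp (- w)))"
    have sf: "sigma_finite_measure \<nu>" unfolding \<nu> by (rule sigma_finite_density_positive) simp
    note levy = gamma_levy_integrals[OF \<theta> assms(2) \<nu>]
    show "pd_partition M 0 \<theta> n (hitting_partition n J Y)"
    proof (rule pd_partitionI[OF assms(1) _ _ _ meas])
      fix bs assume bs: "distinct bs" "partition_on {1..n} (set bs)"
      have "((\<lambda>t. \<theta> * ln (1 + t)) \<longlongrightarrow> 0) (at_right 0)" by real_asymp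
      then show "emeasure M {\<omega>\<in>space M. hitting_partition n J Y \<omega> = set bs} = ennreal (pd_prob 0 \<theta> (map card bs))"
        \<comment> \<open>As in the stable case, now with the rational moments and the logarithmic
          exponent.\<close>
        unfolding nn_integral_gamma_pd[OF \<theta> assms(3) bs, symmetric]
        using \<theta>
        by (intro emeasure_hitting_partition[OF pp sf assms(2,3,4,6,8,9,10) levy(1) _ levy(2)] bs) auto
    qed (use \<theta> in auto)
  qed
qed

end
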